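(* The following identities hold, and are equivalent: (1) $\displaystyle (E-1)[Lie^{(2)}]=\Big(\sum_{r\geq 1} e_r\Big)[Lie^{(2)}]=\sum_{n\geq 1} p_1^n$. (2) $\displaystyle (1-H^{\pm})[Lie^{(2)}]=\Big(\sum_{r\geq 1} (-1)^{r-1} h_r\Big)[Lie^{(2)}]=p_1$. (3) $\displaystyle (1-H^{\pm})[Lie_{\geq 2}^{(2)}]=\Big(\sum_{r\geq 1} (-1)^{r-1} h_r\Big)[Lie_{\geq 2}^{(2)}]=\omega(\kappa)$; equivalently, for every $n\ge2$, the degree $n$ term of $\sum_{r\geq 0} (-1)^{r} h_{n-r}[Lie_{\geq 2}^{(2)}]$ is $(-1)^{n-1} s_{(2,1^{n-2})}$. (4) $Lie_{\geq 2}^{(2)}=Lie^{(2)}[\omega(\kappa)]$. (5) $Lie_{\geq 2}^{(2)}=\omega(\kappa)+\omega(\kappa)[\omega(\kappa)]+\omega(\kappa)[\omega(\kappa)[\omega(\kappa)]]+\cdots$. (6) $\displaystyle (E-1)[Lie^{(2)}_{\geq 2}]=\sum_{r\geq 1} e_r[Lie^{(2)}_{\geq 2}]=(1-p_1)^{-1}\cdot H^{\pm}-1=\sum_{n\geq 2}\sum_{k=0}^n (-1)^k p_1^{n-k}h_k$.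
   Context: Work in the (completed) ring of symmetric functions; $h_n,e_n,p_n,s_\lambda$ are the complete homogeneous, elementary, power-sum and Schur functions, $\omega$ is the involution with $\omega(h_n)=e_n$ (applied termwise to series), $f[g]$ is plethysm. $E=\sum_{r\ge0}e_r$, $H^{\pm}=\sum_{r\ge0}(-1)^rh_r$. Let $C_n\subset S_n$ be the cyclic group generated by an $n$-cycle and let $2^{k_n}$ be the largest power of $2$ dividing $n$. $Lie_n^{(2)}$ is the Frobenius characteristic of the $S_n$-module induced from the linear character of $C_n$ sending the generator to $\exp(\frac{2\pi i}{n}\cdot 2^{k_n})$; $Lie^{(2)}=\sum_{n\ge1}Lie_n^{(2)}$ and $Lie^{(2)}_{\ge2}=\sum_{n\ge2}Lie_n^{(2)}$. $\kappa=\sum_{n\ge2}s_{(n-1,1)}$, so that $\omega(\kappa)=\sum_{n\ge2}s_{(2,1^{n-2})}$. *)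

theory Defs
  imports
    "HOL-Analysis.Infinite_Sum"
    "HOL-Combinatorics.Orbits"
    "HOL-Algebra.Sym_Groups"
    "HOL-Algebra.Left_Coset"
begin

section \<open>Formal power series in countably many variables\<close>

text \<open>
  A series in the variables \<open>x\<^sub>0, x\<^sub>1, \<dots>\<close> is its family of coefficients, where the
  monomial with exponents \<open>count M\<close> is represented by the multiset \<open>M\<close> of variable indices.
  The degree of the monomial is \<open>size M\<close>.  The degree of a series need not be bounded, so that the
  symmetric ones among these series form the completed ring of symmetric functions.
  The coefficients are complex since Frobenius characteristics are defined through complex
  characters.
\<close>

typedef mseries = "UNIV :: (nat multiset \<Rightarrow> complex) set"
  morphisms coeff Abs_mseries by simp

setup_lifting type_definition_mseries

lemma mseries_eq_iff: "f = g \<longleftrightarrow> (\<forall>M. coeff f M = coeff g M)"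
  by (simp add: coeff_inject[symmetric] fun_eq_iff)

lemma mseries_eqI: "(\<And>M. coeff f M = coeff g M) \<Longrightarrow> f = g"
  by (simp add: mseries_eq_iff)

lemma finite_mset_splittings: "finite {(A, B). A + B = (M :: 'a multiset)}"
proof -
  have "finite (mset ` {xs. set xs \<subseteq> set_mset M \<and> length xs \<le> size M})" (is "finite ?S")
    by (intro finite_imageI finite_lists_length_le) simp
  moreover have "{(A, B). A + B = M} \<subseteq> ?S \<times> ?S"
  proof safe
    fix A B assume M: "M = A + B"
    obtain xs ys where "A = mset xs" "B = mset ys" by (metis ex_mset)
    with M show "A \<in> mset ` {xs. set xs \<subseteq> set_mset (A + B) \<and> length xs \<le> size (A + B)}"
      "B \<in> mset ` {xs. set xs \<subseteq> set_mset (A + B) \<and> length xs \<le> size (A + B)}" by auto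
  qed
  ultimately show ?thesis by (meson finite_SigmaI finite_subset)
qed

instantiation mseries :: comm_ring_1
begin

lift_definition zero_mseries :: mseries is "\<lambda>_. 0" .
lift_definition one_mseries :: mseries is "\<lambda>M. if M = {#} then 1 else 0" .
lift_definition plus_mseries :: "mseries \<Rightarrow> mseries \<Rightarrow> mseries" is "\<lambda>f g M. f M + g M" .
lift_definition minus_mseries :: "mseries \<Rightarrow> mseries \<Rightarrow> mseries" is "\<lambda>f g M. f M - g M" .
lift_definition uminus_mseries :: "mseries \<Rightarrow> mseries" is "\<lambda>f M. - f M" .
lift_definition times_mseries :: "mseries \<Rightarrow> mseries \<Rightarrow> mseries"
  is "\<lambda>f g M. \<Sum>(A, B) | A + B = M. f A * g B" .

instance
proof
  fix f g k :: mseries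
  show "f * g * k = f * (g * k)"
  proof (rule mseries_eqI)
    fix M
    let ?S = "\<lambda>M. {(A, B). A + B = (M :: nat multiset)}"
    have fin: "finite (?S N)" for N by (rule finite_mset_splittings)
    have "coeff (f * g * k) M =
        (\<Sum>x \<in> ?S M. \<Sum>y \<in> ?S (fst x). coeff f (fst y) * coeff g (snd y) * coeff k (snd x))"
      by (simp add: times_mseries.rep_eq sum_distrib_right case_prod_unfold)
    also have "\<dots> = (\<Sum>(x, y) \<in> Sigma (?S M) (\<lambda>x. ?S (fst x)).
        coeff f (fst y) * coeff g (snd y) * coeff k (snd x))"
      by (rule sum.Sigma, rule fin, rule ballI, rule fin)
    also have "\<dots> = (\<Sum>(x, y) \<in> Sigma (?S M) (\<lambda>x. ?S (snd x)).
        coeff f (fst x) * (coeff g (fst y) * coeff k (snd y)))"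
      by (rule sum.reindex_bij_witness
          [of _ "\<lambda>(x, y). ((fst x + fst y, snd y), (fst x, fst y))"
                "\<lambda>(x, y). ((fst y, snd y + snd x), (snd y, snd x))"])
        (auto simp: add.assoc mult.assoc)
    also have "\<dots> = (\<Sum>x \<in> ?S M. \<Sum>y \<in> ?S (snd x).
        coeff f (fst x) * (coeff g (fst y) * coeff k (snd y)))"
      by (rule sum.Sigma[symmetric], rule fin, rule ballI, rule fin)
    also have "\<dots> = coeff (f * (g * k)) M"
      by (simp add: times_mseries.rep_eq sum_distrib_left case_prod_unfold)
    finally show "coeff (f * g * k) M = coeff (f * (g * k)) M" .
  qed
  show "f * g = g * f"
  proof (rule mseries_eqI)
    fix M
    show "coeff (f * g) M = coeff (g * f) M"
      unfolding times_mseries.rep_eq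
      by (rule sum.reindex_bij_witness[of _ "\<lambda>(A, B). (B, A)" "\<lambda>(A, B). (B, A)"])
        (auto simp: add.commute mult.commute)
  qed
  show "1 * f = f"
  proof (rule mseries_eqI)
    fix M
    have "coeff (1 * f) M = (\<Sum>(A, B) \<in> {({#} :: nat multiset, M)}. (if A = {#} then 1 else 0) * coeff f B)"
      unfolding times_mseries.rep_eq one_mseries.rep_eq
      by (rule sum.mono_neutral_right) (auto simp: finite_mset_splittings split: if_splits)
    thus "coeff (1 * f) M = coeff f M" by simp
  qed
  show "(f + g) * k = f * k + g * k"
    by (rule mseries_eqI)
      (simp add: times_mseries.rep_eq plus_mseries.rep_eq case_prod_unfold distrib_right sum.distrib)
  show "(0 :: mseries) \<noteq> 1"
    by (auto simp: mseries_eq_iff zero_mseries.rep_eq one_mseries.rep_eq)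
qed (auto simp: mseries_eq_iff zero_mseries.rep_eq plus_mseries.rep_eq minus_mseries.rep_eq
       uminus_mseries.rep_eq)

end

text \<open>
  The topology is that of coefficientwise convergence for the discrete topology on the
  coefficients, so that a family has a sum in the sense of \<^const>\<open>HAS_SUM\<close> if and only if every
  monomial occurs in only finitely many of its members.
\<close>

instantiation mseries :: t2_space
begin

definition open_mseries :: "mseries set \<Rightarrow> bool" where
  "open_mseries U \<longleftrightarrow>
     (\<forall>f\<in>U. \<exists>S. finite S \<and> (\<forall>g. (\<forall>M\<in>S. coeff g M = coeff f M) \<longrightarrow> g \<in> U))"

instance
proof
  show "open (UNIV :: mseries set)"
    by (auto simp: open_mseries_def)
next
  fix U V :: "mseries set"
  assume U: "open U" and V: "open V"
  show "open (U \<inter> V)"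
    unfolding open_mseries_def
  proof
    fix f assume f: "f \<in> U \<inter> V"
    obtain S where S: "finite S" "\<forall>g. (\<forall>M\<in>S. coeff g M = coeff f M) \<longrightarrow> g \<in> U"
      using bspec[OF U[unfolded open_mseries_def]] f by (metis IntD1)
    obtain T where T: "finite T" "\<forall>g. (\<forall>M\<in>T. coeff g M = coeff f M) \<longrightarrow> g \<in> V"
      using bspec[OF V[unfolded open_mseries_def]] f by (metis IntD2)
    show "\<exists>S. finite S \<and> (\<forall>g. (\<forall>M\<in>S. coeff g M = coeff f M) \<longrightarrow> g \<in> U \<inter> V)"
      using S T by (intro exI[of _ "S \<union> T"]) simp
  qed
next
  fix K :: "mseries set set"
  assume "\<forall>U\<in>K. open U"
  thus "open (\<Union>K)"
    unfolding open_mseries_def by (simp add: Bex_def) metis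
next
  fix f g :: mseries
  assume "f \<noteq> g"
  then obtain M where "coeff f M \<noteq> coeff g M" by (auto simp: mseries_eq_iff)
  moreover have "open {k. coeff k M = a}" for a
    unfolding open_mseries_def by (auto intro!: exI[of _ "{M}"])
  ultimately show "\<exists>U V. open U \<and> open V \<and> f \<in> U \<and> g \<in> V \<and> U \<inter> V = {}"
    by (intro exI[of _ "{k. coeff k M = coeff f M}"] exI[of _ "{k. coeff k M = coeff g M}"]) auto
qed

end

lemma has_sum_mseries_iff:
  fixes f :: "'i \<Rightarrow> mseries"
  shows "(f has_sum s) A \<longleftrightarrow>
    (\<forall>M. finite {i \<in> A. coeff (f i) M \<noteq> 0} \<and>
         coeff s M = (\<Sum>i | i \<in> A \<and> coeff (f i) M \<noteq> 0. coeff (f i) M))"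
    (is "?L \<longleftrightarrow> ?R")
proof
  have coeff_sum: "coeff (sum f X) M = (\<Sum>i\<in>X. coeff (f i) M)" for X M
    by (induction X rule: infinite_finite_induct)
      (auto simp: zero_mseries.rep_eq plus_mseries.rep_eq)
  {
    assume ?L
    show ?R
    proof
      fix M
      have "open {k. coeff k M = coeff s M}"
        unfolding open_mseries_def by (auto intro!: exI[of _ "{M}"])
      with \<open>?L\<close> have "eventually (\<lambda>X. sum f X \<in> {k. coeff k M = coeff s M}) (finite_subsets_at_top A)"
        unfolding has_sum_def by (rule topological_tendstoD) simp
      then obtain X where X: "finite X" "X \<subseteq> A"
        "\<And>Y. finite Y \<Longrightarrow> X \<subseteq> Y \<Longrightarrow> Y \<subseteq> A \<Longrightarrow> coeff (sum f Y) M = coeff s M"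
        unfolding eventually_finite_subsets_at_top mem_Collect_eq by (elim exE conjE) simp
      have *: "{i \<in> A. coeff (f i) M \<noteq> 0} \<subseteq> X"
      proof (rule subsetI, rule ccontr)
        fix i assume i: "i \<in> {i \<in> A. coeff (f i) M \<noteq> 0}" "i \<notin> X"
        have "coeff (sum f (insert i X)) M = coeff s M" "coeff (sum f X) M = coeff s M"
          using i X(1,2) by (intro X(3); auto)+
        with i X(1) show False by (simp add: coeff_sum plus_mseries.rep_eq)
      qed
      hence "coeff s M = (\<Sum>i | i \<in> A \<and> coeff (f i) M \<noteq> 0. coeff (f i) M)"
        unfolding X(3)[OF X(1) order_refl X(2), symmetric] coeff_sum
        using X(1,2) by (intro sum.mono_neutral_right) auto
      with * X(1) show "finite {i \<in> A. coeff (f i) M \<noteq> 0} \<and>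
         coeff s M = (\<Sum>i | i \<in> A \<and> coeff (f i) M \<noteq> 0. coeff (f i) M)"
        using finite_subset by blast
    qed
  next
    assume R: ?R
    show ?L
      unfolding has_sum_def
    proof (rule topological_tendstoI)
      fix U assume "open U" "s \<in> U"
      then obtain S where S: "finite S" "\<And>g. (\<forall>M\<in>S. coeff g M = coeff s M) \<Longrightarrow> g \<in> U"
        unfolding open_mseries_def by metis
      let ?X = "\<Union>M\<in>S. {i \<in> A. coeff (f i) M \<noteq> 0}"
      show "eventually (\<lambda>X. sum f X \<in> U) (finite_subsets_at_top A)"
        unfolding eventually_finite_subsets_at_top
      proof (intro exI[of _ ?X] conjI allI impI)
        show "finite ?X" using S(1) R by blast
        show "?X \<subseteq> A" by auto
        fix Y assume Y: "finite Y \<and> ?X \<subseteq> Y \<and> Y \<subseteq> A"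
        show "sum f Y \<in> U"
        proof (rule S(2), rule ballI)
          fix M assume "M \<in> S"
          hence "(\<Sum>i\<in>Y. coeff (f i) M) = (\<Sum>i | i \<in> A \<and> coeff (f i) M \<noteq> 0. coeff (f i) M)"
            using Y by (intro sum.mono_neutral_right) auto
          thus "coeff (sum f Y) M = coeff s M" using R by (simp add: coeff_sum)
        qed
      qed
    qed
  }
qed

definition const :: "complex \<Rightarrow> mseries" where
  "const a = Abs_mseries (\<lambda>M. if M = {#} then a else 0)"

text \<open>Meaningful for units only; the inverse is then unique.\<close>

definition mseries_inv :: "mseries \<Rightarrow> mseries" where
  "mseries_inv f = (THE g. f * g = 1)"

definition deg_part :: "nat \<Rightarrow> mseries \<Rightarrow> mseries" where
  "deg_part n f = Abs_mseries (\<lambda>M. if size M = n then coeff f M else 0)"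

section \<open>Symmetric functions\<close>

definition symmetric :: "mseries \<Rightarrow> bool" where
  "symmetric f \<longleftrightarrow> (\<forall>\<pi>. bij \<pi> \<longrightarrow> (\<forall>M. coeff f (image_mset \<pi> M) = coeff f M))"

definition homogeneous :: "nat \<Rightarrow> mseries \<Rightarrow> bool" where
  "homogeneous n f \<longleftrightarrow> (\<forall>M. coeff f M \<noteq> 0 \<longrightarrow> size M = n)"

definition sym_h :: "nat \<Rightarrow> mseries" where
  "sym_h n = Abs_mseries (\<lambda>M. if size M = n then 1 else 0)"

definition sym_e :: "nat \<Rightarrow> mseries" where
  "sym_e n = Abs_mseries (\<lambda>M. if size M = n \<and> (\<forall>i. count M i \<le> 1) then 1 else 0)"

definition sym_p :: "nat \<Rightarrow> mseries" where
  "sym_p n = Abs_mseries (\<lambda>M. if \<exists>i. M = replicate_mset n i then 1 else 0)"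

text \<open>
  Schur functions as generating functions of semistandard Young tableaux.  A partition is the list
  of its parts in weakly decreasing order, and tableaux are in English notation.
\<close>

definition diagram :: "nat list \<Rightarrow> (nat \<times> nat) set" where
  "diagram l = {(i, j). i < length l \<and> j < l ! i}"

definition ssyt :: "nat list \<Rightarrow> (nat \<times> nat \<Rightarrow> nat) set" where
  "ssyt l = {T \<in> extensional (diagram l).
     (\<forall>i j. (i, Suc j) \<in> diagram l \<longrightarrow> T (i, j) \<le> T (i, Suc j)) \<and>
     (\<forall>i j. (Suc i, j) \<in> diagram l \<longrightarrow> T (i, j) < T (Suc i, j))}"

definition schur :: "nat list \<Rightarrow> mseries" where
  "schur l = Abs_mseries (\<lambda>M.
     of_nat (card {T \<in> ssyt l. image_mset T (mset_set (diagram l)) = M}))"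

text \<open>
  Let \<open>b\<^sub>1, b\<^sub>2, \<dots>\<close> be algebraically independent generators of the ring of symmetric functions,
  with \<open>b\<^sub>n\<close> of degree \<open>n\<close>.  Every symmetric series is then uniquely an infinite linear combination
  of the products of the \<open>b\<^sub>i\<close>, which are indexed by the multisets of positive integers
  (the partitions).  \<open>gen_coeffs b f\<close> is the family of coefficients of this combination, and
  \<open>subst_gens b t\<close> is the continuous algebra homomorphism that sends each \<open>b\<^sub>n\<close> to \<open>t\<^sub>n\<close>.
\<close>

definition gen_coeffs :: "(nat \<Rightarrow> mseries) \<Rightarrow> mseries \<Rightarrow> nat multiset \<Rightarrow> complex" where
  "gen_coeffs b f = (THE c. (\<forall>l. 0 \<in># l \<longrightarrow> c l = 0) \<and>
     ((\<lambda>l. const (c l) * (\<Prod>i\<in>#l. b i)) has_sum f) UNIV)"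

definition subst_gens :: "(nat \<Rightarrow> mseries) \<Rightarrow> (nat \<Rightarrow> mseries) \<Rightarrow> mseries \<Rightarrow> mseries" where
  "subst_gens b t f = (\<Sum>\<^sub>\<infinity>l. const (gen_coeffs b f l) * (\<Prod>i\<in>#l. t i))"

definition omega :: "mseries \<Rightarrow> mseries" where
  "omega = subst_gens sym_h sym_e"

text \<open>
  Plethysm is determined by \<open>p\<^sub>k[g] = g(x\<^sub>0\<^sup>k, x\<^sub>1\<^sup>k, \<dots>)\<close> for \<open>k \<ge> 1\<close> and by \<open>f \<mapsto> f[g]\<close> being a
  continuous algebra homomorphism.  It is meaningful for symmetric \<open>f\<close> and symmetric \<open>g\<close> without
  constant term.
\<close>

definition power_subst :: "nat \<Rightarrow> mseries \<Rightarrow> mseries" where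
  "power_subst k g = Abs_mseries (\<lambda>M. \<Sum>N | repeat_mset k N = M. coeff g N)"

definition plethysm :: "mseries \<Rightarrow> mseries \<Rightarrow> mseries" where
  "plethysm f g = subst_gens sym_p (\<lambda>k. power_subst k g) f"

section \<open>Frobenius characteristics of induced modules\<close>

text \<open>
  The module induced from a linear character \<open>\<psi>\<close> of a subgroup \<open>H\<close> of \<open>G\<close>, as a matrix
  representation: rows and columns are indexed by the left cosets of \<open>H\<close>, and with coset
  representatives \<open>t\<^sub>X\<close> the entry of \<open>g\<close> at \<open>(X, Y)\<close> is \<open>\<psi>(t\<^sub>X\<^sup>-\<^sup>1 g t\<^sub>Y)\<close>, where \<open>\<psi>\<close> is extended
  by \<open>0\<close> outside \<open>H\<close>.
\<close>

definition coset_rep :: "'g set \<Rightarrow> 'g" where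
  "coset_rep X = (SOME t. t \<in> X)"

definition ind_rep ::
  "('g, 'm) monoid_scheme \<Rightarrow> 'g set \<Rightarrow> ('g \<Rightarrow> complex) \<Rightarrow> 'g \<Rightarrow> 'g set \<Rightarrow> 'g set \<Rightarrow> complex" where
  "ind_rep G H \<psi> g X Y =
     (let u = m_inv G (coset_rep X) \<otimes>\<^bsub>G\<^esub> g \<otimes>\<^bsub>G\<^esub> coset_rep Y in if u \<in> H then \<psi> u else 0)"

definition ind_char ::
  "('g, 'm) monoid_scheme \<Rightarrow> 'g set \<Rightarrow> ('g \<Rightarrow> complex) \<Rightarrow> 'g \<Rightarrow> complex" where
  "ind_char G H \<psi> g = (\<Sum>X \<in> lcosets\<^bsub>G\<^esub> H. ind_rep G H \<psi> g X X)"

text \<open>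
  The orbits of a permutation \<open>w\<close> on \<open>{1..n}\<close> are the supports of its cycles, fixed points
  included, so the product is the power sum indexed by the cycle type of \<open>w\<close>.
\<close>

definition frob_char :: "nat \<Rightarrow> ((nat \<Rightarrow> nat) \<Rightarrow> complex) \<Rightarrow> mseries" where
  "frob_char n \<chi> = const (1 / fact n) *
     (\<Sum>w \<in> carrier (sym_group n). const (\<chi> w) * (\<Prod>C \<in> orbit w ` {1..n}. sym_p (card C)))"

definition is_n_cycle :: "nat \<Rightarrow> (nat \<Rightarrow> nat) \<Rightarrow> bool" where
  "is_n_cycle n c \<longleftrightarrow> (\<exists>cs. cycle cs \<and> set cs = {1..n} \<and> c = cycle_of_list cs)"

text \<open>
  The linear character of the cyclic group generated by \<open>c\<close> that sends \<open>c\<close> to \<open>z\<close>; here the order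
  of \<open>z\<close> has to divide that of \<open>c\<close>.
\<close>

definition cyclic_char :: "(nat \<Rightarrow> nat) \<Rightarrow> complex \<Rightarrow> (nat \<Rightarrow> nat) \<Rightarrow> complex" where
  "cyclic_char c z w = z ^ (LEAST j. c ^^ j = w)"

text \<open>
  The \<open>n\<close>-cycle \<open>c n\<close> that generates the cyclic subgroup is a parameter.
\<close>

definition Lie2 :: "(nat \<Rightarrow> nat \<Rightarrow> nat) \<Rightarrow> nat \<Rightarrow> mseries" where
  "Lie2 c n = frob_char n
     (ind_char (sym_group n) (generate (sym_group n) {c n})
       (cyclic_char (c n) (exp (2 * of_real pi * \<i> / of_nat n * 2 ^ multiplicity 2 n))))"

definition E_series :: mseries where
  "E_series = (\<Sum>\<^sub>\<infinity>r. sym_e r)"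

definition H_pm :: mseries where
  "H_pm = (\<Sum>\<^sub>\<infinity>r. (-1) ^ r * sym_h r)"

definition kappa :: mseries where
  "kappa = (\<Sum>\<^sub>\<infinity>n\<in>{2..}. schur [n - 1, 1])"

end

theory Submission
  imports Defs "HOL-Analysis.Complex_Transcendental"
begin

text \<open>
  Write \<open>H\<close> for \<open>H_pm\<close>, \<open>L\<close> for the sum of all \<open>L\<^sub>n\<close> and \<open>K = 1 - (1 - p\<^sub>1) E = \<omega>(\<kappa>)\<close>.  Since \<open>H\<close> is the
  exponential of \<open>\<Sum>\<^sub>k (-1)\<^sup>k p\<^sub>k / k\<close>, \<open>f \<mapsto> H[f]\<close> turns sums into products, and \<open>E H = 1\<close>.  So (1), (2),
  (3) and (6) all say \<open>H[L] = 1 - p\<^sub>1\<close>.  Identity (4) is a fixed point equation whose solution is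
  unique, by comparison of lowest degrees, and is given by the iteration (5); that (2) implies (4)
  follows from \<open>H[L[K]] = 1 - K = H[L - p\<^sub>1]\<close> because \<open>f \<mapsto> H[f]\<close> is injective.  For \<open>Lie2\<close>, the
  expansion \<open>n Lie\<^sub>n = \<Sum>\<^sub>d\<^sub>|\<^sub>n \<psi>(d) p\<^sub>d\<^bsup>n/d\<^esup>\<close> with Ramanujan sums \<open>\<psi>(d)\<close> and the convolution identity
  \<open>\<Sum>\<^sub>d\<^sub>|\<^sub>n (-1)\<^bsup>n/d\<^esup> \<psi>(d) = -[n = 1]\<close> show that \<open>H[L]\<close> and \<open>1 - p\<^sub>1\<close> satisfy the same linear differential
  equation for the Euler derivation, hence agree.
\<close>

section \<open>Coefficients\<close>

text \<open>\<open>gen_coeffs\<close> is a definite description, so plethysm and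
  \<open>omega\<close> cannot be computed until expansions in the p_n and in the h_n are known to be
  unique. The coordinates of such an expansion are kept as an \<open>mseries\<close> whose variable
  i stands for the i-th generator. Plethysm, p_k[g] and \<open>omega\<close> are then all obtained
  from one substitution map \<open>ev\<close>, and the laws of plethysm become laws for composing
  substitutions.

  For an arbitrary family L the step from (4) back to (2) is not a computation. It compares L with
  \<open>Lie2\<close>, a solution of (4) for which (2) is already proved, so the equivalences rest
  on the concrete family.

  The power of 2 in the character matters only through the sum of psi(d) over the divisors d of n,
  which is n if n is a power of 2 and 0 otherwise. This is what the signs (-1)^(n/d) coming from H
  turn into the indicator of n = 1.\<close>

declare zero_mseries.rep_eq [simp] one_mseries.rep_eq [simp] plus_mseries.rep_eq [simp]
  minus_mseries.rep_eq [simp] uminus_mseries.rep_eq [simp]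

lemma coeff_Abs [simp]: "coeff (Abs_mseries f) = f"
  by (simp add: Abs_mseries_inverse)

lemma coeff_sum [simp]: "coeff (sum f X) M = (\<Sum>i\<in>X. coeff (f i) M)"
  by (induction X rule: infinite_finite_induct) auto

abbreviation splits :: "nat multiset \<Rightarrow> (nat multiset \<times> nat multiset) set" where
  "splits M \<equiv> {(A, B). A + B = M}"

lemma finite_splits [simp]: "finite (splits M)"
  by (rule finite_mset_splittings)

lemma coeff_mult: "coeff (f * g) M = (\<Sum>(A, B)\<in>splits M. coeff f A * coeff g B)"
  by (simp add: times_mseries.rep_eq)

lemma splits_empty [simp]: "splits {#} = {({#}, {#})}"
  by auto

lemma coeff_mult_empty [simp]: "coeff (f * g) {#} = coeff f {#} * coeff g {#}"
  by (simp add: coeff_mult)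

definition mon :: "nat multiset \<Rightarrow> mseries" where
  "mon N = Abs_mseries (\<lambda>M. if M = N then 1 else 0)"

lemma coeff_mon [simp]: "coeff (mon N) M = (if M = N then 1 else 0)"
  by (simp add: mon_def)

lemma mon_empty [simp]: "mon {#} = 1"
  by (rule mseries_eqI) auto

lemma coeff_mon_mult: "coeff (mon N * f) M = (if N \<subseteq># M then coeff f (M - N) else 0)"
proof -
  have "coeff (mon N * f) M = (\<Sum>(A, B)\<in>splits M. if A = N then coeff f B else 0)"
    unfolding coeff_mult by (rule sum.cong) auto
  also have "\<dots> = (\<Sum>(A, B)\<in>splits M \<inter> {(A, B). A = N}. coeff f B)"
    by (rule sum.mono_neutral_cong_right) (auto split: if_splits)
  also have "splits M \<inter> {(A, B). A = N} = (if N \<subseteq># M then {(N, M - N)} else {})"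
    by (auto simp: subset_mset.add_diff_inverse)
  finally show ?thesis by simp
qed

lemma mon_mult: "mon A * mon B = mon (A + B)"
proof (rule mseries_eqI)
  fix M
  show "coeff (mon A * mon B) M = coeff (mon (A + B)) M"
    unfolding coeff_mon_mult coeff_mon
    by (metis add_diff_cancel_left' mset_subset_eq_add_left subset_mset.add_diff_inverse)
qed

lemma coeff_const [simp]: "coeff (const a) M = (if M = {#} then a else 0)"
  by (simp add: const_def)

lemma coeff_const_mult [simp]: "coeff (const a * f) M = a * coeff f M"
proof -
  have "coeff (const a * f) M = (\<Sum>(A, B)\<in>{({#} :: nat multiset, M)}. a * coeff f B)"
    unfolding coeff_mult by (rule sum.mono_neutral_cong_right) (auto split: if_splits)
  thus ?thesis by simp
qed

lemma const_0 [simp]: "const 0 = 0" and const_1 [simp]: "const 1 = 1"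
  by (auto intro!: mseries_eqI)

lemma const_add: "const (a + b) = const a + const b"
  and const_mult: "const (a * b) = const a * const b"
  and const_uminus: "const (- a) = - const a"
  by (auto intro!: mseries_eqI)

lemma const_power: "const (a ^ n) = const a ^ n"
  by (induction n) (auto simp: const_mult)

lemma const_of_nat: "const (of_nat n) = of_nat n"
  by (induction n) (auto simp: const_add)

lemma coeff_of_nat_mult [simp]: "coeff (of_nat n * f) M = of_nat n * coeff f M"
  using coeff_const_mult[of "of_nat n" f M] by (simp add: const_of_nat)

lemma const_minus_one_power: "(-1) ^ n = const ((-1) ^ n)"
  by (simp add: const_power const_uminus)

lemma coeff_sign_mult [simp]: "coeff ((-1) ^ n * f) M = (-1) ^ n * coeff f M"
  by (simp add: const_minus_one_power)

section \<open>Order of a series\<close>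

text \<open>A predicate rather than an order function, so that 0 needs no infinite order: it is the
  series that meets every bound.\<close>

definition ord_ge :: "nat \<Rightarrow> mseries \<Rightarrow> bool" where
  "ord_ge n f \<longleftrightarrow> (\<forall>M. size M < n \<longrightarrow> coeff f M = 0)"

lemma ord_ge_0 [simp]: "ord_ge 0 f"
  by (simp add: ord_ge_def)

lemma ord_ge_1: "ord_ge (Suc 0) f \<longleftrightarrow> coeff f {#} = 0"
  by (auto simp: ord_ge_def)

lemma ord_ge_mono: "ord_ge n f \<Longrightarrow> m \<le> n \<Longrightarrow> ord_ge m f"
  by (auto simp: ord_ge_def)

lemma ord_ge_mult: "ord_ge m f \<Longrightarrow> ord_ge n g \<Longrightarrow> ord_ge (m + n) (f * g)"
  unfolding ord_ge_def coeff_mult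
proof (intro allI impI sum.neutral ballI)
  fix M x
  assume *: "\<forall>M. size M < m \<longrightarrow> coeff f M = 0" "\<forall>M. size M < n \<longrightarrow> coeff g M = 0"
    "size M < m + n" "x \<in> splits M"
  obtain A B where x: "x = (A, B)" "A + B = M" using *(4) by auto
  hence "size A < m \<or> size B < n" using *(3) by auto
  thus "(case x of (A, B) \<Rightarrow> coeff f A * coeff g B) = 0" using * x by auto
qed

lemma ord_ge_power: "ord_ge m f \<Longrightarrow> ord_ge (n * m) (f ^ n)"
  by (induction n) (auto intro: ord_ge_mult)

lemma ord_ge_all_imp_zero: "(\<And>n. ord_ge n f) \<Longrightarrow> f = 0"
  by (rule mseries_eqI) (auto simp: ord_ge_def)

section \<open>Summation\<close>

text \<open>\<open>S M\<close> may be any finite set of indices that contains those contributing to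
  \<open>M\<close>, so the exact support in \<open>has_sum_mseries_iff\<close> never has to be
  determined.\<close>

lemma has_sum_mseriesI:
  assumes "\<And>M. finite (S M)" "\<And>M i. i \<in> A \<Longrightarrow> coeff (f i) M \<noteq> 0 \<Longrightarrow> i \<in> S M"
    and "\<And>M. S M \<subseteq> A" "\<And>M. coeff s M = (\<Sum>i\<in>S M. coeff (f i) M)"
  shows "(f has_sum s) A"
  unfolding has_sum_mseries_iff
proof
  fix M
  have *: "{i \<in> A. coeff (f i) M \<noteq> 0} \<subseteq> S M" using assms(2) by auto
  hence "finite {i \<in> A. coeff (f i) M \<noteq> 0}" using assms(1) finite_subset by blast
  moreover have "coeff s M = (\<Sum>i | i \<in> A \<and> coeff (f i) M \<noteq> 0. coeff (f i) M)"
    unfolding assms(4) using * assms(1,3) by (intro sum.mono_neutral_right) auto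
  ultimately show "finite {i \<in> A. coeff (f i) M \<noteq> 0} \<and>
     coeff s M = (\<Sum>i | i \<in> A \<and> coeff (f i) M \<noteq> 0. coeff (f i) M)" by blast
qed

lemma has_sum_coeff:
  assumes "(f has_sum s) A"
  shows "finite {i \<in> A. coeff (f i) M \<noteq> 0}"
    and "finite S \<Longrightarrow> S \<subseteq> A \<Longrightarrow> (\<And>i. i \<in> A \<Longrightarrow> coeff (f i) M \<noteq> 0 \<Longrightarrow> i \<in> S) \<Longrightarrow>
           coeff s M = (\<Sum>i\<in>S. coeff (f i) M)"
proof -
  show fin: "finite {i \<in> A. coeff (f i) M \<noteq> 0}"
    using assms unfolding has_sum_mseries_iff by blast
  assume S: "finite S" "S \<subseteq> A" "\<And>i. i \<in> A \<Longrightarrow> coeff (f i) M \<noteq> 0 \<Longrightarrow> i \<in> S"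
  have "coeff s M = (\<Sum>i | i \<in> A \<and> coeff (f i) M \<noteq> 0. coeff (f i) M)"
    using assms unfolding has_sum_mseries_iff by blast
  also have "\<dots> = (\<Sum>i\<in>S. coeff (f i) M)"
    using S by (intro sum.mono_neutral_left) auto
  finally show "coeff s M = (\<Sum>i\<in>S. coeff (f i) M)" .
qed

lemma has_sum_mseries_exists:
  assumes "\<And>M. finite {i \<in> A. coeff (f i) M \<noteq> 0}"
  shows "(f has_sum infsum f A) A"
proof -
  have "(f has_sum Abs_mseries (\<lambda>M. \<Sum>i | i \<in> A \<and> coeff (f i) M \<noteq> 0. coeff (f i) M)) A"
    by (rule has_sum_mseriesI[where S = "\<lambda>M. {i \<in> A. coeff (f i) M \<noteq> 0}"]) (use assms in auto)
  thus ?thesis by (simp add: has_sum_infsum has_sum_imp_summable)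
qed

text \<open>A monomial of degree d can occur only in the members with index at most d.\<close>

lemma has_sum_ord_ge:
  fixes f :: "nat \<Rightarrow> mseries"
  assumes "\<And>n. n \<in> A \<Longrightarrow> ord_ge n (f n)"
  shows "(f has_sum infsum f A) A"
proof (rule has_sum_mseries_exists)
  fix M
  have "{i \<in> A. coeff (f i) M \<noteq> 0} \<subseteq> {..size M}"
    using assms by (force simp: ord_ge_def not_less[symmetric])
  thus "finite {i \<in> A. coeff (f i) M \<noteq> 0}" by (rule finite_subset) simp
qed

lemma has_sum_homogeneous:
  fixes f :: "nat \<Rightarrow> mseries"
  assumes "\<And>n. n \<in> A \<Longrightarrow> homogeneous n (f n)"
    and "\<And>M. coeff s M = (if size M \<in> A then coeff (f (size M)) M else 0)"
  shows "(f has_sum s) A"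
  by (rule has_sum_mseriesI[where S = "\<lambda>M. A \<inter> {size M}"])
    (use assms in \<open>auto simp: homogeneous_def\<close>)

section \<open>Subalgebras and continuous maps on them\<close>

definition ring_closed :: "mseries set \<Rightarrow> bool" where
  "ring_closed D \<longleftrightarrow> (\<forall>a. const a \<in> D) \<and> (\<forall>f\<in>D. \<forall>g\<in>D. f + g \<in> D \<and> f * g \<in> D)"

text \<open>For additive maps continuity reduces to continuity at 0: each coefficient of
  \<open>T f\<close> vanishes as soon as finitely many coefficients of \<open>f\<close> do. The
  domain \<open>D\<close> is explicit because \<open>p_coords\<close> and plethysm behave well on
  symmetric series only.\<close>

definition cont_additive :: "mseries set \<Rightarrow> (mseries \<Rightarrow> mseries) \<Rightarrow> bool" where
  "cont_additive D T \<longleftrightarrow> (\<forall>f\<in>D. \<forall>g\<in>D. T (f + g) = T f + T g) \<and>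
     (\<forall>M. \<exists>S. finite S \<and> (\<forall>f\<in>D. (\<forall>N\<in>S. coeff f N = 0) \<longrightarrow> coeff (T f) M = 0))"

definition cont_hom :: "mseries set \<Rightarrow> (mseries \<Rightarrow> mseries) \<Rightarrow> bool" where
  "cont_hom D T \<longleftrightarrow> cont_additive D T \<and> (\<forall>a. T (const a) = const a) \<and>
     (\<forall>f\<in>D. \<forall>g\<in>D. T (f * g) = T f * T g)"

lemma ring_closed_UNIV [simp]: "ring_closed UNIV"
  by (simp add: ring_closed_def)

lemma ring_closedD:
  assumes "ring_closed D"
  shows "const a \<in> D" "0 \<in> D" "1 \<in> D" "f \<in> D \<Longrightarrow> g \<in> D \<Longrightarrow> f + g \<in> D"
    "f \<in> D \<Longrightarrow> g \<in> D \<Longrightarrow> f * g \<in> D" "f \<in> D \<Longrightarrow> - f \<in> D"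
    "f \<in> D \<Longrightarrow> g \<in> D \<Longrightarrow> f - g \<in> D"
proof -
  show 1: "const a \<in> D" "f \<in> D \<Longrightarrow> g \<in> D \<Longrightarrow> f + g \<in> D" "f \<in> D \<Longrightarrow> g \<in> D \<Longrightarrow> f * g \<in> D" for a f g
    using assms by (auto simp: ring_closed_def)
  show "0 \<in> D" "1 \<in> D" using 1(1)[of 0] 1(1)[of 1] by simp_all
  show 2: "f \<in> D \<Longrightarrow> - f \<in> D" for f using 1(3)[OF 1(1)[of "-1"], of f] by (simp add: const_uminus)
  show "f \<in> D \<Longrightarrow> g \<in> D \<Longrightarrow> f - g \<in> D" using 1(2)[of f "- g"] 2[of g] by simp
qed

lemma ring_closed_sum: "ring_closed D \<Longrightarrow> (\<And>i. i \<in> X \<Longrightarrow> f i \<in> D) \<Longrightarrow> sum f X \<in> D"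
  by (induction X rule: infinite_finite_induct) (auto dest: ring_closedD)

lemma ring_closed_power: "ring_closed D \<Longrightarrow> f \<in> D \<Longrightarrow> f ^ n \<in> D"
  by (induction n) (auto dest: ring_closedD)

lemma ring_closed_prod_mset:
  "ring_closed D \<Longrightarrow> (\<And>i. i \<in># l \<Longrightarrow> t i \<in> D) \<Longrightarrow> (\<Prod>i\<in>#l. t i) \<in> D"
  by (induction l) (auto dest: ring_closedD)

lemma cont_additiveD:
  assumes "cont_additive D T" "ring_closed D"
  shows "f \<in> D \<Longrightarrow> g \<in> D \<Longrightarrow> T (f + g) = T f + T g" "T 0 = 0"
    "f \<in> D \<Longrightarrow> T (- f) = - T f" "f \<in> D \<Longrightarrow> g \<in> D \<Longrightarrow> T (f - g) = T f - T g"
    "(\<And>i. i \<in> X \<Longrightarrow> h i \<in> D) \<Longrightarrow> T (sum h X) = (\<Sum>i\<in>X. T (h i))"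
proof -
  show 1: "f \<in> D \<Longrightarrow> g \<in> D \<Longrightarrow> T (f + g) = T f + T g" for f g
    using assms by (auto simp: cont_additive_def)
  have "T (0 + 0) = T 0 + T 0" using 1[of 0 0] ring_closedD[OF assms(2)] by blast
  thus 2: "T 0 = 0" by simp
  show 3: "f \<in> D \<Longrightarrow> T (- f) = - T f" for f
    using 1[of f "- f"] ring_closedD[OF assms(2)] 2 by (simp add: eq_neg_iff_add_eq_0 add.commute)
  show "f \<in> D \<Longrightarrow> g \<in> D \<Longrightarrow> T (f - g) = T f - T g"
    using 1[of f "- g"] 3[of g] ring_closedD[OF assms(2)] by simp
  show "(\<And>i. i \<in> X \<Longrightarrow> h i \<in> D) \<Longrightarrow> T (sum h X) = (\<Sum>i\<in>X. T (h i))"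
  proof (induction X rule: infinite_finite_induct)
    case (insert x F)
    have "h x \<in> D" "sum h F \<in> D" using insert.prems by (auto intro: ring_closed_sum[OF assms(2)])
    thus ?case using insert 1 by simp
  qed (auto simp: 2)
qed

lemma cont_homD:
  assumes "cont_hom D T" "ring_closed D"
  shows "cont_additive D T" "T (const a) = const a" "f \<in> D \<Longrightarrow> g \<in> D \<Longrightarrow> T (f * g) = T f * T g"
    "T 1 = 1" "f \<in> D \<Longrightarrow> T (f ^ n) = T f ^ n"
    "(\<And>i. i \<in># l \<Longrightarrow> t i \<in> D) \<Longrightarrow> T (\<Prod>i\<in>#l. t i) = (\<Prod>i\<in>#l. T (t i))"
proof -
  show 1: "cont_additive D T" "T (const a) = const a" "f \<in> D \<Longrightarrow> g \<in> D \<Longrightarrow> T (f * g) = T f * T g" for a f g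
    using assms by (auto simp: cont_hom_def)
  show 2: "T 1 = 1" using 1(2)[of 1] by simp
  show "f \<in> D \<Longrightarrow> T (f ^ n) = T f ^ n"
    by (induction n) (use 1 2 ring_closed_power[OF assms(2)] in \<open>auto\<close>)
  show "(\<And>i. i \<in># l \<Longrightarrow> t i \<in> D) \<Longrightarrow> T (\<Prod>i\<in>#l. t i) = (\<Prod>i\<in>#l. T (t i))"
  proof (induction l)
    case (add x l)
    have "t x \<in> D" "(\<Prod>i\<in>#l. t i) \<in> D" using add.prems by (auto intro: ring_closed_prod_mset[OF assms(2)])
    thus ?case using add 1(3) by simp
  qed (simp add: 2)
qed

lemmas cont_hom_additiveD = cont_additiveD[OF cont_homD(1)]

lemma has_sum_cont_additive:
  assumes T: "cont_additive D T" and D: "ring_closed D"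
    and f: "\<And>i. i \<in> A \<Longrightarrow> f i \<in> D" "s \<in> D" and sum: "(f has_sum s) A"
  shows "((\<lambda>i. T (f i)) has_sum T s) A"
proof -
  have "\<exists>X. finite X \<and> X \<subseteq> A \<and> (\<forall>Y. finite Y \<longrightarrow> X \<subseteq> Y \<longrightarrow> Y \<subseteq> A \<longrightarrow>
      coeff (\<Sum>i\<in>Y. T (f i)) M = coeff (T s) M)" for M
  proof -
    obtain S where S: "finite S" "\<And>f. f \<in> D \<Longrightarrow> (\<forall>N\<in>S. coeff f N = 0) \<Longrightarrow> coeff (T f) M = 0"
      using T unfolding cont_additive_def by metis
    \<comment> \<open>From \<open>X\<close> on, the partial sums agree with \<open>s\<close> at all
      monomials of \<open>S\<close>, so \<open>T\<close> of the difference has coefficient 0 at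
      \<open>M\<close>.\<close>
    define X where "X = (\<Union>N\<in>S. {i \<in> A. coeff (f i) N \<noteq> 0})"
    have "finite X" "X \<subseteq> A" using has_sum_coeff(1)[OF sum] S(1) by (auto simp: X_def)
    moreover have "coeff (\<Sum>i\<in>Y. T (f i)) M = coeff (T s) M"
      if Y: "finite Y" "X \<subseteq> Y" "Y \<subseteq> A" for Y
    proof -
      have fY: "sum f Y \<in> D" by (rule ring_closed_sum[OF D]) (use f Y in auto)
      have "coeff s N = coeff (sum f Y) N" if "N \<in> S" for N
        unfolding coeff_sum by (rule has_sum_coeff(2)[OF sum]) (use Y that in \<open>auto simp: X_def\<close>)
      hence "coeff (T (sum f Y - s)) M = 0"
        using fY f by (intro S(2)) (auto intro: ring_closedD[OF D])
      moreover have "T (sum f Y) = (\<Sum>i\<in>Y. T (f i))"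
        by (rule cont_additiveD(5)[OF T D]) (use f Y in auto)
      ultimately show ?thesis using cont_additiveD(4)[OF T D fY f(2)] by simp
    qed
    ultimately show ?thesis by blast
  qed
  then obtain X where X: "\<And>M. finite (X M)" "\<And>M. X M \<subseteq> A"
    "\<And>M Y. finite Y \<Longrightarrow> X M \<subseteq> Y \<Longrightarrow> Y \<subseteq> A \<Longrightarrow> coeff (\<Sum>i\<in>Y. T (f i)) M = coeff (T s) M" by metis
  show ?thesis
  proof (rule has_sum_mseriesI[where S = X])
    fix M i assume i: "i \<in> A" "coeff (T (f i)) M \<noteq> 0"
    show "i \<in> X M"
    proof (rule ccontr)
      assume "i \<notin> X M"
      \<comment> \<open>The partial sums over \<open>X M\<close> and \<open>insert i (X M)\<close>
        have the same coefficient at \<open>M\<close>, so \<open>T (f i)\<close> adds nothing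
        there.\<close>
      thus False using X(3)[of "X M" M] X(3)[of "insert i (X M)" M] X(1,2)[of M] i by auto
    qed
  qed (use X in auto)
qed

lemmas has_sum_cont_hom = has_sum_cont_additive[OF cont_homD(1)]

lemma cont_additive_mult: "cont_additive UNIV ((*) g)"
  unfolding cont_additive_def
proof (intro conjI allI ballI)
  fix M
  show "\<exists>S. finite S \<and> (\<forall>f\<in>UNIV. (\<forall>N\<in>S. coeff f N = 0) \<longrightarrow> coeff (g * f) M = 0)"
    by (rule exI[of _ "snd ` splits M"]) (auto simp: coeff_mult intro!: sum.neutral)
qed (simp add: distrib_left)

lemmas has_sum_mult_left = has_sum_cont_additive[OF cont_additive_mult ring_closed_UNIV UNIV_I UNIV_I]

text \<open>\<open>has_sum_add\<close> and \<open>has_sum_Un_disjoint\<close> require this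
  class.\<close>

instance mseries :: topological_comm_monoid_add
proof
  fix a b :: mseries
  show "((\<lambda>x. fst x + snd x) \<longlongrightarrow> a + b) (nhds a \<times>\<^sub>F nhds b)"
  proof (rule topological_tendstoI)
    fix U assume "open U" "a + b \<in> U"
    then obtain S where S: "finite S" "\<And>g. (\<forall>M\<in>S. coeff g M = coeff (a + b) M) \<Longrightarrow> g \<in> U"
      unfolding open_mseries_def by metis
    define V where "V f = {g. \<forall>M\<in>S. coeff g M = coeff f M}" for f
    have V: "open (V f)" "f \<in> V f" for f
      unfolding open_mseries_def using S(1) by (auto simp: V_def intro!: exI[of _ S])
    have "eventually (\<lambda>x. fst x \<in> V a \<and> snd x \<in> V b) (nhds a \<times>\<^sub>F nhds b)"
      unfolding eventually_prod_filter
      by (intro exI[of _ "\<lambda>x. x \<in> V a"] exI[of _ "\<lambda>x. x \<in> V b"]) (use V in \<open>auto intro: eventually_nhds_in_open\<close>)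
    thus "eventually (\<lambda>x. fst x + snd x \<in> U) (nhds a \<times>\<^sub>F nhds b)"
      by (rule eventually_mono) (auto simp: V_def intro!: S(2))
  qed
qed

lemma has_sum_shift:
  fixes f :: "nat \<Rightarrow> mseries"
  assumes "(f has_sum s) {Suc n..}"
  shows "(f has_sum f n + s) {n..}"
proof -
  have "(f has_sum f n) {n}" using has_sum_finite[of "{n}" f] by simp
  moreover have "{n} \<union> {Suc n..} = {n..}" by auto
  ultimately show ?thesis
    using has_sum_Un_disjoint[of f "{n}" "f n" "{Suc n..}" s] assms by simp
qed

section \<open>Substitution\<close>

definition mpow :: "(nat \<Rightarrow> mseries) \<Rightarrow> nat multiset \<Rightarrow> mseries" where
  "mpow t l = (\<Prod>i\<in>#l. t i)"

lemma mpow_empty [simp]: "mpow t {#} = 1"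
  and mpow_add_mset [simp]: "mpow t (add_mset i l) = t i * mpow t l"
  and mpow_plus: "mpow t (l + l') = mpow t l * mpow t l'"
  by (simp_all add: mpow_def)

lemma mpow_cong: "(\<And>i. i \<in># l \<Longrightarrow> t i = t' i) \<Longrightarrow> mpow t l = mpow t' l"
  by (induction l) auto

lemma mpow_zero: "i \<in># l \<Longrightarrow> t i = 0 \<Longrightarrow> mpow t l = 0"
  by (induction l) auto

text \<open>Exactly the condition under which the sum in \<open>ev t c\<close> converges for every
  \<open>c\<close>.\<close>

definition admissible :: "(nat \<Rightarrow> mseries) \<Rightarrow> bool" where
  "admissible t \<longleftrightarrow> (\<forall>M. finite {l. coeff (mpow t l) M \<noteq> 0})"

text \<open>Substitution of \<open>t i\<close> for the i-th variable of \<open>c\<close>. The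
  coordinates \<open>c\<close> have the type \<open>mseries\<close> as well, so they multiply like
  the series that they describe.\<close>

definition ev :: "(nat \<Rightarrow> mseries) \<Rightarrow> mseries \<Rightarrow> mseries" where
  "ev t c = (\<Sum>\<^sub>\<infinity>l. const (coeff c l) * mpow t l)"

lemma ev_has_sum:
  assumes "admissible t"
  shows "((\<lambda>l. const (coeff c l) * mpow t l) has_sum ev t c) UNIV"
  unfolding ev_def
proof (rule has_sum_mseries_exists)
  fix M
  have "{l \<in> UNIV. coeff (const (coeff c l) * mpow t l) M \<noteq> 0} \<subseteq> {l. coeff (mpow t l) M \<noteq> 0}"
    by auto
  thus "finite {l \<in> UNIV. coeff (const (coeff c l) * mpow t l) M \<noteq> 0}"
    using assms finite_subset unfolding admissible_def by blast
qed

lemma coeff_ev: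
  assumes "admissible t" "finite S" "\<And>l. coeff c l \<noteq> 0 \<Longrightarrow> coeff (mpow t l) M \<noteq> 0 \<Longrightarrow> l \<in> S"
  shows "coeff (ev t c) M = (\<Sum>l\<in>S. coeff c l * coeff (mpow t l) M)"
  using has_sum_coeff(2)[OF ev_has_sum[OF assms(1)] assms(2)] assms(3) by simp

lemma coeff_ev':
  assumes "admissible t"
  shows "coeff (ev t c) M = (\<Sum>l | coeff (mpow t l) M \<noteq> 0. coeff c l * coeff (mpow t l) M)"
  using assms by (intro coeff_ev) (auto simp: admissible_def)

lemma ev_cong:
  assumes "\<And>l. coeff c l \<noteq> 0 \<Longrightarrow> mpow t l = mpow t' l"
  shows "ev t c = ev t' c"
proof -
  have "const (coeff c l) * mpow t l = const (coeff c l) * mpow t' l" for l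
    using assms[of l] by (cases "coeff c l = 0") auto
  thus ?thesis by (simp add: ev_def)
qed

text \<open>Only finitely many \<open>l\<close> have a product \<open>mpow t l\<close> that meets a
  divisor of a given monomial, so the identity reduces to a rearrangement of finite sums.\<close>

lemma ev_mult:
  assumes t: "admissible t"
  shows "ev t (f * g) = ev t f * ev t g"
proof (rule mseries_eqI)
  fix M
  \<comment> \<open>All \<open>l\<close> whose product meets a divisor of \<open>M\<close>. The set
    \<open>S'\<close> adds the sums of two of them, which index the coefficients of
    \<open>f * g\<close>.\<close>
  define S where "S = (\<Union>X\<in>fst ` splits M \<union> snd ` splits M. {l. coeff (mpow t l) X \<noteq> 0})"
  define S' where "S' = S \<union> (\<lambda>(A, B). A + B) ` (S \<times> S)"
  have fin: "finite S" using t by (auto simp: S_def admissible_def)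
  hence fin': "finite S'" by (auto simp: S'_def)
  have S: "l \<in> S" if "coeff (mpow t l) X \<noteq> 0" "A + B = M" "X = A \<or> X = B" for l X A B
    using that unfolding S_def by force
  have M: "{#} + M = M" by simp
  \<comment> \<open>A monomial of \<open>mpow t (A + B)\<close> is a product of monomials of the two
    factors, so both \<open>A\<close> and \<open>B\<close> are seen at divisors of
    \<open>M\<close>.\<close>
  have S_split: "A \<in> S \<and> B \<in> S" if "coeff (mpow t (A + B)) M \<noteq> 0" for A B
  proof -
    have "\<exists>x\<in>splits M. coeff (mpow t A) (fst x) * coeff (mpow t B) (snd x) \<noteq> 0"
      using that unfolding mpow_plus coeff_mult by (auto simp: case_prod_unfold dest: sum.not_neutral_contains_not_neutral)
    then obtain X Y where "X + Y = M" "coeff (mpow t A) X \<noteq> 0" "coeff (mpow t B) Y \<noteq> 0" by auto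
    thus ?thesis using S by blast
  qed
  have "coeff (ev t (f * g)) M = (\<Sum>l\<in>S'. coeff (f * g) l * coeff (mpow t l) M)"
    by (rule coeff_ev[OF t fin']) (use S[of _ M "{#}" M] in \<open>auto simp: S'_def\<close>)
  also have "\<dots> = (\<Sum>l\<in>S'. \<Sum>(A, B)\<in>splits l. coeff f A * coeff g B * coeff (mpow t (A + B)) M)"
    unfolding coeff_mult[of f g] sum_distrib_right by (intro sum.cong) auto
  also have "\<dots> = (\<Sum>(l, A, B)\<in>Sigma S' splits. coeff f A * coeff g B * coeff (mpow t (A + B)) M)"
    by (subst sum.Sigma) (auto simp: fin')
  also have "\<dots> = (\<Sum>(A, B)\<in>S \<times> S. coeff f A * coeff g B * coeff (mpow t (A + B)) M)"
  proof (rule sum.reindex_bij_witness_not_neutral[where S' = "{x \<in> Sigma S' splits. snd x \<notin> S \<times> S}"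
        and T' = "{}" and j = snd and i = "\<lambda>(A, B). (A + B, A, B)"])
    show "finite {x \<in> Sigma S' splits. snd x \<notin> S \<times> S}"
      by (rule finite_subset[OF _ finite_SigmaI[of S' splits]]) (auto simp: fin')
    fix x assume "x \<in> {x \<in> Sigma S' splits. snd x \<notin> S \<times> S}"
    then obtain A B where x: "x = (A + B, A, B)" "\<not> (A \<in> S \<and> B \<in> S)" by auto
    hence "coeff (mpow t (A + B)) M = 0" using S_split by blast
    thus "(case x of (l, A, B) \<Rightarrow> coeff f A * coeff g B * coeff (mpow t (A + B)) M) = 0"
      using x by simp
  qed (auto simp: S'_def)
  also have "\<dots> = (\<Sum>(A, B)\<in>S \<times> S. \<Sum>(X, Y)\<in>splits M.
      (coeff f A * coeff (mpow t A) X) * (coeff g B * coeff (mpow t B) Y))"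
    unfolding mpow_plus coeff_mult[of "mpow t _"] sum_distrib_left
    by (intro sum.cong) (auto simp: mult_ac case_prod_unfold sum_distrib_left)
  also have "\<dots> = (\<Sum>(X, Y)\<in>splits M. \<Sum>(A, B)\<in>S \<times> S.
      (coeff f A * coeff (mpow t A) X) * (coeff g B * coeff (mpow t B) Y))"
    unfolding case_prod_unfold by (rule sum.swap)
  also have "\<dots> = (\<Sum>(X, Y)\<in>splits M. coeff (ev t f) X * coeff (ev t g) Y)"
  proof (rule sum.cong, rule refl)
    fix x assume "x \<in> splits M"
    then obtain X Y where x: "x = (X, Y)" "X + Y = M" by auto
    have "coeff (ev t f) X = (\<Sum>A\<in>S. coeff f A * coeff (mpow t A) X)"
      by (rule coeff_ev[OF t fin]) (use x S in blast)
    moreover have "coeff (ev t g) Y = (\<Sum>A\<in>S. coeff g A * coeff (mpow t A) Y)"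
      by (rule coeff_ev[OF t fin]) (use x S in blast)
    ultimately show "(case x of (X, Y) \<Rightarrow> \<Sum>(A, B)\<in>S \<times> S.
          (coeff f A * coeff (mpow t A) X) * (coeff g B * coeff (mpow t B) Y)) =
        (case x of (X, Y) \<Rightarrow> coeff (ev t f) X * coeff (ev t g) Y)"
      by (simp add: x sum_product sum.cartesian_product)
  qed
  also have "\<dots> = coeff (ev t f * ev t g) M" by (simp add: coeff_mult)
  finally show "coeff (ev t (f * g)) M = coeff (ev t f * ev t g) M" .
qed

lemma cont_hom_ev:
  assumes t: "admissible t"
  shows "cont_hom UNIV (ev t)"
  unfolding cont_hom_def cont_additive_def
proof (intro conjI allI ballI)
  fix f g
  show "ev t (f + g) = ev t f + ev t g"
    by (rule mseries_eqI) (simp add: coeff_ev'[OF t] distrib_right sum.distrib)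
  show "ev t (f * g) = ev t f * ev t g" by (rule ev_mult[OF t])
next
  fix M
  show "\<exists>S. finite S \<and> (\<forall>f\<in>UNIV. (\<forall>N\<in>S. coeff f N = 0) \<longrightarrow> coeff (ev t f) M = 0)"
    by (rule exI[of _ "{l. coeff (mpow t l) M \<noteq> 0}"])
      (use t in \<open>auto simp: coeff_ev'[OF t] admissible_def\<close>)
next
  fix a
  show "ev t (const a) = const a"
  proof (rule mseries_eqI)
    fix M
    have "coeff (ev t (const a)) M = (\<Sum>l\<in>{{#}}. coeff (const a) l * coeff (mpow t l) M)"
      by (rule coeff_ev[OF t]) (auto split: if_splits)
    thus "coeff (ev t (const a)) M = coeff (const a) M" by simp
  qed
qed

lemmas ev_simps = cont_hom_additiveD[OF cont_hom_ev ring_closed_UNIV, simplified]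
  cont_homD[OF cont_hom_ev ring_closed_UNIV, simplified]

lemma ev_mon:
  assumes t: "admissible t"
  shows "ev t (mon N) = mpow t N"
proof (rule mseries_eqI)
  fix M
  have "coeff (ev t (mon N)) M = (\<Sum>l\<in>{N}. coeff (mon N) l * coeff (mpow t l) M)"
    by (rule coeff_ev[OF t]) (auto split: if_splits)
  thus "coeff (ev t (mon N)) M = coeff (mpow t N) M" by simp
qed

lemma cont_hom_mpow:
  assumes "cont_hom D T" "ring_closed D" "\<And>i. i \<in># l \<Longrightarrow> t i \<in> D"
  shows "T (mpow t l) = mpow (\<lambda>i. T (t i)) l"
  unfolding mpow_def using assms(3) by (rule cont_homD(6)[OF assms(1,2)])

lemma ring_closed_mpow: "ring_closed D \<Longrightarrow> (\<And>i. i \<in># l \<Longrightarrow> t i \<in> D) \<Longrightarrow> mpow t l \<in> D"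
  unfolding mpow_def by (rule ring_closed_prod_mset)

text \<open>Convergence for the family \<open>T (s i)\<close> is inherited from that of
  \<open>ev s c\<close> through continuity, so no admissibility is demanded of the image family. All
  composition laws below come from this lemma.\<close>

lemma cont_hom_ev_comp:
  assumes T: "cont_hom D T" and D: "ring_closed D"
    and s: "admissible s" "\<And>l i. coeff c l \<noteq> 0 \<Longrightarrow> i \<in># l \<Longrightarrow> s i \<in> D" "ev s c \<in> D"
  shows "((\<lambda>l. const (coeff c l) * mpow (\<lambda>i. T (s i)) l) has_sum T (ev s c)) UNIV"
    and "T (ev s c) = ev (\<lambda>i. T (s i)) c"
proof -
  have mp: "const (coeff c l) * mpow s l \<in> D \<and>
      T (const (coeff c l) * mpow s l) = const (coeff c l) * mpow (\<lambda>i. T (s i)) l" for l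
  proof (cases "coeff c l = 0")
    case False
    hence l: "mpow s l \<in> D" using s(2) by (intro ring_closed_mpow[OF D]) auto
    have "T (mpow s l) = mpow (\<lambda>i. T (s i)) l"
      by (rule cont_hom_mpow[OF T D]) (rule s(2)[OF False])
    thus ?thesis
      using l ring_closedD(1)[OF D] by (simp add: cont_homD(2,3)[OF T D] ring_closedD(5)[OF D])
  next
    case True
    thus ?thesis using ring_closedD(2)[OF D] cont_hom_additiveD(2)[OF T D D] by simp
  qed
  have "((\<lambda>l. T (const (coeff c l) * mpow s l)) has_sum T (ev s c)) UNIV"
    by (rule has_sum_cont_hom[OF T D D _ s(3) ev_has_sum[OF s(1)]]) (use mp in auto)
  thus *: "((\<lambda>l. const (coeff c l) * mpow (\<lambda>i. T (s i)) l) has_sum T (ev s c)) UNIV"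
    using mp by simp
  show "T (ev s c) = ev (\<lambda>i. T (s i)) c"
    unfolding ev_def[of "\<lambda>i. T (s i)"] by (rule infsumI[symmetric, OF *])
qed

lemma ev_ev:
  assumes "admissible t" "admissible s"
  shows "ev t (ev s c) = ev (\<lambda>i. ev t (s i)) c"
  by (rule cont_hom_ev_comp(2)[OF cont_hom_ev[OF assms(1)] ring_closed_UNIV assms(2)]) auto

lemma finite_multisets_size_le:
  assumes "finite A"
  shows "finite {M. set_mset M \<subseteq> A \<and> size M \<le> n}"
proof (rule finite_subset)
  show "{M. set_mset M \<subseteq> A \<and> size M \<le> n} \<subseteq> mset ` {xs. set xs \<subseteq> A \<and> length xs \<le> n}"
  proof
    fix M assume M: "M \<in> {M. set_mset M \<subseteq> A \<and> size M \<le> n}"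
    obtain xs where "M = mset xs" by (metis ex_mset)
    with M show "M \<in> mset ` {xs. set xs \<subseteq> A \<and> length xs \<le> n}" by auto
  qed
  show "finite (mset ` {xs. set xs \<subseteq> A \<and> length xs \<le> n})"
    using assms by (intro finite_imageI finite_lists_length_le)
qed

lemma finite_partitions: "finite {l :: nat multiset. 0 \<notin># l \<and> sum_mset l \<le> n}"
proof (rule finite_subset)
  show "{l :: nat multiset. 0 \<notin># l \<and> sum_mset l \<le> n} \<subseteq> {M. set_mset M \<subseteq> {..n} \<and> size M \<le> n}"
  proof safe
    fix l :: "nat multiset" assume l: "0 \<notin># l" "sum_mset l \<le> n"
    have "size l \<le> sum_mset l" using l(1) by (induction l) auto
    thus "size l \<le> n" using l(2) by simp
    fix x assume "x \<in># l"
    then obtain l' where "l = add_mset x l'" by (meson mset_add)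
    thus "x \<le> n" using l(2) by simp
  qed
qed (simp add: finite_multisets_size_le)

text \<open>\<open>t 0 = 0\<close> is demanded because index 0 has weight 0 and would allow
  infinitely many \<open>l\<close> of the same weight.\<close>

definition graded :: "(nat \<Rightarrow> mseries) \<Rightarrow> bool" where
  "graded t \<longleftrightarrow> t 0 = 0 \<and> (\<forall>n. ord_ge n (t n))"

lemma ord_ge_mpow:
  assumes "\<And>i. i \<in># l \<Longrightarrow> ord_ge (b * i) (t i)"
  shows "ord_ge (b * sum_mset l) (mpow t l)"
  using assms by (induction l) (auto simp: distrib_left intro: ord_ge_mult)

lemma graded_mpow:
  assumes "graded t" "coeff (mpow t l) M \<noteq> 0"
  shows "0 \<notin># l" "sum_mset l \<le> size M"
proof -
  show "0 \<notin># l" using assms by (auto simp: graded_def dest: mpow_zero)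
  have "ord_ge (1 * sum_mset l) (mpow t l)"
    by (rule ord_ge_mpow) (use assms in \<open>auto simp: graded_def\<close>)
  thus "sum_mset l \<le> size M" using assms(2) by (auto simp: ord_ge_def not_le[symmetric])
qed

lemma graded_admissible: "graded t \<Longrightarrow> admissible t"
  unfolding admissible_def using graded_mpow
  by (intro allI finite_subset[OF _ finite_partitions[of "size _"]] subsetI) blast

text \<open>Generators are numbered from 1, so coordinates involve no variable 0; the multisets
  \<open>l\<close> that remain are the partitions.\<close>

definition zero_free :: "mseries \<Rightarrow> bool" where
  "zero_free c \<longleftrightarrow> (\<forall>l. 0 \<in># l \<longrightarrow> coeff c l = 0)"

lemma ev_zero_free: "zero_free c \<Longrightarrow> (\<And>i. i > 0 \<Longrightarrow> t i = t' i) \<Longrightarrow> ev t c = ev t' c"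
  unfolding zero_free_def by (intro ev_cong mpow_cong) (metis neq0_conv)

text \<open>\<open>sym_p 0\<close>, \<open>sym_h 0\<close> and \<open>sym_e 0\<close> all equal 1,
  which would destroy convergence; zero-free coordinates do not see the change.\<close>

definition no_zero :: "(nat \<Rightarrow> mseries) \<Rightarrow> nat \<Rightarrow> mseries" where
  "no_zero t i = (if i = 0 then 0 else t i)"

lemma no_zero_0 [simp]: "no_zero t 0 = 0"
  and no_zero_pos [simp]: "i > 0 \<Longrightarrow> no_zero t i = t i"
  by (auto simp: no_zero_def)

lemma graded_no_zero: "(\<And>n. n > 0 \<Longrightarrow> ord_ge n (t n)) \<Longrightarrow> graded (no_zero t)"
  by (auto simp: graded_def no_zero_def)

lemma ring_closed_zero_free: "ring_closed (Collect zero_free)"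
  unfolding ring_closed_def
proof (intro conjI allI ballI)
  fix f g assume *: "f \<in> Collect zero_free" "g \<in> Collect zero_free"
  thus "f + g \<in> Collect zero_free" by (auto simp: zero_free_def)
  have "coeff (f * g) l = 0" if "0 \<in># l" for l
    unfolding coeff_mult
  proof (intro sum.neutral ballI)
    fix x assume "x \<in> splits l"
    then obtain A B where "x = (A, B)" "0 \<in># A \<or> 0 \<in># B" using \<open>0 \<in># l\<close> by auto
    thus "(case x of (A, B) \<Rightarrow> coeff f A * coeff g B) = 0" using * by (auto simp: zero_free_def)
  qed
  thus "f * g \<in> Collect zero_free" by (simp add: zero_free_def)
qed (auto simp: zero_free_def)

definition vars :: "nat \<Rightarrow> mseries" where
  "vars i = mon {#i#}"

lemma mpow_vars: "mpow vars l = mon l"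
  by (induction l) (simp_all add: vars_def mon_mult)

lemma ev_vars: "admissible t \<Longrightarrow> ev t (vars i) = t i"
  by (simp add: vars_def ev_mon)

lemma has_sum_mons: "((\<lambda>l. const (coeff c l) * mon l) has_sum c) UNIV"
  by (rule has_sum_mseriesI[where S = "\<lambda>M. {M}"]) (auto split: if_splits)

lemma ev_vars_self: "ev vars c = c"
  unfolding ev_def mpow_vars by (rule infsumI[OF has_sum_mons])

section \<open>Symmetric series and their expansion in power sums\<close>

abbreviation SYM :: "mseries set" where
  "SYM \<equiv> Collect symmetric"

lemma symmetricD: "symmetric f \<Longrightarrow> bij \<pi> \<Longrightarrow> coeff f (image_mset \<pi> M) = coeff f M"
  by (auto simp: symmetric_def)

lemma image_mset_inv:
  assumes "bij \<pi>"
  shows "image_mset \<pi> (image_mset (inv' \<pi>) M) = M" "image_mset (inv' \<pi>) (image_mset \<pi> M) = M"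
  using assms by (simp_all add: multiset.map_comp bij_is_surj bij_is_inj surj_iff[symmetric] inj_iff[symmetric] o_def surj_f_inv_f)

lemma symmetric_mult:
  assumes "symmetric f" "symmetric g"
  shows "symmetric (f * g)"
  unfolding symmetric_def
proof (intro allI impI)
  fix \<pi> :: "nat \<Rightarrow> nat" and M assume \<pi>: "bij \<pi>"
  show "coeff (f * g) (image_mset \<pi> M) = coeff (f * g) M"
    unfolding coeff_mult
  proof (rule sum.reindex_bij_witness[where i = "\<lambda>(A, B). (image_mset \<pi> A, image_mset \<pi> B)"
        and j = "\<lambda>(A, B). (image_mset (inv' \<pi>) A, image_mset (inv' \<pi>) B)"], goal_cases)
    case (2 x)
    then obtain A B where "x = (A, B)" "A + B = image_mset \<pi> M" by auto
    thus ?case using image_mset_inv(2)[OF \<pi>, of M] by (auto simp flip: image_mset_union)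
  next
    case (5 x)
    then obtain A B where x: "x = (A, B)" by (cases x)
    show ?case
      using symmetricD[OF assms(1) \<pi>, of "image_mset (inv' \<pi>) A"]
        symmetricD[OF assms(2) \<pi>, of "image_mset (inv' \<pi>) B"]
      by (simp add: x image_mset_inv[OF \<pi>])
  qed (auto simp: image_mset_inv[OF \<pi>])
qed

lemma ring_closed_SYM [simp]: "ring_closed SYM"
  by (auto simp: ring_closed_def symmetric_mult) (auto simp: symmetric_def)

lemmas symmetric_intros [simp, intro] = ring_closedD[OF ring_closed_SYM, unfolded mem_Collect_eq]
lemmas symmetric_power [simp, intro] = ring_closed_power[OF ring_closed_SYM, unfolded mem_Collect_eq]
lemmas symmetric_sum [intro] = ring_closed_sum[OF ring_closed_SYM, unfolded mem_Collect_eq]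
lemmas symmetric_mpow = ring_closed_mpow[OF ring_closed_SYM, unfolded mem_Collect_eq]

lemma symmetric_sign_mult [simp]: "symmetric f \<Longrightarrow> symmetric ((-1) ^ n * f)"
  by auto

lemma has_sum_symmetric:
  assumes "(f has_sum s) A" "\<And>i. i \<in> A \<Longrightarrow> symmetric (f i)"
  shows "symmetric s"
  unfolding symmetric_def
proof (intro allI impI)
  fix \<pi> :: "nat \<Rightarrow> nat" and M assume \<pi>: "bij \<pi>"
  let ?S = "{i \<in> A. coeff (f i) M \<noteq> 0}"
  have *: "coeff (f i) (image_mset \<pi> M) = coeff (f i) M" if "i \<in> A" for i
    using assms(2)[OF that] \<pi> by (rule symmetricD)
  have "coeff s (image_mset \<pi> M) = (\<Sum>i\<in>?S. coeff (f i) (image_mset \<pi> M))"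
    by (rule has_sum_coeff(2)[OF assms(1)]) (use has_sum_coeff(1)[OF assms(1)] * in auto)
  also have "\<dots> = (\<Sum>i\<in>?S. coeff (f i) M)" by (rule sum.cong) (auto simp: *)
  also have "\<dots> = coeff s M"
    by (rule has_sum_coeff(2)[OF assms(1), symmetric]) (use has_sum_coeff(1)[OF assms(1)] in auto)
  finally show "coeff s (image_mset \<pi> M) = coeff s M" .
qed

lemma symmetric_ev:
  assumes "admissible t" "\<And>l i. coeff c l \<noteq> 0 \<Longrightarrow> i \<in># l \<Longrightarrow> symmetric (t i)"
  shows "symmetric (ev t c)"
proof (rule has_sum_symmetric[OF ev_has_sum[OF assms(1)]])
  fix l
  show "symmetric (const (coeff c l) * mpow t l)"
    using assms(2)[of l] by (cases "coeff c l = 0") (auto intro!: symmetric_mpow)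
qed

lemma coeff_sym_h [simp]: "coeff (sym_h n) M = (if size M = n then 1 else 0)"
  by (simp add: sym_h_def)

lemma coeff_sym_e: "coeff (sym_e n) M = (if size M = n \<and> (\<forall>i. count M i \<le> 1) then 1 else 0)"
  by (simp add: sym_e_def)

lemma coeff_sym_p: "coeff (sym_p n) M = (if \<exists>i. M = replicate_mset n i then 1 else 0)"
  by (simp add: sym_p_def)

lemma symmetric_sym_h [simp]: "symmetric (sym_h n)"
  by (simp add: symmetric_def)

lemma count_image_mset_inj: "inj f \<Longrightarrow> count (image_mset f M) (f x) = count M x"
  by (induction M) (auto simp: inj_eq)

lemma symmetric_sym_e [simp]: "symmetric (sym_e n)"
proof -
  have "(\<forall>i. count (image_mset \<pi> M) i \<le> 1) \<longleftrightarrow> (\<forall>i. count M i \<le> 1)" if "bij \<pi>" for \<pi> and M :: "nat multiset"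
  proof -
    have "count (image_mset \<pi> M) (\<pi> i) = count M i" for i
      using bij_is_inj[OF that] by (rule count_image_mset_inj)
    thus ?thesis using bij_is_surj[OF that] by (metis surjD)
  qed
  thus ?thesis unfolding symmetric_def coeff_sym_e by (metis size_image_mset)
qed

lemma symmetric_sym_p [simp]: "symmetric (sym_p n)"
  unfolding symmetric_def
proof (intro allI impI)
  fix \<pi> :: "nat \<Rightarrow> nat" and M assume \<pi>: "bij \<pi>"
  have "(\<exists>i. image_mset \<pi> M = replicate_mset n i) \<longleftrightarrow> (\<exists>i. M = replicate_mset n i)"
  proof
    assume "\<exists>i. image_mset \<pi> M = replicate_mset n i"
    then obtain i where "image_mset \<pi> M = replicate_mset n i" ..
    hence "M = image_mset (inv' \<pi>) (replicate_mset n i)" using image_mset_inv(2)[OF \<pi>, of M] by simp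
    thus "\<exists>i. M = replicate_mset n i" by auto
  qed auto
  thus "coeff (sym_p n) (image_mset \<pi> M) = coeff (sym_p n) M" by (simp add: coeff_sym_p)
qed

lemma ord_ge_sym_h [simp]: "ord_ge n (sym_h n)"
  and ord_ge_sym_e [simp]: "ord_ge n (sym_e n)"
  and ord_ge_sym_p [simp]: "ord_ge n (sym_p n)"
  by (auto simp: ord_ge_def coeff_sym_e coeff_sym_p)

lemma coeff_sym_p_mult:
  assumes "k > 0"
  shows "coeff (sym_p k * f) M = (\<Sum>i | k \<le> count M i. coeff f (M - replicate_mset k i))"
proof -
  have fin: "finite {i. k \<le> count M i}"
    by (rule finite_subset[of _ "set_mset M"]) (use assms in \<open>auto simp flip: count_greater_zero_iff\<close>)
  have "coeff (sym_p k * f) M =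
      (\<Sum>x\<in>(\<lambda>i. (replicate_mset k i, M - replicate_mset k i)) ` {i. k \<le> count M i}. coeff f (snd x))"
    unfolding coeff_mult
  proof (rule sum.mono_neutral_cong_right, goal_cases)
    case 3
    show ?case
    proof
      fix x assume x: "x \<in> splits M - (\<lambda>i. (replicate_mset k i, M - replicate_mset k i)) ` {i. k \<le> count M i}"
      then obtain A B where AB: "x = (A, B)" "A + B = M" by auto
      have "\<not> (\<exists>i. A = replicate_mset k i)"
      proof
        assume "\<exists>i. A = replicate_mset k i"
        then obtain i where "A = replicate_mset k i" ..
        hence "x = (replicate_mset k i, M - replicate_mset k i)" "k \<le> count M i" using AB by auto
        thus False using x by blast
      qed
      thus "(case x of (A, B) \<Rightarrow> coeff (sym_p k) A * coeff f B) = 0" by (simp add: AB coeff_sym_p)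
    qed
  qed (auto simp: coeff_sym_p count_le_replicate_mset_subset_eq)
  also have "\<dots> = (\<Sum>i | k \<le> count M i. coeff f (M - replicate_mset k i))"
  proof (subst sum.reindex)
    show "inj_on (\<lambda>i. (replicate_mset k i, M - replicate_mset k i)) {i. k \<le> count M i}"
      using assms by (auto simp: inj_on_def replicate_mset_eq_iff)
  qed simp
  finally show ?thesis .
qed

text \<open>The partition formed by the nonzero exponents of a monomial. By
  \<open>expo_eq_imp_bij\<close> it labels the orbits of monomials under permutations of the
  variables.\<close>

definition expo :: "nat multiset \<Rightarrow> nat multiset" where
  "expo M = image_mset (count M) (mset_set (set_mset M))"

lemma expo_empty [simp]: "expo {#} = {#}"
  by (simp add: expo_def)

lemma size_expo: "size (expo M) = card (set_mset M)"
  by (simp add: expo_def)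

lemma sum_expo: "sum_mset (expo M) = size M"
  by (simp add: expo_def size_multiset_overloaded_eq sum_unfold_sum_mset)

lemma zero_notin_expo: "0 \<notin># expo M"
  by (auto simp: expo_def count_eq_zero_iff)

lemma expo_add:
  assumes "i \<notin># M" "k > 0"
  shows "expo (replicate_mset k i + M) = add_mset k (expo M)"
proof -
  have "set_mset (replicate_mset k i + M) = insert i (set_mset M)" using assms by auto
  moreover have "image_mset (count (replicate_mset k i + M)) (mset_set (set_mset M)) = expo M"
    unfolding expo_def using assms by (intro image_mset_cong) auto
  ultimately show ?thesis
    using assms by (simp add: expo_def not_in_iff)
qed

lemma expo_remove:
  assumes "k \<in># expo M"
  obtains i M' where "M = replicate_mset k i + M'" "i \<notin># M'" "k > 0" "expo M = add_mset k (expo M')"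
proof -
  obtain i where i: "i \<in># M" "k = count M i" using assms by (auto simp: expo_def)
  define M' where "M' = filter_mset (\<lambda>x. x \<noteq> i) M"
  have "M = replicate_mset k i + M'"
    by (rule multiset_eqI) (auto simp: M'_def i)
  moreover have "i \<notin># M'" "k > 0" using i by (auto simp: M'_def)
  ultimately show thesis using that expo_add by metis
qed

lemma ex_expo: "0 \<notin># l \<Longrightarrow> \<exists>M. expo M = l"
proof (induction l)
  case (add k l)
  then obtain M where M: "expo M = l" by auto
  obtain i where "i \<notin># M" using ex_new_if_finite[OF infinite_UNIV_nat finite_set_mset] by blast
  thus ?case using expo_add[of i M k] add.prems M by auto
qed (auto intro: exI[of _ "{#}"])

lemma expo_eq_imp_bij:
  "expo M = expo N \<Longrightarrow> \<exists>\<pi>. bij \<pi> \<and> image_mset \<pi> M = N"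
proof (induction "expo M" arbitrary: M N)
  case empty
  hence "card (set_mset M) = 0" "card (set_mset N) = 0" by (metis size_empty size_expo)+
  thus ?case by (auto intro: exI[of _ id])
next
  case (add k l)
  have "k \<in># expo M" "k \<in># expo N" using add.hyps(2) add.prems by (metis union_single_eq_member)+
  then obtain i M' j N' where M: "M = replicate_mset k i + M'" "i \<notin># M'" "k > 0" "expo M = add_mset k (expo M')"
    and N: "N = replicate_mset k j + N'" "j \<notin># N'" "expo N = add_mset k (expo N')"
    by (metis expo_remove)
  have "l = expo M'" "expo M' = expo N'" using add.hyps(2) add.prems M(4) N(3) by simp_all
  then obtain \<pi> where \<pi>: "bij \<pi>" "image_mset \<pi> M' = N'" using add.hyps(1) by blast
  \<comment> \<open>Neither \<open>\<pi> i\<close> nor \<open>j\<close> occurs in \<open>N'\<close>,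
    so this transposition corrects the image of \<open>i\<close> and leaves \<open>N'\<close>
    alone.\<close>
  define \<rho> where "\<rho> = Transposition.transpose (\<pi> i) j \<circ> \<pi>"
  have "\<pi> i \<notin># N'" using M(2) \<pi> by (auto simp: bij_def inj_eq)
  have "bij \<rho>" unfolding \<rho>_def using \<pi>(1) by (intro bij_comp bij_transpose)
  moreover have "image_mset \<rho> M' = N'"
  proof -
    have "image_mset \<rho> M' = image_mset (Transposition.transpose (\<pi> i) j) N'"
      using \<pi>(2) by (simp add: \<rho>_def multiset.map_comp[symmetric])
    also have "\<dots> = image_mset id N'"
    proof (rule image_mset_cong)
      fix x assume "x \<in># N'"
      hence "x \<noteq> \<pi> i" "x \<noteq> j" using \<open>\<pi> i \<notin># N'\<close> N(2) by auto
      thus "Transposition.transpose (\<pi> i) j x = id x" by simp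
    qed
    finally show ?thesis by simp
  qed
  moreover have "\<rho> i = j" by (simp add: \<rho>_def)
  ultimately show ?case using M(1) N(1) by auto
qed

lemma symmetric_expo: "symmetric f \<Longrightarrow> expo M = expo N \<Longrightarrow> coeff f M = coeff f N"
  by (metis expo_eq_imp_bij symmetricD)

abbreviation "pp \<equiv> no_zero sym_p"

lemma graded_pp [simp]: "graded pp"
  by (rule graded_no_zero) simp

lemmas admissible_pp [simp] = graded_admissible[OF graded_pp]

text \<open>
  The product \<open>p\<^sub>l\<close> is unitriangular up to nonzero factors with respect to the monomial symmetric
  functions: its monomials have at most as many variables as \<open>l\<close> has parts.
\<close>

lemma coeff_mpow_pp_nonzero:
  "coeff (mpow pp l) M \<noteq> 0 \<Longrightarrow> size M = sum_mset l \<and> size (expo M) \<le> size l \<and>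
     (size (expo M) = size l \<longrightarrow> expo M = l)"
proof (induction l arbitrary: M)
  case empty
  thus ?case by (auto split: if_splits)
next
  case (add k l)
  have k: "k > 0" using add.prems by (cases "k = 0") auto
  have "mpow pp (add_mset k l) = sym_p k * mpow pp l" using k by simp
  hence "coeff (sym_p k * mpow pp l) M \<noteq> 0" using add.prems by (simp only: not_False_eq_True)
  then obtain i where i: "k \<le> count M i" "coeff (mpow pp l) (M - replicate_mset k i) \<noteq> 0"
    unfolding coeff_sym_p_mult[OF k] by (auto dest: sum.not_neutral_contains_not_neutral)
  define B where "B = M - replicate_mset k i"
  have M: "M = replicate_mset k i + B"
    using i(1) by (simp add: B_def count_le_replicate_mset_subset_eq subset_mset.add_diff_inverse)
  have IH: "size B = sum_mset l" "size (expo B) \<le> size l" "size (expo B) = size l \<Longrightarrow> expo B = l"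
    using add.IH[of B] i(2) by (auto simp: B_def)
  have "set_mset M = insert i (set_mset B)" using M k by auto
  hence card: "size (expo M) = (if i \<in># B then size (expo B) else Suc (size (expo B)))"
    by (simp add: size_expo insert_absorb)
  show ?case
  proof (intro conjI impI)
    show "size M = sum_mset (add_mset k l)" using M IH(1) by simp
    show "size (expo M) \<le> size (add_mset k l)" using card IH(2) by (simp split: if_splits)
    assume "size (expo M) = size (add_mset k l)"
    hence "i \<notin># B" "size (expo B) = size l" using card IH(2) by (auto split: if_splits)
    thus "expo M = add_mset k l" using M IH(3) k by (simp add: expo_add)
  qed
qed

text \<open>Rules out cancellation in the proof of \<open>coeff_mpow_pp_expo\<close>.\<close>

lemma coeff_mpow_pp_Nats: "coeff (mpow pp l) M \<in> \<nat>"
proof (induction l arbitrary: M)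
  case (add k l)
  show ?case
  proof (cases "k = 0")
    case False
    have "sum f A \<in> \<nat>" if "\<And>i. f i \<in> \<nat>" for f :: "nat \<Rightarrow> complex" and A
      using that by (induction A rule: infinite_finite_induct) auto
    thus ?thesis using add False by (simp add: coeff_sym_p_mult)
  qed simp
qed simp

text \<open>Split off a variable with exponent k: choosing it in \<open>sym_p k\<close> contributes
  a nonzero natural number by induction, and the other choices contribute natural numbers
  too.\<close>

lemma coeff_mpow_pp_expo: "coeff (mpow pp (expo M)) M \<noteq> 0"
proof (induction "expo M" arbitrary: M)
  case empty
  hence "card (set_mset M) = 0" by (metis size_empty size_expo)
  thus ?case by simp
next
  case (add k l)
  have "k \<in># expo M" using add.hyps(2) by (metis union_single_eq_member)
  then obtain i M' where M: "M = replicate_mset k i + M'" "i \<notin># M'" "k > 0" "expo M = add_mset k (expo M')"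
    by (metis expo_remove)
  have l: "l = expo M'" using add.hyps(2) M(4) by simp
  have nz: "coeff (mpow pp l) M' \<noteq> 0" using add.hyps(1)[OF l] l by simp
  define g where "g j = coeff (mpow pp l) (M - replicate_mset k j)" for j
  have fin: "finite {j. k \<le> count M j}"
    by (rule finite_subset[of _ "set_mset M"]) (use M(3) in \<open>auto simp flip: count_greater_zero_iff\<close>)
  \<comment> \<open>The real parts carry the order that \<open>sum_nonneg_eq_0_iff\<close>
    needs.\<close>
  have Nats: "Re (g j) \<ge> 0 \<and> g j = of_real (Re (g j))" for j
    using coeff_mpow_pp_Nats[of l "M - replicate_mset k j"] unfolding g_def Nats_def by auto
  have "i \<in> {j. k \<le> count M j}" "g i \<noteq> 0" using M nz by (auto simp: g_def not_in_iff)
  hence "(\<Sum>j | k \<le> count M j. Re (g j)) \<noteq> 0"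
    using fin Nats by (metis (no_types, lifting) of_real_0 sum_nonneg_eq_0_iff)
  hence "Re (\<Sum>j | k \<le> count M j. g j) \<noteq> 0" by simp
  hence "(\<Sum>j | k \<le> count M j. g j) \<noteq> 0" by (metis zero_complex.sel(1))
  hence "coeff (sym_p k * mpow pp l) M \<noteq> 0"
    unfolding coeff_sym_p_mult[OF M(3)] g_def .
  thus ?case using M(3) by (simp add: add.hyps(2)[symmetric])
qed

text \<open>Among the partitions of n with nonzero coefficient take one with the most parts. A
  monomial of that exponent type occurs in no other p_l with nonzero coefficient, so it would
  survive in \<open>ev pp c\<close>.\<close>

lemma pp_triangular:
  assumes c: "zero_free c" and 0: "\<And>M. size M = n \<Longrightarrow> coeff (ev pp c) M = 0" and l: "sum_mset l = n"
  shows "coeff c l = 0"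
proof (rule ccontr)
  assume nz: "coeff c l \<noteq> 0"
  define B where "B = {l. sum_mset l = n \<and> coeff c l \<noteq> 0}"
  have "B \<subseteq> {l. 0 \<notin># l \<and> sum_mset l \<le> n}" using c by (auto simp: B_def zero_free_def)
  hence "finite B" using finite_partitions finite_subset by blast
  moreover have "l \<in> B" using nz l by (simp add: B_def)
  ultimately have "Max (size ` B) \<in> size ` B" "\<And>l. l \<in> B \<Longrightarrow> size l \<le> Max (size ` B)"
    by (auto intro!: Max_in)
  then obtain m where m: "m \<in> B" "\<And>l. l \<in> B \<Longrightarrow> size l \<le> size m" by auto
  have "0 \<notin># m" using m(1) c by (auto simp: B_def zero_free_def)
  then obtain M where M: "expo M = m" using ex_expo by blast
  have size: "size M = n" using sum_expo[of M] M m(1) by (simp add: B_def)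
  have "coeff (ev pp c) M = (\<Sum>l\<in>{m}. coeff c l * coeff (mpow pp l) M)"
  proof (rule coeff_ev)
    fix l assume *: "coeff c l \<noteq> 0" "coeff (mpow pp l) M \<noteq> 0"
    hence "l \<in> B" using coeff_mpow_pp_nonzero size by (auto simp: B_def)
    thus "l \<in> {m}" using m(2)[of l] coeff_mpow_pp_nonzero[OF *(2)] M by auto
  qed auto
  hence "coeff (ev pp c) M \<noteq> 0" using coeff_mpow_pp_expo[of M] M m(1) by (simp add: B_def)
  thus False using 0[OF size] by simp
qed

lemma ev_pp_inj:
  assumes "zero_free c" "zero_free c'" "ev pp c = ev pp c'"
  shows "c = c'"
proof (rule mseries_eqI)
  fix l
  have "coeff (c - c') l = 0"
  proof (rule pp_triangular[OF _ _ refl])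
    show "zero_free (c - c')" using assms by (auto simp: zero_free_def)
    show "coeff (ev pp (c - c')) M = 0" for M using assms(3) by (simp add: ev_simps(4))
  qed
  thus "coeff c l = coeff c' l" by simp
qed

text \<open>Induction on a bound for the number of variables in a monomial of \<open>f\<close>.
  Products p_l with exactly \<open>Suc k\<close> parts remove all monomials in \<open>Suc k\<close>
  variables and introduce none with more.\<close>

lemma ev_pp_onto_homogeneous:
  "symmetric f \<Longrightarrow> homogeneous n f \<Longrightarrow> (\<And>M. coeff f M \<noteq> 0 \<Longrightarrow> size (expo M) \<le> k) \<Longrightarrow>
     \<exists>c. zero_free c \<and> ev pp c = f"
proof (induction k arbitrary: f)
  case 0
  have "f = const (coeff f {#})"
  proof (rule mseries_eqI)
    fix M
    show "coeff f M = coeff (const (coeff f {#})) M"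
      using 0(3)[of M] by (auto simp: size_expo)
  qed
  moreover have "ev pp (const a) = const a" "zero_free (const a)" for a
    by (auto simp: ev_simps zero_free_def)
  ultimately show ?case by metis
next
  case (Suc k)
  define rep where "rep l = (SOME M. expo M = l)" for l
  have rep: "expo (rep (expo M)) = expo M" for M unfolding rep_def by (rule someI) simp
  \<comment> \<open>The denominator is a diagonal entry of the triangular matrix, nonzero by
    \<open>coeff_mpow_pp_expo\<close>. By symmetry any monomial of type \<open>l\<close> could
    replace \<open>rep l\<close>.\<close>
  define c where "c = Abs_mseries (\<lambda>l. if 0 \<notin># l \<and> sum_mset l = n \<and> size l = Suc k
     then coeff f (rep l) / coeff (mpow pp l) (rep l) else 0)"
  have c: "coeff c l \<noteq> 0 \<Longrightarrow> 0 \<notin># l \<and> sum_mset l = n \<and> size l = Suc k" for l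
    by (auto simp: c_def split: if_splits)
  hence zf: "zero_free c" by (auto simp: zero_free_def)
  define g where "g = ev pp c"
  have g: "symmetric g" unfolding g_def by (rule symmetric_ev) (auto simp: no_zero_def)
  have g_nz: "size M = n \<and> size (expo M) \<le> Suc k" if "coeff g M \<noteq> 0" for M
  proof -
    have "\<exists>l. coeff c l \<noteq> 0 \<and> coeff (mpow pp l) M \<noteq> 0"
    proof (rule ccontr)
      assume "\<not> ?thesis"
      hence z: "coeff c l * coeff (mpow pp l) M = 0" for l by auto
      show False using that unfolding g_def coeff_ev'[OF admissible_pp] z by simp
    qed
    then obtain l where "coeff c l \<noteq> 0" "coeff (mpow pp l) M \<noteq> 0" by blast
    thus ?thesis using c[of l] coeff_mpow_pp_nonzero[of l M] by simp
  qed
  have g_eq: "coeff g M = coeff f M" if "size M = n" "size (expo M) = Suc k" for M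
  proof -
    have "coeff g M = (\<Sum>l\<in>{expo M}. coeff c l * coeff (mpow pp l) M)"
      unfolding g_def
    proof (rule coeff_ev)
      fix l assume "coeff c l \<noteq> 0" "coeff (mpow pp l) M \<noteq> 0"
      thus "l \<in> {expo M}" using c[of l] coeff_mpow_pp_nonzero[of l M] that by simp
    qed auto
    also have "\<dots> = coeff c (expo M) * coeff (mpow pp (expo M)) M" by simp
    also have "coeff c (expo M) = coeff f (rep (expo M)) / coeff (mpow pp (expo M)) (rep (expo M))"
      using that by (simp add: c_def zero_notin_expo sum_expo)
    also have "coeff f (rep (expo M)) = coeff f M"
      by (rule symmetric_expo[OF Suc.prems(1) rep])
    also have "coeff (mpow pp (expo M)) (rep (expo M)) = coeff (mpow pp (expo M)) M"
      by (rule symmetric_expo[OF symmetric_mpow rep]) (auto simp: no_zero_def)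
    finally show ?thesis using coeff_mpow_pp_expo[of M] by simp
  qed
  have "\<exists>c'. zero_free c' \<and> ev pp c' = f - g"
  proof (rule Suc.IH)
    show "symmetric (f - g)" using Suc.prems(1) g by auto
    show "homogeneous n (f - g)" using Suc.prems(2) g_nz unfolding homogeneous_def
      by (metis diff_zero minus_mseries.rep_eq)
    fix M assume nz: "coeff (f - g) M \<noteq> 0"
    hence "size (expo M) \<le> Suc k" "size M = n"
      using Suc.prems(3)[of M] g_nz[of M] Suc.prems(2) unfolding homogeneous_def by (cases "coeff g M = 0"; auto)+
    moreover have "\<not> (size M = n \<and> size (expo M) = Suc k)" using g_eq[of M] nz by auto
    ultimately show "size (expo M) \<le> k" by simp
  qed
  then obtain c' where "zero_free c'" "ev pp c' = f - g" by blast
  thus ?case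
    using zf by (intro exI[of _ "c + c'"]) (auto simp: ev_simps(1) g_def zero_free_def)
qed

lemma coeff_deg_part [simp]: "coeff (deg_part n f) M = (if size M = n then coeff f M else 0)"
  by (simp add: deg_part_def)

lemma ev_pp_onto:
  assumes "symmetric f"
  shows "\<exists>c. zero_free c \<and> ev pp c = f"
proof -
  have "\<exists>c. zero_free c \<and> ev pp c = deg_part n f" for n
  proof (rule ev_pp_onto_homogeneous[where n = n and k = n])
    show "symmetric (deg_part n f)" "homogeneous n (deg_part n f)"
      using assms by (auto simp: symmetric_def homogeneous_def)
    fix M assume "coeff (deg_part n f) M \<noteq> 0"
    hence "sum_mset (expo M) = n" by (auto simp: sum_expo split: if_splits)
    moreover have "size l \<le> sum_mset l" if "0 \<notin># l" for l :: "nat multiset" using that by (induction l) auto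
    ultimately show "size (expo M) \<le> n" using zero_notin_expo by metis
  qed
  then obtain C where C: "\<And>n. zero_free (C n)" "\<And>n. ev pp (C n) = deg_part n f" by metis
  \<comment> \<open>The product p_l is homogeneous of degree \<open>sum_mset l\<close>, so each
    homogeneous component of \<open>f\<close> reads only its own part of \<open>c\<close>.\<close>
  define c where "c = Abs_mseries (\<lambda>l. coeff (C (sum_mset l)) l)"
  have "ev pp c = f"
  proof (rule mseries_eqI)
    fix M
    have "coeff (ev pp c) M = coeff (ev pp (C (size M))) M"
      unfolding coeff_ev'[OF admissible_pp]
      by (rule sum.cong) (auto simp: c_def dest: coeff_mpow_pp_nonzero)
    thus "coeff (ev pp c) M = coeff f M" by (simp add: C(2))
  qed
  moreover have "zero_free c" using C(1) by (auto simp: c_def zero_free_def)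
  ultimately show ?thesis by blast
qed

text \<open>The coordinates with respect to the power sums, as a series in which the variable \<open>i\<close> stands for \<open>p\<^sub>i\<close>.\<close>

definition p_coords :: "mseries \<Rightarrow> mseries" where
  "p_coords f = (THE c. zero_free c \<and> ev pp c = f)"

lemma p_coords_unique: "zero_free c \<Longrightarrow> ev pp c = f \<Longrightarrow> p_coords f = c"
  unfolding p_coords_def by (rule the_equality) (auto intro: ev_pp_inj)

lemma p_coords:
  assumes "symmetric f"
  shows "zero_free (p_coords f)" "ev pp (p_coords f) = f"
  using ev_pp_onto[OF assms] p_coords_unique by auto

lemma cont_hom_p_coords: "cont_hom SYM p_coords"
  unfolding cont_hom_def cont_additive_def
proof (intro conjI allI ballI)
  fix f g assume "f \<in> SYM" "g \<in> SYM"
  hence *: "zero_free (p_coords f)" "zero_free (p_coords g)" "ev pp (p_coords f) = f" "ev pp (p_coords g) = g"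
    by (auto simp: p_coords)
  show "p_coords (f + g) = p_coords f + p_coords g" "p_coords (f * g) = p_coords f * p_coords g"
    using * ring_closedD(4,5)[OF ring_closed_zero_free] by (auto intro!: p_coords_unique simp: ev_simps)
next
  fix l
  \<comment> \<open>One monomial for each partition of weight at most that of \<open>l\<close>; by
    symmetry these determine the coefficients at all monomials of the same types.\<close>
  let ?S = "(\<lambda>m. SOME M. expo M = m) ` {m. 0 \<notin># m \<and> sum_mset m \<le> sum_mset l}"
  show "\<exists>S. finite S \<and> (\<forall>f\<in>SYM. (\<forall>N\<in>S. coeff f N = 0) \<longrightarrow> coeff (p_coords f) l = 0)"
  proof (intro exI[of _ ?S] conjI ballI impI)
    show "finite ?S" by (intro finite_imageI finite_partitions)
    fix f assume f: "f \<in> SYM" "\<forall>N\<in>?S. coeff f N = 0"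
    show "coeff (p_coords f) l = 0"
    proof (rule pp_triangular[OF _ _ refl])
      show "zero_free (p_coords f)" using f(1) by (simp add: p_coords)
      fix M :: "nat multiset" assume M: "size M = sum_mset l"
      have "expo (SOME N. expo N = expo M) = expo M" by (rule someI) simp
      moreover have "coeff f (SOME N. expo N = expo M) = 0"
        using f(2) M zero_notin_expo[of M] sum_expo[of M] by auto
      ultimately have "coeff f M = 0" using symmetric_expo[of f "SOME N. expo N = expo M" M] f(1) by simp
      thus "coeff (ev pp (p_coords f)) M = 0" using f(1) by (simp add: p_coords)
    qed
  qed
next
  show "p_coords (const a) = const a" for a
    by (rule p_coords_unique) (auto simp: zero_free_def ev_simps)
qed

text \<open>Resolves the definite description. Changing \<open>b\<close> at index 0 is harmless
  because \<open>c\<close> and all its competitors vanish at every \<open>l\<close> with a part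
  0.\<close>

lemma gen_coeffs_eq:
  assumes b: "graded (no_zero b)" and c: "zero_free c" "ev (no_zero b) c = f"
    and inj: "\<And>c'. zero_free c' \<Longrightarrow> ev (no_zero b) c' = f \<Longrightarrow> c' = c"
  shows "gen_coeffs b f = coeff c"
proof -
  have eq: "const (coeff d l) * (\<Prod>i\<in>#l. b i) = const (coeff d l) * mpow (no_zero b) l"
    if "zero_free d" for d l
  proof (cases "0 \<in># l")
    case True
    thus ?thesis using that by (simp add: zero_free_def)
  next
    case False
    hence "mpow b l = mpow (no_zero b) l" by (intro mpow_cong) (auto simp: no_zero_def)
    thus ?thesis by (simp add: mpow_def)
  qed
  show ?thesis
    unfolding gen_coeffs_def
  proof (rule the_equality)
    show "(\<forall>l. 0 \<in># l \<longrightarrow> coeff c l = 0) \<and> ((\<lambda>l. const (coeff c l) * (\<Prod>i\<in>#l. b i)) has_sum f) UNIV"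
      using c ev_has_sum[OF graded_admissible[OF b], of c] unfolding eq[OF c(1)] by (simp add: zero_free_def)
  next
    fix d assume d: "(\<forall>l. 0 \<in># l \<longrightarrow> d l = 0) \<and> ((\<lambda>l. const (d l) * (\<Prod>i\<in>#l. b i)) has_sum f) UNIV"
    define c' where "c' = Abs_mseries d"
    have c': "zero_free c'" "((\<lambda>l. const (coeff c' l) * (\<Prod>i\<in>#l. b i)) has_sum f) UNIV"
      using d by (simp_all add: c'_def zero_free_def)
    have "ev (no_zero b) c' = f"
      unfolding ev_def by (rule infsumI) (use c'(2) in \<open>simp add: eq[OF c'(1)]\<close>)
    hence "c' = c" by (rule inj[OF c'(1)])
    thus "d = coeff c" by (auto simp: c'_def)
  qed
qed

lemma subst_gens_eq:
  assumes "graded (no_zero b)" "zero_free c" "ev (no_zero b) c = f"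
    "\<And>c'. zero_free c' \<Longrightarrow> ev (no_zero b) c' = f \<Longrightarrow> c' = c"
  shows "subst_gens b t f = ev t c"
proof -
  have "gen_coeffs b f = coeff c" by (rule gen_coeffs_eq[OF assms(1-3)]) (rule assms(4))
  thus ?thesis by (simp add: subst_gens_def ev_def mpow_def)
qed

section \<open>Plethysm\<close>

lemma mpow_mon_replicate: "mpow (\<lambda>i. mon (replicate_mset k i)) l = mon (repeat_mset k l)"
  by (induction l) (simp_all add: mon_mult)

lemma repeat_mset_inj: "k > 0 \<Longrightarrow> repeat_mset k A = repeat_mset k B \<longleftrightarrow> A = B"
  by (auto simp: multiset_eq_iff)

lemma repeat_replicate: "repeat_mset k (replicate_mset j i) = replicate_mset (k * j) i"
  by (simp add: multiset_eq_iff)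

lemma admissible_powers:
  assumes "k > 0"
  shows "admissible (\<lambda>i. mon (replicate_mset k i))"
  unfolding admissible_def mpow_mon_replicate
proof
  fix M :: "nat multiset"
  have "{l. coeff (mon (repeat_mset k l)) M \<noteq> 0} \<subseteq> (if \<exists>N. repeat_mset k N = M then {SOME N. repeat_mset k N = M} else {})"
    by (auto simp: repeat_mset_inj[OF assms])
  thus "finite {l. coeff (mon (repeat_mset k l)) M \<noteq> 0}" by (rule finite_subset) simp
qed

text \<open>Replacing each x_i by its k-th power is a substitution, so p_k[g] inherits the
  homomorphism and composition laws of \<open>ev\<close>.\<close>

lemma power_subst_eq_ev:
  assumes "k > 0"
  shows "power_subst k g = ev (\<lambda>i. mon (replicate_mset k i)) g"
proof (rule mseries_eqI)
  fix M
  have "coeff (ev (\<lambda>i. mon (replicate_mset k i)) g) M =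
      (\<Sum>l | coeff (mon (repeat_mset k l)) M \<noteq> 0. coeff g l * coeff (mon (repeat_mset k l)) M)"
    by (simp add: coeff_ev'[OF admissible_powers[OF assms]] mpow_mon_replicate)
  also have "\<dots> = (\<Sum>l | repeat_mset k l = M. coeff g l)"
    by (rule sum.cong) auto
  finally show "coeff (power_subst k g) M = coeff (ev (\<lambda>i. mon (replicate_mset k i)) g) M"
    by (simp add: power_subst_def)
qed

lemma cont_hom_power_subst:
  assumes "k > 0"
  shows "cont_hom UNIV (power_subst k)"
proof -
  have "power_subst k = ev (\<lambda>i. mon (replicate_mset k i))"
    by (rule ext) (rule power_subst_eq_ev[OF assms])
  thus ?thesis using cont_hom_ev[OF admissible_powers[OF assms]] by simp
qed

lemma coeff_power_subst_repeat:
  assumes "k > 0"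
  shows "coeff (power_subst k g) (repeat_mset k N) = coeff g N"
  by (simp add: power_subst_def repeat_mset_inj[OF assms])

lemma coeff_power_subst_other: "(\<And>N. M \<noteq> repeat_mset k N) \<Longrightarrow> coeff (power_subst k g) M = 0"
  by (auto simp: power_subst_def intro!: sum.neutral)

lemma power_subst_power_subst:
  assumes "j > 0" "k > 0"
  shows "power_subst j (power_subst k g) = power_subst (j * k) g"
  using assms
  by (simp add: power_subst_eq_ev ev_ev[OF admissible_powers admissible_powers]
      ev_mon[OF admissible_powers] mpow_mon_replicate repeat_replicate)

lemma power_subst_1 [simp]: "power_subst (Suc 0) g = g"
  by (rule mseries_eqI) (simp add: power_subst_def)

lemma power_subst_sym_p:
  assumes "k > 0"
  shows "power_subst k (sym_p j) = sym_p (k * j)"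
proof (rule mseries_eqI)
  fix M
  show "coeff (power_subst k (sym_p j)) M = coeff (sym_p (k * j)) M"
  proof (cases "\<exists>N. M = repeat_mset k N")
    case True
    then obtain N where N: "M = repeat_mset k N" ..
    have "N = replicate_mset j i \<longleftrightarrow> M = replicate_mset (k * j) i" for i
      using repeat_mset_inj[OF assms, of N "replicate_mset j i"] unfolding N repeat_replicate by simp
    thus ?thesis unfolding N coeff_power_subst_repeat[OF assms] by (simp add: coeff_sym_p N)
  next
    case False
    hence "M \<noteq> replicate_mset (k * j) i" for i
      by (metis repeat_replicate)
    thus ?thesis using False by (simp add: coeff_power_subst_other coeff_sym_p)
  qed
qed

lemma image_mset_repeat: "image_mset f (repeat_mset k M) = repeat_mset k (image_mset f M)"
  by (induction k) auto

lemma symmetric_power_subst [simp]: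
  assumes "symmetric g" "k > 0"
  shows "symmetric (power_subst k g)"
  unfolding symmetric_def
proof (intro allI impI)
  fix \<pi> :: "nat \<Rightarrow> nat" and M assume \<pi>: "bij \<pi>"
  show "coeff (power_subst k g) (image_mset \<pi> M) = coeff (power_subst k g) M"
  proof (cases "\<exists>N. M = repeat_mset k N")
    case True
    thus ?thesis using symmetricD[OF assms(1) \<pi>]
      by (auto simp: image_mset_repeat coeff_power_subst_repeat[OF assms(2)])
  next
    case False
    have "image_mset \<pi> M \<noteq> repeat_mset k N" for N
    proof
      assume "image_mset \<pi> M = repeat_mset k N"
      hence "M = repeat_mset k (image_mset (inv' \<pi>) N)"
        by (metis \<pi> image_mset_inv(2) image_mset_repeat)
      thus False using False by blast
    qed
    thus ?thesis using False by (simp add: coeff_power_subst_other)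
  qed
qed

lemma ord_ge_power_subst:
  assumes "ord_ge n g"
  shows "ord_ge (n * k) (power_subst k g)"
  unfolding ord_ge_def
proof (intro allI impI)
  fix M :: "nat multiset" assume M: "size M < n * k"
  show "coeff (power_subst k g) M = 0"
  proof (cases "\<exists>N. M = repeat_mset k N")
    case True
    then obtain N where "M = repeat_mset k N" ..
    moreover from this have "size N < n" "k > 0"
      using M mult_less_cancel1[of k "size N" n] by (simp_all add: mult.commute[of n])
    ultimately show ?thesis using assms by (simp add: coeff_power_subst_repeat ord_ge_def)
  qed (auto intro: coeff_power_subst_other)
qed

abbreviation psub :: "mseries \<Rightarrow> nat \<Rightarrow> mseries" where
  "psub g \<equiv> no_zero (\<lambda>k. power_subst k g)"

abbreviation pos :: "mseries \<Rightarrow> bool" where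
  "pos g \<equiv> coeff g {#} = 0"

lemma graded_psub:
  assumes "pos g"
  shows "graded (psub g)"
  using ord_ge_power_subst[of 1 g] assms by (intro graded_no_zero) (simp add: ord_ge_1)

lemmas admissible_psub = graded_admissible[OF graded_psub]

lemma plethysm_eq_ev:
  assumes "symmetric f"
  shows "plethysm f g = ev (psub g) (p_coords f)"
proof -
  have "plethysm f g = ev (\<lambda>k. power_subst k g) (p_coords f)"
    unfolding plethysm_def
    by (rule subst_gens_eq[OF graded_pp p_coords[OF assms]]) (rule p_coords_unique[symmetric])
  also have "\<dots> = ev (psub g) (p_coords f)"
    by (rule ev_zero_free) (simp_all add: p_coords(1)[OF assms])
  finally show ?thesis .
qed

lemma cont_hom_cong: "cont_hom D T \<Longrightarrow> ring_closed D \<Longrightarrow> (\<And>f. f \<in> D \<Longrightarrow> T f = T' f) \<Longrightarrow> cont_hom D T'"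
  unfolding cont_hom_def cont_additive_def ring_closed_def by simp

lemma cont_hom_comp:
  assumes T: "cont_hom D T" and T': "cont_hom UNIV T'"
  shows "cont_hom D (\<lambda>f. T' (T f))"
  unfolding cont_hom_def cont_additive_def
proof (intro conjI ballI allI)
  fix M
  obtain S where S: "finite S" "\<And>f. (\<forall>N\<in>S. coeff f N = 0) \<Longrightarrow> coeff (T' f) M = 0"
    using T' unfolding cont_hom_def cont_additive_def by (metis UNIV_I)
  have "\<forall>N. \<exists>S. finite S \<and> (\<forall>f\<in>D. (\<forall>N\<in>S. coeff f N = 0) \<longrightarrow> coeff (T f) N = 0)"
    using T unfolding cont_hom_def cont_additive_def by blast
  then obtain R where R: "\<And>N. finite (R N)"
    "\<And>N f. f \<in> D \<Longrightarrow> (\<forall>N\<in>R N. coeff f N = 0) \<Longrightarrow> coeff (T f) N = 0" by metis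
  show "\<exists>S. finite S \<and> (\<forall>f\<in>D. (\<forall>N\<in>S. coeff f N = 0) \<longrightarrow> coeff (T' (T f)) M = 0)"
  proof (intro exI[of _ "\<Union>N\<in>S. R N"] conjI ballI impI)
    show "finite (\<Union>N\<in>S. R N)" using S(1) R(1) by blast
    fix f assume f: "f \<in> D" "\<forall>N\<in>(\<Union>N\<in>S. R N). coeff f N = 0"
    have "coeff (T f) N = 0" if "N \<in> S" for N by (rule R(2)[OF f(1)]) (use f(2) that in blast)
    thus "coeff (T' (T f)) M = 0" by (intro S(2)) blast
  qed
qed (use T T' in \<open>simp_all add: cont_hom_def cont_additive_def\<close>)

lemma cont_hom_plethysm:
  assumes "pos g"
  shows "cont_hom SYM (\<lambda>f. plethysm f g)"
proof (rule cont_hom_cong[OF cont_hom_comp[OF cont_hom_p_coords cont_hom_ev[OF admissible_psub[OF assms]]]])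
qed (auto simp: plethysm_eq_ev)

lemmas pleth_simps = cont_hom_additiveD[OF cont_hom_plethysm ring_closed_SYM ring_closed_SYM, unfolded mem_Collect_eq]
  cont_homD(2-6)[OF cont_hom_plethysm ring_closed_SYM, unfolded mem_Collect_eq]

lemma has_sum_plethysm:
  assumes "pos g" "(f has_sum s) A" "\<And>i. i \<in> A \<Longrightarrow> symmetric (f i)"
  shows "((\<lambda>i. plethysm (f i) g) has_sum plethysm s g) A"
  by (rule has_sum_cont_hom[OF cont_hom_plethysm[OF assms(1)] ring_closed_SYM ring_closed_SYM _ _ assms(2)])
    (use assms(3) has_sum_symmetric[OF assms(2,3)] in auto)

lemma symmetric_psub: "symmetric g \<Longrightarrow> symmetric (psub g i)"
  by (cases "i = 0") auto

lemma symmetric_plethysm [simp]: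
  assumes "symmetric f" "symmetric g" "pos g"
  shows "symmetric (plethysm f g)"
  unfolding plethysm_eq_ev[OF assms(1)]
  by (rule symmetric_ev[OF admissible_psub[OF assms(3)]]) (use assms(2) in \<open>simp add: symmetric_psub\<close>)

lemma p_coords_sym_p: "k > 0 \<Longrightarrow> p_coords (sym_p k) = vars k"
  by (rule p_coords_unique) (auto simp: zero_free_def vars_def ev_mon)

lemma plethysm_sym_p: "k > 0 \<Longrightarrow> pos g \<Longrightarrow> plethysm (sym_p k) g = power_subst k g"
  by (simp add: plethysm_eq_ev p_coords_sym_p ev_vars admissible_psub)

lemma plethysm_p1_left [simp]: "pos g \<Longrightarrow> plethysm (sym_p (Suc 0)) g = g"
  by (simp add: plethysm_sym_p)

lemma pos_sym_p [simp]: "k > 0 \<Longrightarrow> pos (sym_p k)"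
  by (simp add: coeff_sym_p)

lemma plethysm_p1_right [simp]:
  assumes "symmetric f"
  shows "plethysm f (sym_p (Suc 0)) = f"
proof -
  have "plethysm f (sym_p (Suc 0)) = ev pp (p_coords f)"
    unfolding plethysm_eq_ev[OF assms]
    by (rule ev_zero_free) (auto simp: p_coords[OF assms] power_subst_sym_p)
  thus ?thesis by (simp add: p_coords[OF assms])
qed

lemma p_coords_weight:
  assumes "symmetric f" "\<And>M. size M = sum_mset l \<Longrightarrow> coeff f M = 0"
  shows "coeff (p_coords f) l = 0"
  using assms by (intro pp_triangular[OF p_coords(1) _ refl]) (auto simp: p_coords)

text \<open>The expansion of \<open>f\<close> involves p_l only for partitions \<open>l\<close> of
  weight at least \<open>a\<close>, and p_j[g] has order at least \<open>j * b\<close>, so p_l[g]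
  has order at least \<open>b\<close> times the weight of \<open>l\<close>.\<close>

lemma ord_ge_plethysm:
  assumes "symmetric f" "ord_ge a f" "ord_ge b g" "b > 0"
  shows "ord_ge (a * b) (plethysm f g)"
  unfolding ord_ge_def
proof (intro allI impI)
  fix M :: "nat multiset" assume M: "size M < a * b"
  have pos: "pos g" using assms(3,4) by (auto simp: ord_ge_def)
  have "coeff (p_coords f) l * coeff (mpow (psub g) l) M = 0" for l
  proof (cases "sum_mset l < a")
    case True
    thus ?thesis using p_coords_weight[OF assms(1)] assms(2) by (simp add: ord_ge_def)
  next
    case False
    have "ord_ge (b * sum_mset l) (mpow (psub g) l)"
      by (rule ord_ge_mpow) (use assms(3) ord_ge_power_subst in \<open>auto simp: no_zero_def\<close>)
    moreover have "size M < b * sum_mset l"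
      using M False by (metis linorder_not_less mult.commute mult_le_mono2 order_less_le_trans)
    ultimately show ?thesis by (simp add: ord_ge_def)
  qed
  thus "coeff (plethysm f g) M = 0"
    unfolding plethysm_eq_ev[OF assms(1)] coeff_ev'[OF admissible_psub[OF pos]] by (intro sum.neutral ballI)
qed

lemma pos_plethysm [simp]: "symmetric f \<Longrightarrow> pos f \<Longrightarrow> pos g \<Longrightarrow> pos (plethysm f g)"
  using ord_ge_plethysm[of f 1 1 g] by (simp add: ord_ge_1)

lemma pos_power_subst [simp]: "pos g \<Longrightarrow> k > 0 \<Longrightarrow> pos (power_subst k g)"
  using coeff_power_subst_repeat[of k g "{#}"] by simp

lemma power_subst_plethysm:
  assumes "symmetric f" "pos g" "k > 0"
  shows "power_subst k (plethysm f g) = ev (\<lambda>i. power_subst (k * i) g) (p_coords f)"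
proof -
  have "power_subst k (plethysm f g) = ev (\<lambda>i. power_subst k (psub g i)) (p_coords f)"
    unfolding plethysm_eq_ev[OF assms(1)]
    by (rule cont_hom_ev_comp(2)[OF cont_hom_power_subst[OF assms(3)] ring_closed_UNIV admissible_psub[OF assms(2)]]) auto
  also have "\<dots> = ev (\<lambda>i. power_subst (k * i) g) (p_coords f)"
    by (rule ev_zero_free) (auto simp: p_coords[OF assms(1)] power_subst_power_subst assms(3))
  finally show ?thesis .
qed

text \<open>On both sides every p_i in \<open>f\<close> becomes p_(k i)[g]. This is the case of an
  outer power sum in \<open>plethysm_assoc\<close>.\<close>

lemma plethysm_power_subst:
  assumes "symmetric f" "pos g" "k > 0"
  shows "plethysm (power_subst k f) g = power_subst k (plethysm f g)"
proof -
  let ?c = "p_coords f"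
  have c: "zero_free ?c" "ev pp ?c = f" using p_coords[OF assms(1)] by auto
  let ?s = "no_zero (\<lambda>i. sym_p (k * i))"
  have s: "admissible ?s"
  proof (intro graded_admissible graded_no_zero)
    fix n assume "n > (0 :: nat)"
    show "ord_ge n (sym_p (k * n))"
      by (rule ord_ge_mono[OF ord_ge_sym_p]) (use assms(3) in simp)
  qed
  have "power_subst k f = ev (\<lambda>i. power_subst k (pp i)) ?c"
    using cont_hom_ev_comp(2)[OF cont_hom_power_subst[OF assms(3)] ring_closed_UNIV admissible_pp, of ?c] c(2)
    by simp
  also have "\<dots> = ev ?s ?c"
    by (rule ev_zero_free[OF c(1)]) (simp add: power_subst_sym_p assms(3))
  finally have *: "power_subst k f = ev ?s ?c" .
  have "plethysm (ev ?s ?c) g = ev (\<lambda>i. plethysm (?s i) g) ?c"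
  proof (rule cont_hom_ev_comp(2)[OF cont_hom_plethysm[OF assms(2)] ring_closed_SYM s])
    show "?s i \<in> SYM" for i by (auto simp: no_zero_def)
    show "ev ?s ?c \<in> SYM" using assms unfolding *[symmetric] by simp
  qed
  also have "\<dots> = ev (\<lambda>i. power_subst (k * i) g) ?c"
    by (rule ev_zero_free[OF c(1)]) (use assms in \<open>simp add: plethysm_sym_p\<close>)
  finally show ?thesis using * assms by (simp add: power_subst_plethysm)
qed

text \<open>Continuous homomorphisms commute with the substitution that expands \<open>f\<close> in
  power sums, which leaves only the case of an outer p_k.\<close>

lemma plethysm_assoc:
  assumes "symmetric f" "symmetric g" "pos g" "symmetric h" "pos h"
  shows "plethysm (plethysm f g) h = plethysm f (plethysm g h)"
proof -
  let ?c = "p_coords f"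
  have "plethysm (ev (psub g) ?c) h = ev (\<lambda>i. plethysm (psub g i) h) ?c"
  proof (rule cont_hom_ev_comp(2)[OF cont_hom_plethysm[OF assms(5)] ring_closed_SYM admissible_psub[OF assms(3)]])
    show "psub g i \<in> SYM" for i using assms by (simp add: symmetric_psub)
    show "ev (psub g) ?c \<in> SYM"
      using assms unfolding plethysm_eq_ev[OF assms(1), symmetric] by simp
  qed
  also have "\<dots> = ev (psub (plethysm g h)) ?c"
    by (rule ev_zero_free) (auto simp: p_coords[OF assms(1)] plethysm_power_subst assms)
  finally show ?thesis by (simp add: plethysm_eq_ev[OF assms(1)])
qed

section \<open>The complete homogeneous functions as generators\<close>

text \<open>At a monomial of degree n the right side counts the pairs (i, k) with k from 1 to the
  exponent of x_i, and there are n of them.\<close>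

lemma newton_h: "of_nat n * sym_h n = (\<Sum>k\<in>{1..n}. sym_p k * sym_h (n - k))"
proof (rule mseries_eqI)
  fix M :: "nat multiset"
  have *: "coeff (sym_p k * sym_h (n - k)) M = (if size M = n then of_nat (card {i \<in> set_mset M. k \<le> count M i}) else 0)"
    if "k \<in> {1..n}" for k
  proof -
    have k: "k > 0" "k \<le> n" using that by auto
    have "coeff (sym_p k * sym_h (n - k)) M = (\<Sum>i | k \<le> count M i. if size M = n then 1 else 0)"
      unfolding coeff_sym_p_mult[OF k(1)]
    proof (rule sum.cong)
      fix i assume "i \<in> {i. k \<le> count M i}"
      hence sub: "replicate_mset k i \<subseteq># M" by (simp add: count_le_replicate_mset_subset_eq)
      hence "size (M - replicate_mset k i) = size M - k" "k \<le> size M"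
        using size_mset_mono[OF sub] by (simp_all add: size_Diff_submset)
      thus "coeff (sym_h (n - k)) (M - replicate_mset k i) = (if size M = n then 1 else 0)"
        using k by auto
    qed simp
    also have "{i. k \<le> count M i} = {i \<in> set_mset M. k \<le> count M i}"
      using k(1) by (auto simp flip: count_greater_zero_iff)
    finally show ?thesis by simp
  qed
  have "(\<Sum>k\<in>{1..n}. card {i \<in> set_mset M. k \<le> count M i}) = size M" if "size M = n"
  proof -
    have "(\<Sum>k\<in>{1..n}. card {i \<in> set_mset M. k \<le> count M i}) = (\<Sum>i\<in>set_mset M. card {k \<in> {1..n}. k \<le> count M i})"
      by (intro sum_multicount_gen) auto
    also have "\<dots> = (\<Sum>i\<in>set_mset M. count M i)"
    proof (rule sum.cong)
      fix i
      have "count M i \<le> n" using that count_le_size by metis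
      hence "{k \<in> {1..n}. k \<le> count M i} = {1..count M i}" by auto
      thus "card {k \<in> {1..n}. k \<le> count M i} = count M i" by simp
    qed simp
    finally show ?thesis by (simp add: size_multiset_overloaded_eq)
  qed
  thus "coeff (of_nat n * sym_h n) M = coeff (\<Sum>k\<in>{1..n}. sym_p k * sym_h (n - k)) M"
    using * by (auto simp flip: of_nat_sum)
qed

definition weighted :: "nat \<Rightarrow> mseries \<Rightarrow> bool" where
  "weighted n f \<longleftrightarrow> (\<forall>M. coeff f M \<noteq> 0 \<longrightarrow> sum_mset M = n)"

lemma weighted_mult: "weighted m f \<Longrightarrow> weighted n g \<Longrightarrow> weighted (m + n) (f * g)"
proof -
  assume f: "weighted m f" and g: "weighted n g"
  have "coeff f A * coeff g B = 0" if "sum_mset A + sum_mset B \<noteq> m + n" for A B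
    using that f g unfolding weighted_def by (metis mult_eq_0_iff)
  hence "coeff (f * g) M = 0" if "sum_mset M \<noteq> m + n" for M
    using that unfolding coeff_mult by (intro sum.neutral ballI) (clarsimp simp del: mult_eq_0_iff)
  thus ?thesis unfolding weighted_def by blast
qed

lemma weighted_vars [simp]: "weighted n (vars n)"
  by (auto simp: weighted_def vars_def split: if_splits)

text \<open>The polynomials \<open>p_of_h n\<close> contain n times a single variable, so that
  family is not \<open>graded\<close>. The weight that gives variable i the degree i takes the place
  of the ordinary degree.\<close>

lemma weighted_admissible:
  assumes "t 0 = 0" "\<And>n. n > 0 \<Longrightarrow> weighted n (t n)"
  shows "admissible t"
  unfolding admissible_def
proof
  fix M
  have w: "weighted (sum_mset l) (mpow t l)" if "0 \<notin># l" for l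
    using that by (induction l) (auto intro: weighted_mult assms(2) simp: weighted_def[of 0] split: if_splits)
  have "{l. coeff (mpow t l) M \<noteq> 0} \<subseteq> {l. 0 \<notin># l \<and> sum_mset l \<le> sum_mset M}"
  proof
    fix l assume "l \<in> {l. coeff (mpow t l) M \<noteq> 0}"
    hence nz: "coeff (mpow t l) M \<noteq> 0" by simp
    have l: "0 \<notin># l"
    proof
      assume "0 \<in># l"
      hence "mpow t l = 0" using assms(1) by (rule mpow_zero)
      thus False using nz by simp
    qed
    thus "l \<in> {l. 0 \<notin># l \<and> sum_mset l \<le> sum_mset M}" using w[OF l] nz by (auto simp: weighted_def)
  qed
  thus "finite {l. coeff (mpow t l) M \<noteq> 0}" using finite_partitions finite_subset by blast
qed

text \<open>Newton's identities solved for p_n, with the variable k in the place of h_k.\<close>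

fun p_of_h :: "nat \<Rightarrow> mseries" where
  "p_of_h n = of_nat n * vars n - (\<Sum>k\<in>{1..<n}. p_of_h k * vars (n - k))"

declare p_of_h.simps [simp del]

lemma p_of_h_0 [simp]: "p_of_h 0 = 0"
  by (subst p_of_h.simps) simp

lemma weighted_p_of_h: "weighted n (p_of_h n)"
proof (induction n rule: less_induct)
  case (less n)
  have "weighted n (p_of_h k * vars (n - k))" if "k \<in> {1..<n}" for k
    using weighted_mult[OF less[of k] weighted_vars[of "n - k"]] that by simp
  hence "coeff (\<Sum>k\<in>{1..<n}. p_of_h k * vars (n - k)) M = 0" if "sum_mset M \<noteq> n" for M
    using that unfolding coeff_sum weighted_def by (intro sum.neutral) blast
  moreover have "coeff (vars n) M = 0" if "sum_mset M \<noteq> n" for M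
    using weighted_vars[of n] that unfolding weighted_def by blast
  ultimately have "coeff (p_of_h n) M = 0" if "sum_mset M \<noteq> n" for M
    using that unfolding p_of_h.simps[of n] by simp
  thus ?case unfolding weighted_def by blast
qed

lemma admissible_p_of_h: "admissible p_of_h"
  by (rule weighted_admissible) (auto simp: weighted_p_of_h)

lemma of_nat_mult_cancel:
  assumes "of_nat n * f = of_nat n * g" "n > 0"
  shows "f = (g :: mseries)"
proof (rule mseries_eqI)
  fix M
  have "coeff (of_nat n * f) M = coeff (of_nat n * g) M" using assms(1) by simp
  thus "coeff f M = coeff g M" using assms(2) by simp
qed

lemma sym_h_0 [simp]: "sym_h 0 = 1" and sym_e_0 [simp]: "sym_e 0 = 1"
  by (auto intro!: mseries_eqI simp: coeff_sym_e)

text \<open>Applied to Newton's identity, the map yields the recursion that defines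
  \<open>p_of_h\<close>; the image of h_n and the variable n therefore satisfy the same
  recursion.\<close>

lemma ev_p_of_h: "ev p_of_h (p_coords (sym_h n)) = (if n = 0 then 1 else vars n)"
proof (induction n rule: less_induct)
  case (less n)
  let ?T = "\<lambda>f. ev p_of_h (p_coords f)"
  have T: "cont_hom SYM ?T"
    by (rule cont_hom_comp[OF cont_hom_p_coords cont_hom_ev[OF admissible_p_of_h]])
  show ?case
  proof (cases "n = 0")
    case True
    thus ?thesis using cont_homD(4)[OF T] by simp
  next
    case False
    have "of_nat n * ?T (sym_h n) = ?T (of_nat n * sym_h n)"
      using cont_homD(3)[OF T ring_closed_SYM, of "of_nat n" "sym_h n"] cont_homD(2)[OF T ring_closed_SYM, of "of_nat n"]
        symmetric_intros(1)[of "of_nat n"] by (simp add: const_of_nat)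
    also have "\<dots> = (\<Sum>k\<in>{1..n}. ?T (sym_p k * sym_h (n - k)))"
      unfolding newton_h by (rule cont_hom_additiveD(5)[OF T ring_closed_SYM ring_closed_SYM]) auto
    also have "\<dots> = (\<Sum>k\<in>{1..n}. p_of_h k * ?T (sym_h (n - k)))"
      by (rule sum.cong) (auto simp: cont_homD(3)[OF T ring_closed_SYM] p_coords_sym_p ev_vars[OF admissible_p_of_h])
    also have "{1..n} = insert n {1..<n}" using False by auto
    also have "(\<Sum>k\<in>insert n {1..<n}. p_of_h k * ?T (sym_h (n - k))) =
        p_of_h n + (\<Sum>k\<in>{1..<n}. p_of_h k * ?T (sym_h (n - k)))"
      using cont_homD(4)[OF T] by simp
    also have "(\<Sum>k\<in>{1..<n}. p_of_h k * ?T (sym_h (n - k))) = (\<Sum>k\<in>{1..<n}. p_of_h k * vars (n - k))"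
      by (rule sum.cong) (auto simp: less)
    also have "p_of_h n + \<dots> = of_nat n * vars n" by (simp add: p_of_h.simps[of n])
    finally show ?thesis using of_nat_mult_cancel False by auto
  qed
qed

lemma graded_h [simp]: "graded (no_zero sym_h)" and graded_e [simp]: "graded (no_zero sym_e)"
  by (auto intro: graded_no_zero)

text \<open>The series \<open>c\<close> is recovered from \<open>ev (no_zero sym_h) c\<close> by expressing the \<open>p\<^sub>k\<close> in the \<open>h\<^sub>k\<close>.\<close>

lemma ev_h_left_inverse:
  assumes "zero_free c"
  shows "ev p_of_h (p_coords (ev (no_zero sym_h) c)) = c"
proof -
  let ?h = "no_zero sym_h"
  have adm: "admissible ?h" by (simp add: graded_admissible)
  have sym: "symmetric (?h i)" for i by (auto simp: no_zero_def)
  have T: "cont_hom SYM (\<lambda>f. ev p_of_h (p_coords f))"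
    by (rule cont_hom_comp[OF cont_hom_p_coords cont_hom_ev[OF admissible_p_of_h]])
  have "ev p_of_h (p_coords (ev ?h c)) = ev (\<lambda>i. ev p_of_h (p_coords (?h i))) c"
    by (rule cont_hom_ev_comp(2)[OF T ring_closed_SYM adm]) (auto simp: sym symmetric_ev[OF adm])
  also have "\<dots> = ev vars c"
    by (rule ev_zero_free[OF assms]) (simp add: ev_p_of_h)
  finally show ?thesis by (simp add: ev_vars_self)
qed

lemma omega_eq:
  assumes "zero_free c"
  shows "omega (ev (no_zero sym_h) c) = ev (no_zero sym_e) c"
proof -
  have "omega (ev (no_zero sym_h) c) = ev sym_e c"
    unfolding omega_def
    by (rule subst_gens_eq[OF graded_h assms refl]) (metis assms ev_h_left_inverse)
  also have "\<dots> = ev (no_zero sym_e) c" by (rule ev_zero_free[OF assms]) simp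
  finally show ?thesis .
qed

section \<open>The Euler derivation and exponential series\<close>

definition euler :: "mseries \<Rightarrow> mseries" where
  "euler f = Abs_mseries (\<lambda>M. of_nat (size M) * coeff f M)"

lemma coeff_euler [simp]: "coeff (euler f) M = of_nat (size M) * coeff f M"
  by (simp add: euler_def)

lemma cont_additive_euler: "cont_additive UNIV euler"
  unfolding cont_additive_def
proof (intro conjI allI ballI)
  fix f g
  show "euler (f + g) = euler f + euler g" by (rule mseries_eqI) (simp add: distrib_left)
next
  fix M
  show "\<exists>S. finite S \<and> (\<forall>f\<in>UNIV. (\<forall>N\<in>S. coeff f N = 0) \<longrightarrow> coeff (euler f) M = 0)"
    by (rule exI[of _ "{M}"]) simp
qed

lemmas has_sum_euler = has_sum_cont_additive[OF cont_additive_euler ring_closed_UNIV UNIV_I UNIV_I]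

lemma euler_add: "euler (f + g) = euler f + euler g"
  and euler_diff: "euler (f - g) = euler f - euler g"
  by (rule mseries_eqI, simp add: algebra_simps)+

lemma euler_mult: "euler (f * g) = euler f * g + f * euler g"
proof (rule mseries_eqI)
  fix M
  have "coeff (euler f * g + f * euler g) M =
      (\<Sum>(A, B)\<in>splits M. (of_nat (size A) + of_nat (size B)) * (coeff f A * coeff g B))"
    unfolding plus_mseries.rep_eq coeff_mult sum.distrib[symmetric]
    by (rule sum.cong) (auto simp: algebra_simps)
  also have "\<dots> = (\<Sum>(A, B)\<in>splits M. of_nat (size M) * (coeff f A * coeff g B))"
    by (rule sum.cong) auto
  also have "\<dots> = coeff (euler (f * g)) M"
    by (simp add: coeff_mult sum_distrib_left case_prod_unfold)
  finally show "coeff (euler (f * g)) M = coeff (euler f * g + f * euler g) M" by simp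
qed

lemma euler_const [simp]: "euler (const a) = 0"
  by (rule mseries_eqI) simp

lemma euler_1 [simp]: "euler 1 = 0"
  using euler_const[of 1] by simp

lemma euler_const_mult: "euler (const a * f) = const a * euler f"
  by (simp add: euler_mult)

lemma euler_power_Suc: "euler (f ^ Suc n) = of_nat (Suc n) * f ^ n * euler f"
  by (induction n) (simp_all add: euler_mult algebra_simps)

lemma euler_homogeneous: "homogeneous n f \<Longrightarrow> euler f = of_nat n * f"
  unfolding homogeneous_def by (rule mseries_eqI) (metis coeff_euler coeff_of_nat_mult mult_zero_right)

lemma euler_power_subst:
  assumes "k > 0"
  shows "euler (power_subst k f) = of_nat k * power_subst k (euler f)"
proof (rule mseries_eqI)
  fix M
  show "coeff (euler (power_subst k f)) M = coeff (of_nat k * power_subst k (euler f)) M"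
  proof (cases "\<exists>N. M = repeat_mset k N")
    case True
    thus ?thesis by (auto simp: coeff_power_subst_repeat[OF assms])
  qed (simp add: coeff_power_subst_other)
qed

lemma euler_eq_zero:
  assumes "euler f = 0" "pos f"
  shows "f = 0"
proof (rule mseries_eqI)
  fix M
  have "coeff (euler f) M = 0" using assms(1) by simp
  thus "coeff f M = coeff 0 M" using assms(2) by (cases "M = {#}") auto
qed

text \<open>\<open>r\<close> has no constant term, so a coefficient of \<open>f * r\<close> involves
  only coefficients of \<open>f\<close> of smaller degree, while \<open>euler\<close> multiplies by
  the positive degree.\<close>

lemma euler_ode_zero:
  assumes f: "euler f = f * r" "pos f" and r: "pos r"
  shows "f = 0"
proof (rule mseries_eqI)
  fix M
  have "coeff f M = 0"
  proof (induction "size M" arbitrary: M rule: less_induct)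
    case less
    show ?case
    proof (cases "M = {#}")
      case False
      have "of_nat (size M) * coeff f M = coeff (f * r) M"
        unfolding f(1)[symmetric] by simp
      also have "\<dots> = 0"
        unfolding coeff_mult
      proof (intro sum.neutral ballI)
        fix x assume "x \<in> splits M"
        then obtain A B where x: "x = (A, B)" "A + B = M" by auto
        show "(case x of (A, B) \<Rightarrow> coeff f A * coeff r B) = 0"
        proof (cases "B = {#}")
          case False
          hence "size A < size M" using x(2) by (auto simp flip: nonempty_has_size)
          thus ?thesis using less x(1) by simp
        qed (use r x in auto)
      qed
      finally show ?thesis using False by simp
    qed (use f in simp)
  qed
  thus "coeff f M = coeff 0 M" by simp
qed

lemma euler_ode_unique:
  assumes "euler f = f * r" "euler g = g * r" "pos r" "coeff f {#} = coeff g {#}"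
  shows "f = g"
proof -
  have "f - g = 0"
    by (rule euler_ode_zero[of _ r]) (use assms in \<open>auto simp: euler_diff algebra_simps\<close>)
  thus ?thesis by simp
qed

section \<open>The exponential of a series without constant term\<close>

definition mexp :: "mseries \<Rightarrow> mseries" where
  "mexp u = (\<Sum>\<^sub>\<infinity>n. const (1 / fact n) * u ^ n)"

lemma ord_ge_const_mult: "ord_ge n f \<Longrightarrow> ord_ge n (const a * f)"
  by (auto simp: ord_ge_def)

lemma mexp_has_sum:
  assumes "pos u"
  shows "((\<lambda>n. const (1 / fact n) * u ^ n) has_sum mexp u) UNIV"
  unfolding mexp_def
proof (rule has_sum_ord_ge)
  show "ord_ge n (const (1 / fact n) * u ^ n)" for n
    using ord_ge_power[of 1 u n] assms by (intro ord_ge_const_mult) (simp add: ord_ge_1)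
qed

lemma has_sum_from_1:
  fixes f :: "nat \<Rightarrow> mseries"
  assumes "((\<lambda>n. f (Suc n)) has_sum s) UNIV"
  shows "(f has_sum f 0 + s) UNIV"
proof -
  have "bij_betw Suc UNIV {Suc 0..}" by (rule bij_betwI[of _ _ _ "\<lambda>n. n - 1"]) auto
  hence "(f has_sum s) {Suc 0..}" using has_sum_reindex_bij_betw[of Suc UNIV "{Suc 0..}" f s] assms by simp
  thus ?thesis using has_sum_shift[of f 0 s] by simp
qed

lemma coeff_mexp_empty:
  assumes "pos u"
  shows "coeff (mexp u) {#} = 1"
proof -
  have "coeff (mexp u) {#} = (\<Sum>n\<in>{0}. coeff (const (1 / fact n) * u ^ n) {#})"
  proof (rule has_sum_coeff(2)[OF mexp_has_sum[OF assms]])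
    fix n assume "coeff (const (1 / fact n) * u ^ n) {#} \<noteq> 0"
    thus "n \<in> {0}" using assms by (cases n) auto
  qed auto
  thus ?thesis by simp
qed

lemma euler_mexp:
  assumes "pos u"
  shows "euler (mexp u) = mexp u * euler u"
proof -
  have *: "euler (const (1 / fact (Suc n)) * u ^ Suc n) = euler u * (const (1 / fact n) * u ^ n)" for n
  proof -
    have "euler (const (1 / fact (Suc n)) * u ^ Suc n) =
        const (1 / fact (Suc n)) * const (of_nat (Suc n)) * (u ^ n * euler u)"
      unfolding euler_const_mult euler_power_Suc const_of_nat by (simp only: mult.assoc)
    also have "const (1 / fact (Suc n)) * const (of_nat (Suc n)) = const (1 / fact n)"
      by (simp add: const_mult[symmetric] field_simps del: of_nat_Suc)
    finally show ?thesis by (simp only: mult_ac)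
  qed
  have "((\<lambda>n. euler (const (1 / fact (Suc n)) * u ^ Suc n)) has_sum euler u * mexp u) UNIV"
    unfolding * by (rule has_sum_mult_left[OF mexp_has_sum[OF assms]])
  hence "((\<lambda>n. euler (const (1 / fact n) * u ^ n)) has_sum euler u * mexp u) UNIV"
    using has_sum_from_1[of "\<lambda>n. euler (const (1 / fact n) * u ^ n)"] by simp
  hence "euler (mexp u) = euler u * mexp u"
    by (rule has_sum_unique[OF has_sum_euler[OF mexp_has_sum[OF assms]]])
  thus ?thesis by (simp only: mult.commute)
qed

text \<open>Both sides solve \<open>euler y = y * (euler u + euler v)\<close> with constant term 1,
  which avoids the binomial expansion.\<close>

lemma mexp_add:
  assumes "pos u" "pos v"
  shows "mexp (u + v) = mexp u * mexp v"
  by (rule euler_ode_unique[where r = "euler u + euler v"])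
    (simp_all add: assms euler_mexp euler_mult euler_add coeff_mexp_empty algebra_simps)

lemma mexp_eq_1:
  assumes "mexp u = 1" "pos u"
  shows "u = 0"
proof (rule euler_eq_zero[OF _ assms(2)])
  have "euler (mexp u) = mexp u * euler u" by (rule euler_mexp[OF assms(2)])
  thus "euler u = 0" by (simp add: assms(1))
qed

lemma cont_hom_mexp:
  assumes T: "cont_hom D T" and D: "ring_closed D" and u: "u \<in> D" "mexp u \<in> D" "pos u"
  shows "T (mexp u) = mexp (T u)"
proof -
  have "((\<lambda>n. T (const (1 / fact n) * u ^ n)) has_sum T (mexp u)) UNIV"
    by (rule has_sum_cont_hom[OF T D D _ u(2) mexp_has_sum[OF u(3)]])
      (intro ring_closedD(1,5)[OF D] ring_closed_power[OF D] u(1))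
  also have "(\<lambda>n. T (const (1 / fact n) * u ^ n)) = (\<lambda>n. const (1 / fact n) * T u ^ n)"
    using cont_homD[OF T D] ring_closedD(1)[OF D] ring_closed_power[OF D u(1)] u(1) by auto
  finally show ?thesis unfolding mexp_def by (rule infsumI[symmetric])
qed

section \<open>The series \<open>E\<close> and \<open>H_pm\<close>\<close>

lemma E_has_sum: "(sym_e has_sum E_series) UNIV"
  unfolding E_series_def by (rule has_sum_ord_ge) simp

lemma H_pm_has_sum: "((\<lambda>r. (-1) ^ r * sym_h r) has_sum H_pm) UNIV"
  unfolding H_pm_def by (rule has_sum_ord_ge) (auto simp: ord_ge_def)

lemma coeff_E: "coeff E_series M = (if \<forall>i. count M i \<le> 1 then 1 else 0)"
proof -
  have "coeff E_series M = (\<Sum>r\<in>{size M}. coeff (sym_e r) M)"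
    by (rule has_sum_coeff(2)[OF E_has_sum]) (auto simp: coeff_sym_e split: if_splits)
  thus ?thesis by (simp add: coeff_sym_e)
qed

lemma coeff_H_pm: "coeff H_pm M = (-1) ^ size M"
proof -
  have "coeff H_pm M = (\<Sum>r\<in>{size M}. coeff ((-1) ^ r * sym_h r) M)"
    by (rule has_sum_coeff(2)[OF H_pm_has_sum]) (auto split: if_splits)
  thus ?thesis by simp
qed

lemma symmetric_E [simp]: "symmetric E_series"
  by (rule has_sum_symmetric[OF E_has_sum]) simp

lemma symmetric_H_pm [simp]: "symmetric H_pm"
  by (rule has_sum_symmetric[OF H_pm_has_sum]) simp

text \<open>A squarefree divisor of a monomial is a subset X of its variables and contributes
  (-1)^|X| up to a common sign; these cancel unless there is no variable.\<close>

lemma E_H_pm: "E_series * H_pm = 1"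
proof (rule mseries_eqI)
  fix M :: "nat multiset"
  let ?f = "\<lambda>X. (mset_set X, M - mset_set X)"
  have sub: "mset_set X \<subseteq># M" if "X \<subseteq> set_mset M" for X
  proof (rule mset_subset_eqI)
    fix i
    have "finite X" using that finite_subset by blast
    thus "count (mset_set X) i \<le> count M i" using that by (cases "i \<in> X") (auto simp: Suc_le_eq)
  qed
  have fin: "finite X" if "X \<subseteq> set_mset M" for X using that finite_subset by blast
  have "coeff (E_series * H_pm) M = (\<Sum>(A, B)\<in>?f ` Pow (set_mset M). (-1) ^ size B)"
    unfolding coeff_mult
  proof (rule sum.mono_neutral_cong_right)
    show "?f ` Pow (set_mset M) \<subseteq> splits M" using sub by (auto simp: subset_mset.add_diff_inverse)
    show "\<forall>x\<in>splits M - ?f ` Pow (set_mset M). (case x of (A, B) \<Rightarrow> coeff E_series A * coeff H_pm B) = 0"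
    proof
      fix x assume x: "x \<in> splits M - ?f ` Pow (set_mset M)"
      then obtain A B where AB: "x = (A, B)" "A + B = M" by auto
      have "\<not> (\<forall>i. count A i \<le> 1)"
      proof
        assume le: "\<forall>i. count A i \<le> 1"
        have "count A i = count (mset_set (set_mset A)) i" for i
          using le[rule_format, of i] by (cases "i \<in># A") (auto simp: le_Suc_eq count_eq_zero_iff)
        hence "A = mset_set (set_mset A)" by (rule multiset_eqI)
        hence "x = ?f (set_mset A)" "set_mset A \<in> Pow (set_mset M)" using AB by auto
        thus False using x by blast
      qed
      thus "(case x of (A, B) \<Rightarrow> coeff E_series A * coeff H_pm B) = 0" by (auto simp: AB coeff_E)
    qed
    fix x assume "x \<in> ?f ` Pow (set_mset M)"
    then obtain X where X: "X \<subseteq> set_mset M" "x = ?f X" by auto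
    have "\<forall>i. count (mset_set X) i \<le> 1" by (simp add: count_mset_set')
    thus "(case x of (A, B) \<Rightarrow> coeff E_series A * coeff H_pm B) = (case x of (A, B) \<Rightarrow> (-1) ^ size B)"
      using X by (simp add: coeff_E coeff_H_pm)
  qed simp
  also have "\<dots> = (\<Sum>X\<in>Pow (set_mset M). (-1) ^ size (M - mset_set X))"
  proof (subst sum.reindex)
    show "inj_on ?f (Pow (set_mset M))"
      by (rule inj_onI) (metis Pair_inject PowD fin finite_set_mset_mset_set)
  qed simp
  also have "\<dots> = (\<Sum>X\<in>Pow (set_mset M). (-1) ^ size M * (\<Prod>x\<in>X. -1))"
  proof (rule sum.cong, rule refl)
    fix X assume "X \<in> Pow (set_mset M)"
    hence X: "mset_set X \<subseteq># M" "finite X" using sub fin by auto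
    have "card X \<le> size M" using size_mset_mono[OF X(1)] by simp
    thus "(-1 :: complex) ^ size (M - mset_set X) = (-1) ^ size M * (\<Prod>x\<in>X. -1)"
      using X by (simp add: size_Diff_submset minus_one_power_iff)
  qed
  also have "\<dots> = (-1) ^ size M * (\<Prod>x\<in>set_mset M. - 1 + 1)"
    by (subst prod_add) (auto simp: sum_distrib_left)
  also have "\<dots> = coeff 1 M" by (auto simp: card_gt_0_iff)
  finally show "coeff (E_series * H_pm) M = coeff 1 M" .
qed

lemma has_sum_congI: "(f has_sum s) A \<Longrightarrow> (\<And>x. x \<in> A \<Longrightarrow> f x = g x) \<Longrightarrow> (g has_sum s) A"
  using has_sum_cong[of A f g s] by simp

definition log_H_pm :: mseries where
  "log_H_pm = (\<Sum>\<^sub>\<infinity>k\<in>{1..}. const ((-1) ^ k / of_nat k) * sym_p k)"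

lemma log_H_pm_has_sum: "((\<lambda>k. const ((-1) ^ k / of_nat k) * sym_p k) has_sum log_H_pm) {1..}"
  unfolding log_H_pm_def by (rule has_sum_ord_ge) (simp add: ord_ge_const_mult)

lemma symmetric_log_H_pm [simp]: "symmetric log_H_pm"
  by (rule has_sum_symmetric[OF log_H_pm_has_sum]) auto

lemma pos_has_sum:
  assumes "(f has_sum s) A" "\<And>i. i \<in> A \<Longrightarrow> pos (f i)"
  shows "pos s"
  using has_sum_coeff(2)[OF assms(1), of "{}"] assms(2) by auto

lemma pos_log_H_pm [simp]: "pos log_H_pm"
  by (rule pos_has_sum[OF log_H_pm_has_sum]) simp

lemma euler_log_H_pm_has_sum: "((\<lambda>k. const ((-1) ^ k) * sym_p k) has_sum euler log_H_pm) {1..}"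
proof -
  have "euler (const ((-1) ^ k / of_nat k) * sym_p k) = const ((-1) ^ k) * sym_p k" if "k \<in> {1..}" for k
  proof -
    have "homogeneous k (sym_p k)" by (auto simp: homogeneous_def coeff_sym_p split: if_splits)
    hence "euler (sym_p k) = const (of_nat k) * sym_p k" by (simp add: euler_homogeneous const_of_nat)
    thus ?thesis
      using that by (simp add: euler_const_mult mult.assoc[symmetric] const_mult[symmetric])
  qed
  with has_sum_euler[OF log_H_pm_has_sum] show ?thesis by (rule has_sum_congI)
qed

text \<open>Newton's identity for n, multiplied by (-1)^n, is the degree n part of
  \<open>euler H_pm = H_pm * euler log_H_pm\<close>, and the exponential satisfies the same
  equation.\<close>

lemma H_pm_eq_mexp: "H_pm = mexp log_H_pm"
proof (rule euler_ode_unique)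
  show "euler (mexp log_H_pm) = mexp log_H_pm * euler log_H_pm" by (rule euler_mexp) simp
  show "coeff H_pm {#} = coeff (mexp log_H_pm) {#}" by (simp add: coeff_mexp_empty coeff_H_pm)
  show "euler H_pm = H_pm * euler log_H_pm"
  proof (rule mseries_eqI)
    fix M :: "nat multiset"
    define n where "n = size M"
    have coeff: "coeff (H_pm * (const ((-1) ^ k) * sym_p k)) M =
        (if k \<le> n then (-1) ^ n * coeff (sym_p k * sym_h (n - k)) M else 0)" if k: "k \<in> {1..}" for k
    proof -
      have "coeff (H_pm * (const ((-1) ^ k) * sym_p k)) M = (-1) ^ k * coeff (sym_p k * H_pm) M"
        by (simp add: mult.commute[of H_pm] mult.assoc)
      also have "\<dots> = (\<Sum>i | k \<le> count M i. (-1) ^ k * (-1) ^ (n - k))"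
        using k by (simp add: coeff_sym_p_mult coeff_H_pm sum_distrib_left size_Diff_submset n_def
            count_le_replicate_mset_subset_eq)
      also have "\<dots> = (if k \<le> n then (-1) ^ n * coeff (sym_p k * sym_h (n - k)) M else 0)"
      proof (cases "k \<le> n")
        case True
        have "(-1 :: complex) ^ k * (-1) ^ (n - k) = (-1) ^ n" using True by (simp flip: power_add)
        moreover have "coeff (sym_p k * sym_h (n - k)) M = (\<Sum>i | k \<le> count M i. 1)"
          using k by (simp add: coeff_sym_p_mult size_Diff_submset n_def count_le_replicate_mset_subset_eq)
        ultimately show ?thesis using True by simp
      next
        case False
        have "count M i \<le> n" for i unfolding n_def by (rule count_le_size)
        hence "{i. k \<le> count M i} = {}" using False by (metis (mono_tags, lifting) Collect_empty_eq order_trans)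
        thus ?thesis using False by simp
      qed
      finally show ?thesis .
    qed
    have "coeff (H_pm * euler log_H_pm) M = (\<Sum>k\<in>{1..n}. coeff (H_pm * (const ((-1) ^ k) * sym_p k)) M)"
      by (rule has_sum_coeff(2)[OF has_sum_mult_left[OF euler_log_H_pm_has_sum]])
        (use coeff in \<open>auto split: if_splits\<close>)
    also have "\<dots> = (-1) ^ n * (\<Sum>k\<in>{1..n}. coeff (sym_p k * sym_h (n - k)) M)"
      unfolding sum_distrib_left by (rule sum.cong) (auto simp: coeff)
    also have "\<dots> = (-1) ^ n * coeff (of_nat n * sym_h n) M"
      unfolding newton_h by simp
    also have "\<dots> = coeff (euler H_pm) M" by (simp add: coeff_H_pm n_def)
    finally show "coeff (euler H_pm) M = coeff (H_pm * euler log_H_pm) M" by simp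
  qed
qed simp

section \<open>Plethysm into \<open>H_pm\<close>\<close>

lemma H_pm_plethysm:
  assumes "symmetric f" "pos f"
  shows "plethysm H_pm f = mexp (plethysm log_H_pm f)"
  unfolding H_pm_eq_mexp
  by (rule cont_hom_mexp[OF cont_hom_plethysm[OF assms(2)] ring_closed_SYM])
    (simp_all flip: H_pm_eq_mexp)

lemma log_H_pm_plethysm_has_sum:
  assumes "pos f"
  shows "((\<lambda>k. const ((-1) ^ k / of_nat k) * power_subst k f) has_sum plethysm log_H_pm f) {1..}"
proof -
  have "plethysm (const ((-1) ^ k / of_nat k) * sym_p k) f = const ((-1) ^ k / of_nat k) * power_subst k f"
    if "k \<in> {1..}" for k
    using that assms by (simp add: pleth_simps plethysm_sym_p)
  moreover have "((\<lambda>k. plethysm (const ((-1) ^ k / of_nat k) * sym_p k) f) has_sum plethysm log_H_pm f) {1..}"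
    by (rule has_sum_plethysm[OF assms log_H_pm_has_sum]) auto
  ultimately show ?thesis by (rule has_sum_congI[rotated])
qed

text \<open>Differentiating p_k[f] produces a factor k that cancels the denominator in
  \<open>log_H_pm\<close>, so only signs remain in front of the p_k[\<open>euler f\<close>].\<close>

lemma euler_H_pm_plethysm:
  assumes "symmetric f" "pos f" "((\<lambda>k. const ((-1) ^ k) * power_subst k (euler f)) has_sum r) {1..}"
  shows "euler (plethysm H_pm f) = plethysm H_pm f * r"
proof -
  have "euler (const ((-1) ^ k / of_nat k) * power_subst k f) = const ((-1) ^ k) * power_subst k (euler f)"
    if "k \<in> {1..}" for k
    using that
    by (simp add: euler_const_mult euler_power_subst const_of_nat[symmetric] mult.assoc[symmetric] const_mult[symmetric])
  with has_sum_euler[OF log_H_pm_plethysm_has_sum[OF assms(2)]]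
  have "((\<lambda>k. const ((-1) ^ k) * power_subst k (euler f)) has_sum euler (plethysm log_H_pm f)) {1..}"
    by (rule has_sum_congI)
  hence "r = euler (plethysm log_H_pm f)" by (rule has_sum_unique[OF assms(3)])
  thus ?thesis using assms by (simp add: H_pm_plethysm euler_mexp)
qed

lemma H_pm_plethysm_add:
  assumes "symmetric f" "pos f" "symmetric g" "pos g"
  shows "plethysm H_pm (f + g) = plethysm H_pm f * plethysm H_pm g"
proof -
  have "power_subst k (f + g) = power_subst k f + power_subst k g" if "k \<in> {1..}" for k
    using cont_hom_additiveD(1)[OF cont_hom_power_subst ring_closed_UNIV ring_closed_UNIV] that by simp
  hence *: "const ((-1) ^ k / of_nat k) * power_subst k f + const ((-1) ^ k / of_nat k) * power_subst k g =
      const ((-1) ^ k / of_nat k) * power_subst k (f + g)" if "k \<in> {1..}" for k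
    using that by (simp add: distrib_left)
  have "((\<lambda>k. const ((-1) ^ k / of_nat k) * power_subst k (f + g)) has_sum
      plethysm log_H_pm f + plethysm log_H_pm g) {1..}"
    using has_sum_add[OF log_H_pm_plethysm_has_sum[OF assms(2)] log_H_pm_plethysm_has_sum[OF assms(4)]] *
    by (rule has_sum_congI)
  moreover have "pos (f + g)" using assms by simp
  ultimately have "plethysm log_H_pm (f + g) = plethysm log_H_pm f + plethysm log_H_pm g"
    using has_sum_unique[OF log_H_pm_plethysm_has_sum] by blast
  thus ?thesis using assms by (simp add: H_pm_plethysm mexp_add)
qed

text \<open>For k > 1 the term p_k[f] reads at \<open>M\<close> only a coefficient of
  \<open>f\<close> in the smaller degree \<open>size M / k\<close>, which is 0 by induction. So the
  vanishing logarithm isolates the coefficient of \<open>f\<close> itself, the term k = 1.\<close>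

lemma H_pm_plethysm_eq_1:
  assumes "symmetric f" "pos f" "plethysm H_pm f = 1"
  shows "f = 0"
proof -
  have "plethysm log_H_pm f = 0" using assms by (intro mexp_eq_1) (simp_all add: H_pm_plethysm)
  hence sum: "((\<lambda>k. const ((-1) ^ k / of_nat k) * power_subst k f) has_sum 0) {1..}"
    using log_H_pm_plethysm_has_sum[OF assms(2)] by simp
  show ?thesis
  proof (rule mseries_eqI)
    fix M
    have "coeff f M = 0"
    proof (induction "size M" arbitrary: M rule: less_induct)
      case less
      show ?case
      proof (cases "M = {#}")
        case False
        have z: "coeff (power_subst k f) M = 0" if "k > 1" for k
        proof (cases "\<exists>N. M = repeat_mset k N")
          case True
          then obtain N where N: "M = repeat_mset k N" ..
          hence "size N < size M" using False that by (auto simp flip: nonempty_has_size)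
          thus ?thesis using less N coeff_power_subst_repeat[of k f N] that by simp
        qed (simp add: coeff_power_subst_other)
        have "coeff 0 M = (\<Sum>k\<in>{1}. coeff (const ((-1) ^ k / of_nat k) * power_subst k f) M)"
        proof (rule has_sum_coeff(2)[OF sum])
          fix k :: nat assume "k \<in> {1..}" "coeff (const ((-1) ^ k / of_nat k) * power_subst k f) M \<noteq> 0"
          thus "k \<in> {1}" using z[of k] by (cases "k > 1") auto
        qed auto
        thus ?thesis by simp
      qed (use assms in simp)
    qed
    thus "coeff f M = coeff 0 M" by simp
  qed
qed

text \<open>H[f - g] H[g] = H[f] = H[g], and H[g] is a unit with inverse E[g], so H[f - g] =
  1.\<close>

lemma H_pm_plethysm_inj:
  assumes "symmetric f" "pos f" "symmetric g" "pos g" "plethysm H_pm f = plethysm H_pm g"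
  shows "f = g"
proof -
  let ?d = "plethysm H_pm (f - g)" and ?h = "plethysm H_pm g" and ?e = "plethysm E_series g"
  have "plethysm H_pm (f - g + g) = ?d * ?h"
    by (rule H_pm_plethysm_add) (use assms(1-4) in simp_all)
  hence h: "?d * ?h = ?h" by (simp add: assms(5))
  have "?e * ?h = plethysm (E_series * H_pm) g"
    by (rule pleth_simps(7)[symmetric]) (simp_all add: assms(4))
  hence e: "?h * ?e = 1" by (simp add: E_H_pm pleth_simps(8)[OF assms(4)] mult.commute)
  have "?d = ?d * (?h * ?e)" by (simp add: e)
  also have "\<dots> = ?h * ?e" by (simp only: mult.assoc[symmetric] h)
  finally have "?d = 1" by (simp add: e)
  hence "f - g = 0" using assms by (intro H_pm_plethysm_eq_1) auto
  thus ?thesis by simp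
qed

section \<open>The equivalent identities\<close>

lemma sum_e_from_1: "infsum sym_e {1..} = E_series - 1"
proof -
  have "(sym_e has_sum infsum sym_e {Suc 0..}) {Suc 0..}" by (rule has_sum_ord_ge) simp
  from has_sum_shift[OF this] have "(sym_e has_sum (1 + infsum sym_e {Suc 0..})) UNIV" by simp
  hence "E_series = 1 + infsum sym_e {Suc 0..}" by (rule has_sum_unique[OF E_has_sum])
  thus ?thesis by (simp add: eq_diff_eq add.commute)
qed

lemma sum_h_from_1: "(\<Sum>\<^sub>\<infinity>r\<in>{1..}. (-1) ^ (r - 1) * sym_h r) = 1 - H_pm"
proof (rule infsumI, rule has_sum_homogeneous)
  fix r assume "r \<in> {1 :: nat..}"
  show "homogeneous r ((-1) ^ (r - 1) * sym_h r)" by (auto simp: homogeneous_def split: if_splits)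
next
  fix M :: "nat multiset"
  show "coeff (1 - H_pm) M = (if size M \<in> {1..} then coeff ((-1) ^ (size M - 1) * sym_h (size M)) M else 0)"
    by (cases "size M") (auto simp: coeff_H_pm)
qed

section \<open>The geometric series in p_1 and inverses\<close>

definition geo :: mseries where
  "geo = (\<Sum>\<^sub>\<infinity>n. sym_p 1 ^ n)"

lemma ord_ge_p1_power: "ord_ge n (sym_p 1 ^ n)"
  using ord_ge_power[OF ord_ge_sym_p[of 1], of n] by simp

lemma geo_has_sum: "((\<lambda>n. sym_p 1 ^ n) has_sum geo) UNIV"
  unfolding geo_def by (rule has_sum_ord_ge) (rule ord_ge_p1_power)

lemma sum_p1_powers: "((\<lambda>n. sym_p 1 ^ n) has_sum (geo - 1)) {1..}"
proof -
  have 1: "((\<lambda>n. sym_p 1 ^ n) has_sum (\<Sum>\<^sub>\<infinity>n\<in>{Suc 0..}. sym_p 1 ^ n)) {Suc 0..}"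
    by (rule has_sum_ord_ge) (rule ord_ge_p1_power)
  from has_sum_shift[OF this]
  have "((\<lambda>n. sym_p 1 ^ n) has_sum 1 + (\<Sum>\<^sub>\<infinity>n\<in>{Suc 0..}. sym_p 1 ^ n)) UNIV" by simp
  hence "geo = 1 + (\<Sum>\<^sub>\<infinity>n\<in>{Suc 0..}. sym_p 1 ^ n)" by (rule has_sum_unique[OF geo_has_sum])
  hence "(\<Sum>\<^sub>\<infinity>n\<in>{Suc 0..}. sym_p 1 ^ n) = geo - 1" by (simp only: eq_diff_eq add.commute)
  thus ?thesis using 1 by simp
qed

lemma geo_inverse: "geo * (1 - sym_p 1) = 1"
proof -
  have "((\<lambda>n. sym_p 1 ^ Suc n) has_sum sym_p 1 * geo) UNIV"
    using has_sum_mult_left[OF geo_has_sum, of "sym_p 1"] by simp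
  from has_sum_from_1[OF this] have "((\<lambda>n. sym_p 1 ^ n) has_sum 1 + sym_p 1 * geo) UNIV" by simp
  hence "geo = 1 + sym_p 1 * geo" by (rule has_sum_unique[OF geo_has_sum])
  thus ?thesis by (simp add: algebra_simps)
qed

lemma mseries_inv_eq:
  assumes "f * g = 1"
  shows "mseries_inv f = g"
  unfolding mseries_inv_def
proof (rule the_equality)
  fix g' assume g': "f * g' = 1"
  have "g' = g * f * g'" using assms by (simp add: mult.commute)
  also have "\<dots> = g" by (simp only: mult.assoc g' mult_1_right)
  finally show "g' = g" .
qed (fact assms)

lemma mseries_inv_p1: "mseries_inv (1 - sym_p 1) = geo"
  by (rule mseries_inv_eq) (simp only: mult.commute[of "1 - sym_p 1"] geo_inverse)

text \<open>Trades an equation for E[f] for an equation for its inverse H[f].\<close>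

lemma unit_inverse_iff:
  fixes a b a' b' :: mseries
  assumes "a * a' = 1" "b * b' = 1"
  shows "a = b \<longleftrightarrow> a' = b'"
proof
  assume "a = b"
  hence "a' = (b * b') * a'" "b' = (a * a') * b'" using assms by simp_all
  thus "a' = b'" using \<open>a = b\<close> by (simp only: mult_ac)
next
  assume "a' = b'"
  hence "a = (b * b') * a" "b = (a * a') * b" using assms by simp_all
  thus "a = b" using \<open>a' = b'\<close> by (simp only: mult_ac)
qed

lemma E_plethysm_inverse:
  assumes "pos f"
  shows "plethysm E_series f * plethysm H_pm f = 1"
proof -
  have "plethysm E_series f * plethysm H_pm f = plethysm (E_series * H_pm) f"
    by (rule pleth_simps(7)[symmetric]) (simp_all add: assms)
  thus ?thesis by (simp add: E_H_pm pleth_simps(8)[OF assms])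
qed

lemma plethysm_E_minus_1: "pos f \<Longrightarrow> plethysm (E_series - 1) f = plethysm E_series f - 1"
  and plethysm_1_minus_H_pm: "pos f \<Longrightarrow> plethysm (1 - H_pm) f = 1 - plethysm H_pm f"
  by (simp_all add: pleth_simps)

text \<open>This will turn out to be \<open>\<omega>(\<kappa>)\<close>.\<close>

definition hooks :: mseries where
  "hooks = 1 - (1 - sym_p 1) * E_series"

lemma symmetric_hooks [simp]: "symmetric hooks"
  unfolding hooks_def by (intro symmetric_intros) auto

lemma sym_h_1: "sym_h 1 = sym_p 1" and sym_e_1: "sym_e 1 = sym_p 1"
proof -
  have *: "size M = 1 \<longleftrightarrow> (\<exists>i. M = replicate_mset 1 i)" for M :: "nat multiset"
    by (auto simp: size_1_singleton_mset)
  show "sym_h 1 = sym_p 1" by (rule mseries_eqI) (simp only: coeff_sym_h coeff_sym_p *)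
  have "size M = 1 \<and> (\<forall>i. count M i \<le> 1) \<longleftrightarrow> size M = 1" for M :: "nat multiset"
    by (auto intro: count_le_size[of M, THEN order_trans])
  thus "sym_e 1 = sym_p 1" by (intro mseries_eqI) (simp only: coeff_sym_e coeff_sym_p *)
qed

text \<open>Multiplying out (1 - p_1) E leaves e_n - e_(n-1) p_1 in each positive degree n.\<close>

lemma coeff_hooks:
  "coeff hooks M = (if size M \<ge> 2 then coeff (sym_e (size M - 1) * sym_e 1 - sym_e (size M)) M else 0)"
proof (cases "M = {#}")
  case True
  thus ?thesis by (simp add: hooks_def coeff_E coeff_sym_p)
next
  case False
  define n where "n = size M"
  have n: "n > 0" using False by (simp add: n_def nonempty_has_size)
  have "coeff (sym_p 1 * E_series) M = coeff (sym_p 1 * sym_e (n - 1)) M"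
    by (simp add: coeff_sym_p_mult coeff_E coeff_sym_e n_def size_Diff_singleton)
  also have "\<dots> = coeff (sym_e (n - 1) * sym_e 1) M" by (simp only: sym_e_1 mult.commute)
  finally have "coeff hooks M = coeff (sym_e (n - 1) * sym_e 1 - sym_e n) M"
    using False by (simp add: hooks_def left_diff_distrib coeff_E coeff_sym_e n_def)
  \<comment> \<open>In degree 1 the two terms cancel, which is why the closed form starts at degree
    2.\<close>
  moreover have "sym_e (n - 1) * sym_e 1 - sym_e n = 0" if "n = 1" using that by simp
  ultimately show ?thesis using n by (cases "n = 1") (auto simp: n_def)
qed

lemma ord_ge_hooks: "ord_ge 2 hooks"
  by (simp add: ord_ge_def coeff_hooks)

lemma pos_if_ord_ge_2: "ord_ge 2 f \<Longrightarrow> pos f"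
  by (simp add: ord_ge_def)

text \<open>The second equation says E[f] = 1 / (1 - p_1) once 1 is added to both sides; inverting
  gives the condition on H[f].\<close>

lemma identity_1:
  assumes "pos f"
  shows "plethysm (E_series - 1) f = plethysm (\<Sum>\<^sub>\<infinity>r\<in>{1..}. sym_e r) f \<and>
      plethysm (\<Sum>\<^sub>\<infinity>r\<in>{1..}. sym_e r) f = (\<Sum>\<^sub>\<infinity>n\<in>{1..}. sym_p 1 ^ n) \<longleftrightarrow>
    plethysm H_pm f = 1 - sym_p 1"
proof -
  have "plethysm E_series f - 1 = geo - 1 \<longleftrightarrow> plethysm E_series f = geo" by simp
  also have "\<dots> \<longleftrightarrow> plethysm H_pm f = 1 - sym_p 1"
    by (rule unit_inverse_iff[OF E_plethysm_inverse[OF assms] geo_inverse])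
  finally show ?thesis
    unfolding sum_e_from_1 infsumI[OF sum_p1_powers] using plethysm_E_minus_1[OF assms] by simp
qed

text \<open>The target \<open>g\<close> is a parameter: it is p_1 in (2) and the value of
  \<open>omega kappa\<close> in (3).\<close>

lemma identity_2:
  assumes "pos f"
  shows "plethysm (1 - H_pm) f = plethysm (\<Sum>\<^sub>\<infinity>r\<in>{1..}. (-1) ^ (r - 1) * sym_h r) f \<and>
      plethysm (\<Sum>\<^sub>\<infinity>r\<in>{1..}. (-1) ^ (r - 1) * sym_h r) f = g \<longleftrightarrow>
    plethysm H_pm f = 1 - g"
proof -
  have "1 - x = g \<longleftrightarrow> x = 1 - g" for x by auto
  thus ?thesis unfolding sum_h_from_1 plethysm_1_minus_H_pm[OF assms] by simp
qed

lemma H_pm_plethysm_p1_add: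
  assumes "symmetric f" "pos f"
  shows "plethysm H_pm (sym_p 1 + f) = H_pm * plethysm H_pm f"
  using H_pm_plethysm_add[of "sym_p 1" f] assms by simp

text \<open>The summand p_1 contributes the factor H, and multiplying by E removes it. This links
  (2) for the full sum with (3) for the sum from degree 2 on.\<close>

lemma H_pm_hooks_iff:
  assumes "symmetric f" "pos f"
  shows "plethysm H_pm (sym_p 1 + f) = 1 - sym_p 1 \<longleftrightarrow> plethysm H_pm f = 1 - hooks"
proof -
  have "H_pm * plethysm H_pm f = 1 - sym_p 1 \<longleftrightarrow> plethysm H_pm f = (1 - sym_p 1) * E_series"
  proof
    assume *: "H_pm * plethysm H_pm f = 1 - sym_p 1"
    have "plethysm H_pm f = E_series * H_pm * plethysm H_pm f" by (simp add: E_H_pm)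
    also have "\<dots> = E_series * (1 - sym_p 1)" by (simp only: mult.assoc *)
    finally show "plethysm H_pm f = (1 - sym_p 1) * E_series" by (simp only: mult.commute)
  next
    assume "plethysm H_pm f = (1 - sym_p 1) * E_series"
    hence "H_pm * plethysm H_pm f = (1 - sym_p 1) * (E_series * H_pm)" by (simp only: mult_ac)
    thus "H_pm * plethysm H_pm f = 1 - sym_p 1" by (simp add: E_H_pm)
  qed
  thus ?thesis unfolding H_pm_plethysm_p1_add[OF assms] by (simp add: hooks_def)
qed

lemma homogeneous_mult:
  assumes "homogeneous m f" "homogeneous n g"
  shows "homogeneous (m + n) (f * g)"
  unfolding homogeneous_def
proof (intro allI impI, rule ccontr)
  fix M assume nz: "coeff (f * g) M \<noteq> 0" and M: "size M \<noteq> m + n"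
  have "coeff f A * coeff g B = 0" if "A + B = M" for A B
  proof (rule ccontr)
    assume "coeff f A * coeff g B \<noteq> 0"
    hence "size A = m" "size B = n" using assms by (auto simp: homogeneous_def)
    thus False using M that by auto
  qed
  hence "coeff (f * g) M = 0" unfolding coeff_mult
    by (intro sum.neutral ballI) (clarsimp simp del: mult_eq_0_iff)
  thus False using nz by simp
qed

lemma homogeneous_power: "homogeneous m f \<Longrightarrow> homogeneous (n * m) (f ^ n)"
  by (induction n) (auto intro: homogeneous_mult simp: homogeneous_def[of 0] split: if_splits)

lemma homogeneous_sym_p: "homogeneous n (sym_p n)"
  by (auto simp: homogeneous_def coeff_sym_p split: if_splits)

text \<open>On the right \<open>n\<close> occurs only through the degree of \<open>M\<close>, and
  \<open>k\<close> only through \<open>size B\<close>. So the sum over k in \<open>geo_H_pm\<close>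
  collapses to one sum over all splittings.\<close>

lemma homogeneous_p1_h:
  assumes "k \<le> n"
  shows "coeff (sym_p 1 ^ (n - k) * sym_h k) M =
    (if size M = n then \<Sum>(A, B)\<in>splits M. if size B = k then coeff (sym_p 1 ^ size A) A else 0 else 0)"
proof -
  have hom: "homogeneous m (sym_p 1 ^ m)" for m
    using homogeneous_power[OF homogeneous_sym_p[of 1], of m] by simp
  show ?thesis
  proof (cases "size M = n")
    case True
    have "coeff (sym_p 1 ^ (n - k)) A * coeff (sym_h k) B = (if size B = k then coeff (sym_p 1 ^ size A) A else 0)"
      if "A + B = M" for A B
      using that True by auto
    hence "(\<Sum>(A, B)\<in>splits M. coeff (sym_p 1 ^ (n - k)) A * coeff (sym_h k) B) =
        (\<Sum>(A, B)\<in>splits M. if size B = k then coeff (sym_p 1 ^ size A) A else 0)"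
      by (intro sum.cong) auto
    thus ?thesis unfolding coeff_mult using True by simp
  next
    case False
    have "coeff (sym_p 1 ^ (n - k)) A * coeff (sym_h k) B = 0" if AB: "A + B = M" for A B
    proof (cases "size B = k")
      case True
      hence "size A \<noteq> n - k" using AB False assms by auto
      hence "coeff (sym_p 1 ^ (n - k)) A = 0" using hom[of "n - k"] unfolding homogeneous_def by blast
      thus ?thesis by simp
    qed simp
    hence "(\<Sum>(A, B)\<in>splits M. coeff (sym_p 1 ^ (n - k)) A * coeff (sym_h k) B) = 0"
      by (intro sum.neutral ballI) (clarsimp simp del: mult_eq_0_iff coeff_sym_h)
    thus ?thesis unfolding coeff_mult using False by simp
  qed
qed

lemma coeff_geo: "coeff geo M = coeff (sym_p 1 ^ size M) M"
proof -
  have "coeff geo M = (\<Sum>n\<in>{size M}. coeff (sym_p 1 ^ n) M)"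
  proof (rule has_sum_coeff(2)[OF geo_has_sum])
    fix n assume "coeff (sym_p 1 ^ n) M \<noteq> 0"
    thus "n \<in> {size M}" using homogeneous_p1_h[of 0 n M] by (auto split: if_splits)
  qed auto
  thus ?thesis by simp
qed

lemma geo_H_pm: "(\<Sum>\<^sub>\<infinity>n\<in>{2..}. \<Sum>k=0..n. (-1) ^ k * sym_p 1 ^ (n - k) * sym_h k) = geo * H_pm - 1"
proof (rule infsumI, rule has_sum_homogeneous)
  have coeff: "coeff (\<Sum>k=0..n. (-1) ^ k * sym_p 1 ^ (n - k) * sym_h k) M =
      (if size M = n then coeff (geo * H_pm) M else 0)" for n M
  proof -
    have "coeff (\<Sum>k=0..n. (-1) ^ k * sym_p 1 ^ (n - k) * sym_h k) M =
        (\<Sum>k=0..n. (-1) ^ k * coeff (sym_p 1 ^ (n - k) * sym_h k) M)"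
      by (simp add: mult.assoc)
    also have "\<dots> = (if size M = n then \<Sum>k=0..n. \<Sum>(A, B)\<in>splits M.
        (if size B = k then (-1) ^ k * coeff (sym_p 1 ^ size A) A else 0) else 0)"
    proof (cases "size M = n")
      case True
      have "(-1) ^ k * coeff (sym_p 1 ^ (n - k) * sym_h k) M = (\<Sum>(A, B)\<in>splits M.
          (if size B = k then (-1) ^ k * coeff (sym_p 1 ^ size A) A else 0))" if "k \<in> {0..n}" for k
        using that True by (subst homogeneous_p1_h) (auto simp: sum_distrib_left intro!: sum.cong)
      thus ?thesis using True by simp
    next
      case False
      thus ?thesis by (simp add: homogeneous_p1_h[simplified])
    qed
    also have "\<dots> = (if size M = n then \<Sum>(A, B)\<in>splits M. \<Sum>k=0..n.
        (if size B = k then (-1) ^ k * coeff (sym_p 1 ^ size A) A else 0) else 0)"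
      unfolding case_prod_unfold by (subst sum.swap) simp
    also have "\<dots> = (if size M = n then \<Sum>(A, B)\<in>splits M. coeff (sym_p 1 ^ size A) A * (-1) ^ size B else 0)"
      by (auto simp: case_prod_unfold intro!: sum.cong)
    also have "\<dots> = (if size M = n then coeff (geo * H_pm) M else 0)"
      by (simp add: coeff_mult coeff_geo coeff_H_pm)
    finally show ?thesis .
  qed
  show "homogeneous n (\<Sum>k=0..n. (-1) ^ k * sym_p 1 ^ (n - k) * sym_h k)" for n
    unfolding homogeneous_def coeff by simp
  fix M :: "nat multiset"
  \<comment> \<open>The parts of \<open>geo * H_pm\<close> in degrees 0 and 1 are 1 and p_1 - h_1 =
    0. This accounts for the subtracted 1 and for the sum starting at 2.\<close>
  have "coeff (geo * H_pm - 1) M = 0" if "size M = 0"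
    using coeff[of 0 M] that by simp
  moreover have "coeff (geo * H_pm - 1) M = 0" if "size M = 1"
  proof -
    have "M \<noteq> {#}" using that by auto
    moreover have "{0..1 :: nat} = {0, 1}" by auto
    ultimately show ?thesis using coeff[of 1 M] that by (simp add: sym_h_1[simplified])
  qed
  moreover have "coeff (geo * H_pm - 1) M = coeff (geo * H_pm) M" if "size M \<ge> 2"
    using that by auto
  ultimately show "coeff (geo * H_pm - 1) M = (if size M \<in> {2..} then
      coeff (\<Sum>k=0..size M. (-1) ^ k * sym_p 1 ^ (size M - k) * sym_h k) M else 0)"
    unfolding coeff by (cases "size M \<ge> 2") (auto simp: not_le less_2_cases_iff)
qed

text \<open>\<open>geo * H_pm\<close> is the inverse of (1 - p_1) E = 1 - \<open>hooks\<close>, so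
  here too both sides are inverted.\<close>

lemma identity_6:
  assumes "symmetric f" "pos f"
  shows "plethysm (E_series - 1) f = (\<Sum>\<^sub>\<infinity>r\<in>{1..}. plethysm (sym_e r) f) \<and>
      (\<Sum>\<^sub>\<infinity>r\<in>{1..}. plethysm (sym_e r) f) = mseries_inv (1 - sym_p 1) * H_pm - 1 \<and>
      mseries_inv (1 - sym_p 1) * H_pm - 1 =
        (\<Sum>\<^sub>\<infinity>n\<in>{2..}. \<Sum>k=0..n. (-1) ^ k * sym_p 1 ^ (n - k) * sym_h k) \<longleftrightarrow>
    plethysm H_pm f = 1 - hooks"
proof -
  have "(sym_e has_sum E_series - 1) {1..}"
    unfolding sum_e_from_1[symmetric] by (rule has_sum_ord_ge) simp
  from has_sum_plethysm[OF assms(2) this]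
  have sum: "(\<Sum>\<^sub>\<infinity>r\<in>{1..}. plethysm (sym_e r) f) = plethysm (E_series - 1) f"
    by (intro infsumI) simp
  have "geo * H_pm * ((1 - sym_p 1) * E_series) = (geo * (1 - sym_p 1)) * (E_series * H_pm)"
    by (simp only: mult_ac)
  hence inv: "geo * H_pm * ((1 - sym_p 1) * E_series) = 1" by (simp add: geo_inverse[simplified] E_H_pm)
  have "plethysm E_series f - 1 = geo * H_pm - 1 \<longleftrightarrow> plethysm E_series f = geo * H_pm" by simp
  also have "\<dots> \<longleftrightarrow> plethysm H_pm f = (1 - sym_p 1) * E_series"
    by (rule unit_inverse_iff[OF E_plethysm_inverse[OF assms(2)] inv])
  finally show ?thesis
    unfolding sum geo_H_pm mseries_inv_p1 plethysm_E_minus_1[OF assms(2)] by (simp add: hooks_def)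
qed

text \<open>The sign (-1)^r in front of h_(n-r) is (-1)^n times the sign of h_(n-r) in H, and h_m[f]
  has order at least m. So the truncated sum agrees in degree n with (-1)^n H[f].\<close>

lemma identity_3_degreewise:
  assumes "symmetric f" "ord_ge 2 f"
  shows "(\<forall>n\<ge>2. deg_part n (\<Sum>r\<le>n. (-1) ^ r * plethysm (sym_h (n - r)) f) =
      (-1) ^ (n - 1) * (sym_e (n - 1) * sym_e 1 - sym_e n)) \<longleftrightarrow>
    plethysm H_pm f = 1 - hooks"
proof -
  let ?k = "\<lambda>n. sym_e (n - 1) * sym_e 1 - sym_e n"
  let ?s = "\<lambda>n. \<Sum>r\<le>n. (-1) ^ r * plethysm (sym_h (n - r)) f"
  let ?P = "\<lambda>M. (-1) ^ size M * coeff (plethysm H_pm f) M = (-1) ^ (size M - 1) * coeff (?k (size M)) M"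
  note pos = pos_if_ord_ge_2[OF assms(2)]
  have coeff_deg: "coeff (?s n) M = (-1) ^ n * coeff (plethysm H_pm f) M"
    if M: "size M = n" for n M
  proof -
    have ord: "ord_ge m (plethysm (sym_h m) f)" for m
      using ord_ge_plethysm[of "sym_h m" m 1 f] pos by (simp add: ord_ge_1)
    have "((\<lambda>r. plethysm ((-1) ^ r * sym_h r) f) has_sum plethysm H_pm f) UNIV"
      by (rule has_sum_plethysm[OF pos H_pm_has_sum]) simp
    hence sum: "((\<lambda>r. (-1) ^ r * plethysm (sym_h r) f) has_sum plethysm H_pm f) UNIV"
      by (simp add: const_minus_one_power pleth_simps pos)
    have "coeff (plethysm H_pm f) M = (\<Sum>m\<le>n. coeff ((-1) ^ m * plethysm (sym_h m) f) M)"
    proof (rule has_sum_coeff(2)[OF sum])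
      fix m assume "coeff ((-1) ^ m * plethysm (sym_h m) f) M \<noteq> 0"
      thus "m \<in> {..n}" using ord[of m] M unfolding ord_ge_def by (auto simp: not_less[symmetric])
    qed auto
    hence "(-1) ^ n * coeff (plethysm H_pm f) M = (\<Sum>m\<le>n. (-1) ^ (n + m) * coeff (plethysm (sym_h m) f) M)"
      by (simp add: sum_distrib_left power_add mult.assoc)
    also have "\<dots> = (\<Sum>r\<le>n. (-1) ^ r * coeff (plethysm (sym_h (n - r)) f) M)"
    proof (rule sum.reindex_bij_witness[where i = "\<lambda>r. n - r" and j = "\<lambda>r. n - r"])
      fix m assume "m \<in> {..n}"
      hence "(-1 :: complex) ^ (n + m) = (-1) ^ (n - m)" by (auto simp: minus_one_power_iff)
      thus "(-1) ^ (n - m) * coeff (plethysm (sym_h (n - (n - m))) f) M = (-1) ^ (n + m) * coeff (plethysm (sym_h m) f) M"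
        using \<open>m \<in> {..n}\<close> by simp
    qed auto
    finally show ?thesis by simp
  qed
  \<comment> \<open>The left side says nothing about degrees 0 and 1; there 1 - H[f] and
    \<open>hooks\<close> both vanish.\<close>
  have ord: "ord_ge 2 (1 - plethysm H_pm f)"
    using ord_ge_plethysm[of "1 - H_pm" 1 2 f] assms(2) pos
    by (auto simp: plethysm_1_minus_H_pm ord_ge_1 coeff_H_pm)
  have hom: "coeff (?k n) M = 0" if "size M \<noteq> n" "n \<ge> 2" for n M
  proof -
    have "coeff (sym_e (n - 1)) A * coeff (sym_e 1) B = 0" if "A + B = M" for A B
      using that \<open>size M \<noteq> n\<close> \<open>n \<ge> 2\<close> by (auto simp: coeff_sym_e)
    hence "coeff (sym_e (n - 1) * sym_e 1) M = 0" unfolding coeff_mult by (intro sum.neutral) auto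
    thus ?thesis using that by (simp add: coeff_sym_e)
  qed
  have "(\<forall>n\<ge>2. deg_part n (?s n) = (-1) ^ (n - 1) * ?k n) \<longleftrightarrow>
      (\<forall>M. size M \<ge> 2 \<longrightarrow> ?P M)"
  proof
    assume *: "\<forall>n\<ge>2. deg_part n (?s n) = (-1) ^ (n - 1) * ?k n"
    show "\<forall>M. size M \<ge> 2 \<longrightarrow> ?P M"
    proof (intro allI impI)
      fix M :: "nat multiset" assume M: "size M \<ge> 2"
      have "coeff (deg_part (size M) (?s (size M))) M =
          coeff ((-1) ^ (size M - 1) * ?k (size M)) M" by (simp only: *[rule_format, OF M])
      thus "?P M"
        using coeff_deg[of M "size M"] by (simp del: coeff_sum minus_mseries.rep_eq)
    qed
  next
    assume *: "\<forall>M. size M \<ge> 2 \<longrightarrow> ?P M"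
    show "\<forall>n\<ge>2. deg_part n (?s n) = (-1) ^ (n - 1) * ?k n"
    proof (intro allI impI mseries_eqI)
      fix n :: nat and M :: "nat multiset" assume n: "n \<ge> 2"
      show "coeff (deg_part n (?s n)) M = coeff ((-1) ^ (n - 1) * ?k n) M"
        using coeff_deg[of M n] hom[of M n] n *[rule_format, of M]
        by (cases "size M = n") (simp_all del: coeff_sum minus_mseries.rep_eq)
    qed
  qed
  also have "\<dots> \<longleftrightarrow> (\<forall>M. size M \<ge> 2 \<longrightarrow> coeff (plethysm H_pm f) M = coeff (1 - hooks) M)"
  proof (intro all_cong1 imp_cong refl)
    fix M :: "nat multiset" assume M: "size M \<ge> 2"
    then obtain m where m: "size M = Suc m" by (cases "size M") auto
    have "M \<noteq> {#}" using M by auto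
    hence "coeff (1 - hooks) M = - coeff hooks M" by simp
    also have "coeff hooks M = coeff (?k (size M)) M" using M by (simp add: coeff_hooks)
    finally have "coeff (1 - hooks) M = - coeff (?k (size M)) M" .
    moreover have "(-1) ^ Suc m * a = (-1) ^ m * b \<longleftrightarrow> a = - b" for a b :: complex
      by (cases "even m") (auto simp: minus_equation_iff)
    ultimately show "?P M \<longleftrightarrow>
        coeff (plethysm H_pm f) M = coeff (1 - hooks) M"
      unfolding m by (simp del: power_Suc minus_mseries.rep_eq)
  qed
  also have "\<dots> \<longleftrightarrow> plethysm H_pm f = 1 - hooks"
  proof
    assume *: "\<forall>M. size M \<ge> 2 \<longrightarrow> coeff (plethysm H_pm f) M = coeff (1 - hooks) M"
    show "plethysm H_pm f = 1 - hooks"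
    proof (rule mseries_eqI)
      fix M
      show "coeff (plethysm H_pm f) M = coeff (1 - hooks) M"
        using * ord ord_ge_hooks by (cases "size M \<ge> 2") (auto simp: ord_ge_def not_le)
    qed
  qed simp
  finally show ?thesis .
qed

section \<open>Iterated plethysm\<close>

text \<open>Plethysm with a series of order at least 2 doubles any lower bound for the order of
  \<open>f\<close>, so a fixed point without constant term meets every bound.\<close>

lemma plethysm_fixed_point_zero:
  assumes "symmetric f" "pos f" "ord_ge 2 g" "plethysm f g = f"
  shows "f = 0"
proof -
  have *: "ord_ge (Suc n) f" for n
  proof (induction n)
    case (Suc n)
    have "ord_ge (Suc n * 2) f"
      using ord_ge_plethysm[OF assms(1) Suc assms(3)] assms(4) by simp
    thus ?case by (rule ord_ge_mono) simp
  qed (use assms(2) in \<open>simp add: ord_ge_1\<close>)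
  have "ord_ge n f" for n by (rule ord_ge_mono[OF *[of n]]) simp
  thus ?thesis by (rule ord_ge_all_imp_zero)
qed

text \<open>(4) reads f = g + f[g]. The sum of the iterates solves it, and the difference of two
  solutions is fixed by plethysm with \<open>g\<close>.\<close>

lemma identity_4_iff_5:
  assumes f: "symmetric f" "pos f" and g: "symmetric g" "ord_ge 2 g"
  shows "f = plethysm (sym_p 1 + f) g \<longleftrightarrow> ((\<lambda>k. ((plethysm g) ^^ k) g) has_sum f) UNIV"
proof -
  note pos = pos_if_ord_ge_2[OF g(2)]
  define G where "G k = ((plethysm g) ^^ k) g" for k
  have G_Suc: "G (Suc k) = plethysm g (G k)" and G_0: "G 0 = g" for k by (simp_all add: G_def)
  have G: "symmetric (G k) \<and> ord_ge (Suc k) (G k)" for k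
  proof (induction k)
    case 0
    show ?case using g by (auto simp: G_0 intro: ord_ge_mono)
  next
    case (Suc k)
    hence "pos (G k)" by (simp add: ord_ge_def)
    moreover have "ord_ge (2 * Suc k) (plethysm g (G k))"
      using Suc g by (intro ord_ge_plethysm) auto
    hence "ord_ge (Suc (Suc k)) (plethysm g (G k))" by (rule ord_ge_mono) simp
    ultimately show ?case using Suc g(1) by (simp add: G_Suc)
  qed
  have G_pos: "pos (G k)" for k using G[of k] by (simp add: ord_ge_def)
  \<comment> \<open>The iteration in (5) puts \<open>g\<close> on the outside, whereas the equation
    needs it on the inside; associativity makes the two agree.\<close>
  have G_right: "plethysm (G k) g = G (Suc k)" for k
  proof (induction k)
    case (Suc k)
    show ?case using plethysm_assoc[of g "G k" g] G G_pos g pos Suc by (simp add: G_Suc)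
  qed (simp add: G_0 G_Suc)
  define s where "s = infsum G UNIV"
  have s: "(G has_sum s) UNIV"
    unfolding s_def by (rule has_sum_ord_ge, rule ord_ge_mono[OF conjunct2[OF G]]) simp
  have sym_s: "symmetric s" using G by (intro has_sum_symmetric[OF s]) auto
  have pos_s: "pos s" using G_pos by (intro pos_has_sum[OF s]) auto
  have "((\<lambda>k. plethysm (G k) g) has_sum plethysm s g) UNIV"
    by (rule has_sum_plethysm[OF pos s]) (use G in auto)
  hence "(G has_sum G 0 + plethysm s g) UNIV" unfolding G_right by (rule has_sum_from_1)
  from has_sum_unique[OF s this] have s_eq: "s = g + plethysm s g" by (simp only: G_0)
  have add: "plethysm (sym_p 1 + f) g = g + plethysm f g"
    using f pos by (simp add: pleth_simps)
  have "f = g + plethysm f g \<longleftrightarrow> f = s"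
  proof
    assume *: "f = g + plethysm f g"
    have "plethysm (f - s) g = plethysm f g - plethysm s g"
      using f(1) sym_s pos by (simp add: pleth_simps)
    also have "\<dots> = (g + plethysm f g) - (g + plethysm s g)" by simp
    also have "\<dots> = f - s" by (simp only: *[symmetric] s_eq[symmetric])
    finally have "f - s = 0"
      using f sym_s pos_s g(2) by (intro plethysm_fixed_point_zero[of "f - s" g]) auto
    thus "f = s" by simp
  next
    assume "f = s"
    thus "f = g + plethysm f g" using s_eq by blast
  qed
  also have "f = s \<longleftrightarrow> (G has_sum f) UNIV"
  proof
    assume "(G has_sum f) UNIV"
    thus "f = s" by (rule has_sum_unique[OF _ s])
  qed (use s in blast)
  finally show ?thesis unfolding add G_def .
qed

lemma identity_4:
  assumes f: "symmetric f" "pos f" and H: "plethysm H_pm (sym_p 1 + f) = 1 - sym_p 1"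
  shows "f = plethysm (sym_p 1 + f) hooks"
proof -
  let ?a = "sym_p 1 + f"
  have hooks: "pos hooks" by (rule pos_if_ord_ge_2[OF ord_ge_hooks])
  have a: "symmetric ?a" "pos ?a" using f by auto
  have "plethysm H_pm (plethysm ?a hooks) = plethysm (plethysm H_pm ?a) hooks"
    by (rule plethysm_assoc[symmetric]) (use a hooks in auto)
  also have "\<dots> = 1 - hooks" unfolding H using hooks by (simp add: pleth_simps)
  also have "\<dots> = plethysm H_pm f" using H H_pm_hooks_iff[OF f] by simp
  finally show ?thesis
    by (rule H_pm_plethysm_inj[symmetric, rotated -1]) (use f a hooks in \<open>auto simp del: One_nat_def plus_mseries.rep_eq\<close>)
qed

text \<open>The inhomogeneous term \<open>hooks\<close> cancels in the difference of the two
  equations, so \<open>f - f'\<close> is fixed by plethysm with \<open>hooks\<close>.\<close>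

lemma identity_4_unique:
  assumes "symmetric f" "pos f" "symmetric f'" "pos f'"
    and "f = plethysm (sym_p 1 + f) hooks" "f' = plethysm (sym_p 1 + f') hooks"
  shows "f = f'"
proof -
  have hooks: "pos hooks" by (rule pos_if_ord_ge_2[OF ord_ge_hooks])
  have *: "plethysm (sym_p 1 + h) hooks = hooks + plethysm h hooks" if "symmetric h" for h
    using that hooks by (simp add: pleth_simps)
  have "plethysm h hooks = h - hooks" if "symmetric h" "h = plethysm (sym_p 1 + h) hooks" for h
    using that(2) unfolding *[OF that(1)] by (metis add_diff_cancel_left')
  hence "plethysm f hooks = f - hooks" "plethysm f' hooks = f' - hooks" using assms by blast+
  moreover have "plethysm (f - f') hooks = plethysm f hooks - plethysm f' hooks"
    by (rule pleth_simps(4)) (use assms hooks in auto)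
  ultimately have "plethysm (f - f') hooks = f - f'" by simp
  hence "f - f' = 0"
    using assms ord_ge_hooks by (intro plethysm_fixed_point_zero[of "f - f'" hooks]) auto
  thus ?thesis by simp
qed

section \<open>Schur functions of hooks with one extra cell\<close>

text \<open>
  A tableau whose shape is a line of cells \<open>p 0, \<dots>, p (m - 1)\<close> with one extra cell \<open>x\<close> is
  determined by its content and by the entry at \<open>x\<close> if the entries along the line are sorted.
\<close>

lemma card_line_tableaux:
  fixes p :: "nat \<Rightarrow> nat \<times> nat" and C :: "nat list \<Rightarrow> nat \<Rightarrow> bool"
  assumes inj: "inj_on p {..<m}" and x: "x \<notin> p ` {..<m}"
    and sorted: "\<And>xs a. C xs a \<Longrightarrow> sorted xs"
    and D: "D = insert x (p ` {..<m})"
  shows "card {T \<in> extensional D. C (map (\<lambda>j. T (p j)) [0..<m]) (T x) \<and> image_mset T (mset_set D) = M} =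
    card {a. a \<in># M \<and> size M = Suc m \<and> C (sorted_list_of_multiset (M - {#a#})) a}"
    (is "card ?S = card ?Y")
proof (rule bij_betw_same_card)
  let ?R = "\<lambda>a. sorted_list_of_multiset (M - {#a#})"
  let ?xs = "\<lambda>T :: nat \<times> nat \<Rightarrow> nat. map (\<lambda>j. T (p j)) [0..<m]"
  \<comment> \<open>Inverse of reading off the entry at \<open>x\<close>: it puts \<open>a\<close>
    at \<open>x\<close>, the rest of the content in weakly increasing order along the line, and
    \<open>undefined\<close> outside \<open>D\<close> because tableaux are extensional.\<close>
  define g where "g a c = (if c = x then a else if c \<in> D then ?R a ! the_inv_into {..<m} p c else undefined)" for a c
  have content: "image_mset T (mset_set D) = add_mset (T x) (mset (?xs T))" for T
  proof -
    have "mset_set (p ` {..<m}) = image_mset p (mset_set {..<m})"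
      by (rule image_mset_mset_set[symmetric, OF inj])
    also have "mset_set {..<m} = mset [0..<m]" by (simp add: atLeast0LessThan)
    finally have "mset_set (p ` {..<m}) = mset (map p [0..<m])" by simp
    hence "mset_set D = add_mset x (mset (map p [0..<m]))" using x by (simp add: D)
    thus ?thesis by (simp add: image_mset.compositionality o_def flip: mset_map)
  qed
  have g_line: "?xs (g a) = ?R a" if "length (?R a) = m" for a
  proof (rule nth_equalityI)
    fix j assume "j < length (?xs (g a))"
    hence j: "j < m" by simp
    hence "p j \<noteq> x" "p j \<in> D" "the_inv_into {..<m} p (p j) = j"
      using x inj by (auto simp: D the_inv_into_f_f)
    thus "?xs (g a) ! j = ?R a ! j" using j by (simp add: g_def)
  qed (use that in simp)
  have T_xs: "?xs T = ?R (T x)" "length (?R (T x)) = m" "T x \<in># M" "size M = Suc m" if T: "T \<in> ?S" for T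
  proof -
    have M: "M = add_mset (T x) (mset (?xs T))" using T content by simp
    hence "?R (T x) = sorted_list_of_multiset (mset (?xs T))" by simp
    also have "\<dots> = ?xs T"
      unfolding sorted_list_of_multiset_mset by (rule sorted_sort_id, rule sorted) (use T in blast)
    finally show "?xs T = ?R (T x)" by simp
    hence "length (?R (T x)) = length (?xs T)" by simp
    thus "length (?R (T x)) = m" by simp
    show "T x \<in># M" "size M = Suc m" using M by auto
  qed
  show "bij_betw (\<lambda>T. T x) ?S ?Y"
  proof (rule bij_betwI[where g = g])
    show "(\<lambda>T. T x) \<in> ?S \<rightarrow> ?Y"
    proof
      fix T assume T: "T \<in> ?S"
      have "C (?xs T) (T x)" using T by blast
      thus "T x \<in> ?Y" using T_xs[OF T] by simp
    qed
    show "g \<in> ?Y \<rightarrow> ?S"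
    proof
      fix a assume a: "a \<in> ?Y"
      have "length (?R a) = size (mset (?R a))" by (simp only: size_mset)
      hence len: "length (?R a) = m" using a by (simp add: size_Diff_singleton)
      have x: "g a x = a" by (simp add: g_def)
      have "g a \<in> extensional D" by (auto simp: extensional_def g_def D)
      moreover have "C (?xs (g a)) (g a x)" unfolding g_line[OF len] x using a by simp
      moreover have "image_mset (g a) (mset_set D) = M"
        unfolding content g_line[OF len] x using a by simp
      ultimately show "g a \<in> ?S" by simp
    qed
    show "g (T x) = T" if T: "T \<in> ?S" for T
    proof
      fix c
      show "g (T x) c = T c"
      proof (cases "c \<in> p ` {..<m}")
        case True
        then obtain j where j: "j < m" "c = p j" by auto
        have "g (T x) c = ?xs (g (T x)) ! j" using j by simp
        also have "\<dots> = ?xs T ! j" unfolding g_line[OF T_xs(2)[OF T]] T_xs(1)[OF T] ..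
        finally show ?thesis using j by simp
      next
        case False
        have T_ext: "T \<in> extensional D" using T by blast
        show ?thesis
        proof (cases "c = x")
          case c: False
          hence "c \<notin> D" using False by (simp add: D)
          hence "T c = undefined" by (rule extensional_arb[OF T_ext])
          moreover have "g (T x) c = undefined" using c \<open>c \<notin> D\<close> by (simp add: g_def)
          ultimately show ?thesis by (rule trans[OF _ sym, rotated])
        qed (simp add: g_def)
      qed
    qed
    show "g a x = a" for a by (simp add: g_def)
  qed
qed

lemma sorted_list_of_multiset_nth_0_le:
  assumes "y \<in># N"
  shows "sorted_list_of_multiset N ! 0 \<le> (y :: nat)"
proof -
  have "y \<in> set (sorted_list_of_multiset N)" using assms by simp
  then obtain i where "i < length (sorted_list_of_multiset N)" "sorted_list_of_multiset N ! i = y"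
    by (metis in_set_conv_nth)
  thus ?thesis using sorted_nth_mono[OF sorted_sorted_list_of_multiset, of 0 i N] by simp
qed

lemma sorted_list_of_multiset_nth_0_in:
  assumes "N \<noteq> {#}"
  shows "sorted_list_of_multiset N ! 0 \<in># N"
proof -
  have "sorted_list_of_multiset N \<noteq> []" using assms by (metis mset.simps(1) mset_sorted_list_of_multiset)
  hence "sorted_list_of_multiset N ! 0 \<in> set (sorted_list_of_multiset N)" by (intro nth_mem) simp
  thus ?thesis by simp
qed

lemma diagram_hook: "diagram [m, 1] = insert (1, 0) ((\<lambda>j. (0, j)) ` {..<m})"
proof -
  have "(i, j) \<in> diagram [m, 1] \<longleftrightarrow> (i = 1 \<and> j = 0) \<or> (i = 0 \<and> j < m)" for i j
    unfolding diagram_def by (cases i) auto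
  thus ?thesis by auto
qed

lemma diagram_near_column:
  assumes "m > 0"
  shows "diagram (2 # replicate (m - 1) 1) = insert (0, 1) ((\<lambda>i. (i, 0)) ` {..<m})"
proof -
  have "(i, j) \<in> diagram (2 # replicate (m - 1) 1) \<longleftrightarrow> (i = 0 \<and> j = 1) \<or> (i < m \<and> j = 0)" for i j
    using assms unfolding diagram_def by (cases i) (auto simp: less_2_cases_iff)
  thus ?thesis by auto
qed

lemma coeff_schur_hook:
  assumes "m > 0"
  shows "coeff (schur [m, 1]) M = of_nat (card {a. a \<in># M \<and> size M = Suc m \<and>
    sorted_list_of_multiset (M - {#a#}) ! 0 < a})"
proof -
  \<comment> \<open>Only the first cell of the row is adjacent to the extra cell, so the column
    condition compares the extra entry with the head of the list.\<close>
  let ?D = "diagram [m, 1]" and ?C = "\<lambda>xs a. sorted xs \<and> xs ! 0 < a"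
  have *: "(\<forall>i j. (i, Suc j) \<in> ?D \<longrightarrow> T (i, j) \<le> T (i, Suc j)) \<and>
      (\<forall>i j. (Suc i, j) \<in> ?D \<longrightarrow> T (i, j) < T (Suc i, j)) \<longleftrightarrow>
      ?C (map (\<lambda>j. T (0, j)) [0..<m]) (T (1, 0))" for T :: "nat \<times> nat \<Rightarrow> nat"
  proof -
    have "(\<forall>i j. (i, Suc j) \<in> ?D \<longrightarrow> T (i, j) \<le> T (i, Suc j)) \<longleftrightarrow> (\<forall>j. Suc j < m \<longrightarrow> T (0, j) \<le> T (0, Suc j))"
      unfolding diagram_hook by auto
    moreover have "(\<forall>i j. (Suc i, j) \<in> ?D \<longrightarrow> T (i, j) < T (Suc i, j)) \<longleftrightarrow> T (0, 0) < T (1, 0)"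
      unfolding diagram_hook by auto
    ultimately show ?thesis using assms by (simp add: sorted_iff_nth_Suc)
  qed
  have eq: "{T \<in> ssyt [m, 1]. image_mset T (mset_set ?D) = M} =
      {T \<in> extensional ?D. ?C (map (\<lambda>j. T (0, j)) [0..<m]) (T (1, 0)) \<and> image_mset T (mset_set ?D) = M}"
  proof (rule Collect_cong)
    fix T
    show "T \<in> ssyt [m, 1] \<and> image_mset T (mset_set ?D) = M \<longleftrightarrow> T \<in> extensional ?D \<and>
        ?C (map (\<lambda>j. T (0, j)) [0..<m]) (T (1, 0)) \<and> image_mset T (mset_set ?D) = M"
      using *[of T] unfolding ssyt_def by blast
  qed
  have "card {T \<in> ssyt [m, 1]. image_mset T (mset_set ?D) = M} = card {a. a \<in># M \<and> size M = Suc m \<and> ?C (sorted_list_of_multiset (M - {#a#})) a}"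
    unfolding eq
  proof (rule card_line_tableaux[of "\<lambda>j. (0, j)" m "(1, 0)" ?C ?D M])
    show "inj_on (\<lambda>j :: nat. (0 :: nat, j)) {..<m}" by (simp add: inj_on_def)
    show "?D = insert (1, 0) ((\<lambda>j. (0, j)) ` {..<m})" by (rule diagram_hook)
  qed auto
  thus ?thesis by (simp add: schur_def)
qed

lemma coeff_schur_near_column:
  assumes "m > 0"
  shows "coeff (schur (2 # replicate (m - 1) 1)) M = of_nat (card {a. a \<in># M \<and> size M = Suc m \<and>
    (\<forall>i. count (M - {#a#}) i \<le> 1) \<and> sorted_list_of_multiset (M - {#a#}) ! 0 \<le> a})"
proof -
  let ?l = "2 # replicate (m - 1) 1"
  let ?D = "diagram ?l" and ?C = "\<lambda>xs a. sorted_wrt (<) xs \<and> xs ! 0 \<le> a"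
  have *: "(\<forall>i j. (i, Suc j) \<in> ?D \<longrightarrow> T (i, j) \<le> T (i, Suc j)) \<and>
      (\<forall>i j. (Suc i, j) \<in> ?D \<longrightarrow> T (i, j) < T (Suc i, j)) \<longleftrightarrow>
      ?C (map (\<lambda>j. T (j, 0)) [0..<m]) (T (0, 1))" for T :: "nat \<times> nat \<Rightarrow> nat"
  proof -
    have "(\<forall>i j. (i, Suc j) \<in> ?D \<longrightarrow> T (i, j) \<le> T (i, Suc j)) \<longleftrightarrow> T (0, 0) \<le> T (0, 1)"
      unfolding diagram_near_column[OF assms] by auto
    moreover have "(\<forall>i j. (Suc i, j) \<in> ?D \<longrightarrow> T (i, j) < T (Suc i, j)) \<longleftrightarrow>
        (\<forall>i. Suc i < m \<longrightarrow> T (i, 0) < T (Suc i, 0))"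
      unfolding diagram_near_column[OF assms] by auto
    ultimately show ?thesis using assms by (auto simp: sorted_wrt_iff_nth_Suc_transp)
  qed
  have eq: "{T \<in> ssyt ?l. image_mset T (mset_set ?D) = M} =
      {T \<in> extensional ?D. ?C (map (\<lambda>j. T (j, 0)) [0..<m]) (T (0, 1)) \<and> image_mset T (mset_set ?D) = M}"
  proof (rule Collect_cong)
    fix T
    show "T \<in> ssyt ?l \<and> image_mset T (mset_set ?D) = M \<longleftrightarrow> T \<in> extensional ?D \<and>
        ?C (map (\<lambda>j. T (j, 0)) [0..<m]) (T (0, 1)) \<and> image_mset T (mset_set ?D) = M"
      using *[of T] unfolding ssyt_def by blast
  qed
  have card: "card {T \<in> ssyt ?l. image_mset T (mset_set ?D) = M} =
      card {a. a \<in># M \<and> size M = Suc m \<and> ?C (sorted_list_of_multiset (M - {#a#})) a}"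
    unfolding eq
  proof (rule card_line_tableaux[of "\<lambda>i. (i, 0)" m "(0, 1)" ?C ?D M])
    show "inj_on (\<lambda>i :: nat. (i, 0 :: nat)) {..<m}" by (simp add: inj_on_def)
    show "?D = insert (0, 1) ((\<lambda>i. (i, 0)) ` {..<m})" by (rule diagram_near_column[OF assms])
  qed (auto simp: strict_sorted_iff)
  have strict: "sorted_wrt (<) (sorted_list_of_multiset N) \<longleftrightarrow> (\<forall>i. count N i \<le> 1)" for N :: "nat multiset"
  proof -
    have "sorted_wrt (<) (sorted_list_of_multiset N) \<longleftrightarrow> distinct (sorted_list_of_multiset N)"
      by (simp add: strict_sorted_iff)
    also have "\<dots> \<longleftrightarrow> (\<forall>i. count N i = (if i \<in># N then 1 else 0))"
      by (simp add: distinct_count_atmost_1)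
    also have "\<dots> \<longleftrightarrow> (\<forall>i. count N i \<le> 1)"
      by (rule all_cong1) (auto simp: le_Suc_eq count_eq_zero_iff)
    finally show ?thesis .
  qed
  have "coeff (schur ?l) M = of_nat (card {T \<in> ssyt ?l. image_mset T (mset_set ?D) = M})"
    by (simp only: schur_def coeff_Abs)
  thus ?thesis unfolding card strict conj_assoc .
qed

lemma coeff_mult_p1: "coeff (f * sym_p 1) M = (\<Sum>i\<in>set_mset M. coeff f (M - {#i#}))"
  by (subst mult.commute) (simp add: coeff_sym_p_mult)

text \<open>A tableau of content \<open>M\<close> is determined by the entry below the corner, which
  can be any value of \<open>M\<close> except the smallest. The number of distinct values is the
  coefficient of h_(n-1) h_1, and the exception accounts for h_n.\<close>

lemma schur_hook:
  assumes "n \<ge> 2"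
  shows "schur [n - 1, 1] = sym_h (n - 1) * sym_h 1 - sym_h n"
proof (rule mseries_eqI)
  fix M :: "nat multiset"
  have m: "n - 1 > 0" "Suc (n - 1) = n" using assms by auto
  let ?R = "\<lambda>a. sorted_list_of_multiset (M - {#a#})"
  have rhs: "coeff (sym_h (n - 1) * sym_h 1 - sym_h n) M =
      (if size M = n then of_nat (card (set_mset M)) - 1 else 0)"
  proof -
    have "coeff (sym_h (n - 1)) (M - {#i#}) = (if size M = n then 1 else 0)" if "i \<in># M" for i
      using that m by (auto simp: size_Diff_singleton)
    hence "coeff (sym_h (n - 1) * sym_p 1) M = (if size M = n then of_nat (card (set_mset M)) else 0)"
      unfolding coeff_mult_p1 by simp
    thus ?thesis unfolding sym_h_1 by simp
  qed
  show "coeff (schur [n - 1, 1]) M = coeff (sym_h (n - 1) * sym_h 1 - sym_h n) M"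
  proof (cases "size M = n")
    case True
    hence "M \<noteq> {#}" using assms by auto
    define \<mu> where "\<mu> = Min (set_mset M)"
    have \<mu>: "\<mu> \<in># M" "\<And>a. a \<in># M \<Longrightarrow> \<mu> \<le> a" using \<open>M \<noteq> {#}\<close> by (auto simp: \<mu>_def)
    have "?R a ! 0 < a \<longleftrightarrow> a \<noteq> \<mu>" if a: "a \<in># M" for a
    proof
      assume "a \<noteq> \<mu>"
      hence "\<mu> \<in># M - {#a#}" "\<mu> < a" using \<mu>(1) \<mu>(2)[OF a] by (simp_all add: in_diff_count)
      thus "?R a ! 0 < a" using sorted_list_of_multiset_nth_0_le[of \<mu> "M - {#a#}"] by linarith
    next
      assume less: "?R a ! 0 < a"
      have "size (M - {#a#}) = n - 1" using True a by (simp add: size_Diff_singleton)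
      hence "M - {#a#} \<noteq> {#}" using m(1) by auto
      hence "?R a ! 0 \<in># M - {#a#}" by (rule sorted_list_of_multiset_nth_0_in)
      hence "?R a ! 0 \<in># M" by (rule in_diffD)
      hence "\<mu> \<le> ?R a ! 0" by (rule \<mu>(2))
      thus "a \<noteq> \<mu>" using less by linarith
    qed
    hence "{a. a \<in># M \<and> size M = n \<and> ?R a ! 0 < a} = set_mset M - {\<mu>}" using True by auto
    moreover have "card (set_mset M) > 0" using \<mu>(1) by (auto simp: card_gt_0_iff)
    ultimately show ?thesis
      unfolding rhs coeff_schur_hook[OF m(1)] m(2) using True \<mu>(1) by (simp add: of_nat_diff)
  next
    case False
    thus ?thesis unfolding rhs coeff_schur_hook[OF m(1)] m(2) by simp
  qed
qed

text \<open>The extra entry \<open>a\<close> must leave a squarefree content for the column and must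
  not be smaller than the top entry. The first condition alone is counted by e_(n-1) e_1. Under it
  the second fails only if \<open>M\<close> itself is squarefree and \<open>a\<close> is its
  minimum, which accounts for e_n.\<close>

lemma schur_near_column:
  assumes "n \<ge> 2"
  shows "schur (2 # replicate (n - 2) 1) = sym_e (n - 1) * sym_e 1 - sym_e n"
proof (rule mseries_eqI)
  fix M :: "nat multiset"
  have m: "n - 1 > 0" "Suc (n - 1) = n" "n - 1 - 1 = n - 2" using assms by auto
  let ?R = "\<lambda>a. sorted_list_of_multiset (M - {#a#})"
  let ?sf = "\<lambda>M :: nat multiset. \<forall>i. count M i \<le> 1"
  let ?Z = "{a. a \<in># M \<and> ?sf (M - {#a#})}"
  have Z: "finite ?Z" by simp
  have rhs: "coeff (sym_e (n - 1) * sym_e 1 - sym_e n) M =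
      (if size M = n then of_nat (card ?Z) - (if ?sf M then 1 else 0) else 0)"
  proof -
    have "coeff (sym_e (n - 1)) (M - {#i#}) = (if size M = n then if i \<in> ?Z then 1 else 0 else 0)" if "i \<in># M" for i
      using that m by (auto simp: size_Diff_singleton coeff_sym_e)
    hence "coeff (sym_e (n - 1) * sym_p 1) M = (if size M = n then \<Sum>i\<in>set_mset M. if i \<in> ?Z then 1 else 0 else 0)"
      unfolding coeff_mult_p1 by simp
    also have "(\<Sum>i\<in>set_mset M. if i \<in> ?Z then 1 else 0 :: complex) = of_nat (card ?Z)"
    proof -
      have "set_mset M \<inter> ?Z = ?Z" by auto
      thus ?thesis by (subst sum.inter_restrict[symmetric]) simp_all
    qed
    finally show ?thesis unfolding sym_e_1 by (simp add: coeff_sym_e)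
  qed
  show "coeff (schur (2 # replicate (n - 2) 1)) M = coeff (sym_e (n - 1) * sym_e 1 - sym_e n) M"
  proof (cases "size M = n")
    case True
    hence "M \<noteq> {#}" using assms by auto
    define \<mu> where "\<mu> = Min (set_mset M)"
    have \<mu>: "\<mu> \<in># M" "\<And>a. a \<in># M \<Longrightarrow> \<mu> \<le> a" using \<open>M \<noteq> {#}\<close> by (auto simp: \<mu>_def)
    have iff: "?R a ! 0 \<le> a \<longleftrightarrow> \<not> (a = \<mu> \<and> ?sf M)" if a: "a \<in> ?Z" for a
    proof
      assume le: "?R a ! 0 \<le> a"
      show "\<not> (a = \<mu> \<and> ?sf M)"
      proof
        assume *: "a = \<mu> \<and> ?sf M"
        have "size (M - {#a#}) = n - 1" using True a by (simp add: size_Diff_singleton)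
        hence "M - {#a#} \<noteq> {#}" using m(1) by auto
        hence R: "?R a ! 0 \<in># M - {#a#}" by (rule sorted_list_of_multiset_nth_0_in)
        hence "?R a ! 0 \<in># M" by (rule in_diffD)
        hence "\<mu> \<le> ?R a ! 0" by (rule \<mu>(2))
        hence "?R a ! 0 = a" using le * by simp
        hence "count M a > 1" using R by (auto simp: in_diff_count)
        thus False using * by (simp add: not_le[symmetric])
      qed
    next
      assume *: "\<not> (a = \<mu> \<and> ?sf M)"
      have "\<exists>y. y \<in># M - {#a#} \<and> y \<le> a"
      proof (cases "a = \<mu>")
        case True
        then obtain i where i: "count M i > 1" using * by (auto simp: not_le)
        have "i = a"
        proof (rule ccontr)
          assume "i \<noteq> a"
          hence "count (M - {#a#}) i > 1" using i by simp
          thus False using a by (auto simp: not_le[symmetric])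
        qed
        thus ?thesis using i by (intro exI[of _ a]) (simp add: in_diff_count)
      next
        case False
        thus ?thesis using \<mu> a by (intro exI[of _ \<mu>]) (auto simp: in_diff_count)
      qed
      then obtain y where "y \<in># M - {#a#}" "y \<le> a" by blast
      thus "?R a ! 0 \<le> a" using sorted_list_of_multiset_nth_0_le[of y "M - {#a#}"] by linarith
    qed
    have Y: "{a. a \<in># M \<and> size M = n \<and> ?sf (M - {#a#}) \<and> ?R a ! 0 \<le> a} = (if ?sf M then ?Z - {\<mu>} else ?Z)"
      using True iff by auto
    have sf: "\<mu> \<in> ?Z" if "?sf M"
    proof -
      have "count (M - {#\<mu>#}) i \<le> 1" for i using that[rule_format, of i] by simp
      thus ?thesis using \<mu>(1) by blast
    qed
    have card_Diff: "of_nat (card (if b then Z - {\<mu>} else Z)) = of_nat (card Z) - (if b then 1 else 0 :: complex)"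
      if "b \<Longrightarrow> \<mu> \<in> Z" "finite Z" for b Z
    proof (cases b)
      case True
      hence "card Z > 0" using that by (auto simp: card_gt_0_iff)
      thus ?thesis using True that by (simp add: of_nat_diff)
    qed simp
    have "coeff (schur (2 # replicate (n - 2) 1)) M = of_nat (card (if ?sf M then ?Z - {\<mu>} else ?Z))"
      using coeff_schur_near_column[OF m(1), of M] unfolding m(2,3) Y .
    also have "\<dots> = of_nat (card ?Z) - (if ?sf M then 1 else 0)"
      using sf Z by (rule card_Diff)
    finally show ?thesis unfolding rhs using True by (simp only: if_True refl)
  next
    case False
    thus ?thesis using coeff_schur_near_column[OF m(1), of M] unfolding rhs m(2,3) by simp
  qed
qed

text \<open>Both series have the same coordinates \<open>c\<close>, the sum of v_(n-1) v_1 - v_n for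
  n from 2 on: the variables v_i become h_i in \<open>kappa\<close> and e_i in
  \<open>hooks\<close>.\<close>

lemma omega_kappa: "omega kappa = hooks"
proof -
  define t where "t n = vars (n - 1) * vars 1 - vars n" for n
  have t_sum: "(t has_sum infsum t {2..}) {2..}"
  proof (rule has_sum_mseries_exists)
    fix M :: "nat multiset"
    have "coeff (t n) M = 0" if n: "n \<noteq> sum_mset M" "n \<ge> 2" for n
    proof -
      have "weighted (n - 1 + 1) (vars (n - 1) * vars 1)" by (intro weighted_mult weighted_vars)
      moreover have "n - 1 + 1 = n" using n(2) by simp
      ultimately have "weighted n (vars (n - 1) * vars 1)" by metis
      hence "coeff (vars (n - 1) * vars 1) M = 0" using n(1) unfolding weighted_def by metis
      moreover have "coeff (vars n) M = 0" using n(1) weighted_vars[of n] unfolding weighted_def by metis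
      ultimately show ?thesis by (simp add: t_def)
    qed
    hence "{n \<in> {2..}. coeff (t n) M \<noteq> 0} \<subseteq> {sum_mset M}" by auto
    thus "finite {n \<in> {2..}. coeff (t n) M \<noteq> 0}" by (rule finite_subset) simp
  qed
  define c where "c = infsum t {2..}"
  have zf_t: "zero_free (t n)" if "n \<ge> 2" for n
  proof -
    have "zero_free (vars i)" if "i > 0" for i using that by (auto simp: zero_free_def vars_def)
    hence "vars (n - 1) \<in> Collect zero_free" "vars 1 \<in> Collect zero_free" "vars n \<in> Collect zero_free"
      using that by auto
    hence "t n \<in> Collect zero_free"
      unfolding t_def by (intro ring_closedD(7,5)[OF ring_closed_zero_free])
    thus ?thesis by simp
  qed
  have zf: "zero_free c" unfolding zero_free_def
  proof (intro allI impI)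
    fix l :: "nat multiset" assume "0 \<in># l"
    thus "coeff c l = 0"
      using has_sum_coeff(2)[OF t_sum, of "{}" l] zf_t unfolding c_def zero_free_def by fastforce
  qed
  have ev_t: "((\<lambda>n. b (n - 1) * b 1 - b n) has_sum ev (no_zero b) c) {2..}" if "graded (no_zero b)" for b
  proof -
    note adm = graded_admissible[OF that]
    have "((\<lambda>n. ev (no_zero b) (t n)) has_sum ev (no_zero b) c) {2..}"
      unfolding c_def by (rule has_sum_cont_hom[OF cont_hom_ev[OF adm] ring_closed_UNIV ring_closed_UNIV UNIV_I UNIV_I t_sum])
    moreover have "ev (no_zero b) (t n) = b (n - 1) * b 1 - b n" if "n \<in> {2..}" for n
      using that by (simp add: t_def ev_simps adm ev_vars)
    ultimately show ?thesis by (rule has_sum_congI)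
  qed
  have "((\<lambda>n. schur [n - 1, 1]) has_sum ev (no_zero sym_h) c) {2..}"
    using ev_t[OF graded_h] by (rule has_sum_congI) (simp add: schur_hook[simplified])
  hence kappa: "kappa = ev (no_zero sym_h) c" unfolding kappa_def by (rule infsumI)
  have "omega kappa = ev (no_zero sym_e) c" unfolding kappa by (rule omega_eq[OF zf])
  moreover have "((\<lambda>n. sym_e (n - 1) * sym_e 1 - sym_e n) has_sum hooks) {2..}"
  proof (rule has_sum_homogeneous)
    fix n :: nat assume "n \<in> {2..}"
    have "coeff (sym_e (n - 1)) A * coeff (sym_e 1) B = 0" if "size (A + B) \<noteq> n" for A B
      using that \<open>n \<in> {2..}\<close> by (auto simp: coeff_sym_e)
    hence "coeff (sym_e (n - 1) * sym_e 1) M = 0" if "size M \<noteq> n" for M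
      using that unfolding coeff_mult by (intro sum.neutral ballI) auto
    thus "homogeneous n (sym_e (n - 1) * sym_e 1 - sym_e n)"
      unfolding homogeneous_def by (auto simp: coeff_sym_e)
  qed (simp add: coeff_hooks)
  ultimately show ?thesis using has_sum_unique[OF ev_t[OF graded_e]] by simp
qed

section \<open>Frobenius characteristics of induced linear characters\<close>

definition cycle_p :: "nat \<Rightarrow> (nat \<Rightarrow> nat) \<Rightarrow> mseries" where
  "cycle_p n w = (\<Prod>C \<in> orbit w ` {1..n}. sym_p (card C))"

lemma funpow_conj:
  assumes "bij t"
  shows "(t \<circ> u \<circ> inv' t) ^^ k = t \<circ> (u ^^ k) \<circ> inv' t"
proof (induction k)
  case 0
  show ?case using assms by (simp add: fun_eq_iff bij_is_surj surj_f_inv_f)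
next
  case (Suc k)
  have "inv' t (t y) = y" for y using assms by (simp add: bij_is_inj inv_f_f)
  thus ?case unfolding funpow.simps(2) Suc by (simp add: fun_eq_iff)
qed

lemma cycle_p_conj:
  assumes "t permutes {1..n}"
  shows "cycle_p n (t \<circ> u \<circ> inv' t) = cycle_p n u"
proof -
  have t: "bij t" "inj t" using assms by (auto simp: permutes_bij permutes_inj)
  have orb: "orbit (t \<circ> u \<circ> inv' t) (t x) = t ` orbit u x" for x
    unfolding orbit_altdef funpow_conj[OF t(1)] using t by (auto simp: inv_f_f)
  have "orbit (t \<circ> u \<circ> inv' t) ` {1..n} = orbit (t \<circ> u \<circ> inv' t) ` t ` {1..n}"
    using permutes_image[OF assms] by simp
  also have "\<dots> = (`) t ` (orbit u ` {1..n})" by (simp add: image_image orb)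
  finally have *: "orbit (t \<circ> u \<circ> inv' t) ` {1..n} = (`) t ` (orbit u ` {1..n})" .
  have "inj_on ((`) t) (orbit u ` {1..n})" using t(2) by (simp add: inj_on_def inj_image_eq_iff)
  thus ?thesis
    using t(2) unfolding cycle_p_def * by (simp add: prod.reindex card_image inj_on_subset)
qed

lemma const_sum: "const (sum f A) = (\<Sum>i\<in>A. const (f i))"
  by (induction A rule: infinite_finite_induct) (simp_all add: const_add)

text \<open>The product of power sums is a class function, so after conjugation by its
  representative every coset contributes the same sum over \<open>H\<close>. The number of cosets
  turns 1/n! into 1/|H|.\<close>

lemma frob_char_ind_char:
  assumes H: "subgroup H (sym_group n)"
  shows "frob_char n (ind_char (sym_group n) H \<psi>) =
    const (1 / of_nat (card H)) * (\<Sum>u\<in>H. const (\<psi> u) * cycle_p n u)"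
proof -
  let ?G = "sym_group n"
  interpret G: group ?G by (rule sym_group_is_group)
  let ?S = "carrier ?G"
  have fin: "finite ?S" by (simp add: sym_group_def finite_permutations)
  have HS: "H \<subseteq> ?S" using H by (rule subgroup.subset)
  define f where "f u = (if u \<in> H then \<psi> u else 0)" for u
  let ?s = "\<Sum>u\<in>H. const (\<psi> u) * cycle_p n u"
  have one: "(\<Sum>w\<in>?S. const (ind_rep ?G H \<psi> w X X) * cycle_p n w) = ?s" if X: "X \<in> lcosets\<^bsub>?G\<^esub> H" for X
  proof -
    define t where "t = coset_rep X"
    obtain a where "a \<in> ?S" "X = a <#\<^bsub>?G\<^esub> H" using X by (auto simp: LCOSETS_def)
    hence "a \<in> X" using H by (simp add: G.lcos_self)
    hence "t \<in> X" unfolding t_def coset_rep_def by (rule someI[of "\<lambda>t. t \<in> X"])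
    hence t: "t \<in> ?S" using subgroup.lcosets_carrier[OF H sym_group_is_group X] by blast
    hence tp: "t permutes {1..n}" by (simp add: sym_group_carrier)
    have ind: "ind_rep ?G H \<psi> w X X = f (inv' t \<circ> w \<circ> t)" for w
      using t by (simp add: ind_rep_def f_def t_def[symmetric] Let_def sym_group_mult)
    have "(\<Sum>w\<in>?S. const (ind_rep ?G H \<psi> w X X) * cycle_p n w) = (\<Sum>u\<in>?S. const (f u) * cycle_p n u)"
    proof (rule sum.reindex_bij_witness[where i = "\<lambda>u. t \<circ> u \<circ> inv' t" and j = "\<lambda>w. inv' t \<circ> w \<circ> t"])
      fix w assume w: "w \<in> ?S"
      have tt: "t (inv' t y) = y" "inv' t (t y) = y" for y
        using tp by (simp_all add: permutes_inverses)
      show eq: "t \<circ> (inv' t \<circ> w \<circ> t) \<circ> inv' t = w" by (simp add: fun_eq_iff tt)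
      show "inv' t \<circ> (t \<circ> w \<circ> inv' t) \<circ> t = w" by (simp add: fun_eq_iff tt)
      have wp: "w permutes {1..n}" using w by (simp add: sym_group_carrier)
      show "inv' t \<circ> w \<circ> t \<in> ?S" "t \<circ> w \<circ> inv' t \<in> ?S"
        unfolding sym_group_carrier using tp wp by (simp_all add: permutes_compose permutes_inv)
      show "const (f (inv' t \<circ> w \<circ> t)) * cycle_p n (inv' t \<circ> w \<circ> t) = const (ind_rep ?G H \<psi> w X X) * cycle_p n w"
        using cycle_p_conj[OF tp, of "inv' t \<circ> w \<circ> t"] unfolding ind eq by simp
    qed
    also have "\<dots> = (\<Sum>u\<in>H. const (\<psi> u) * cycle_p n u)"
      by (rule sum.mono_neutral_cong_right) (use fin HS in \<open>auto simp: f_def\<close>)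
    finally show ?thesis .
  qed
  have "(\<Sum>w\<in>?S. const (ind_char ?G H \<psi> w) * cycle_p n w) =
      (\<Sum>w\<in>?S. \<Sum>X\<in>lcosets\<^bsub>?G\<^esub> H. const (ind_rep ?G H \<psi> w X X) * cycle_p n w)"
    by (simp add: ind_char_def const_sum sum_distrib_right)
  also have "\<dots> = (\<Sum>X\<in>lcosets\<^bsub>?G\<^esub> H. \<Sum>w\<in>?S. const (ind_rep ?G H \<psi> w X X) * cycle_p n w)"
    by (rule sum.swap)
  also have "\<dots> = of_nat (card (lcosets\<^bsub>?G\<^esub> H)) * ?s" by (simp add: one)
  finally have "frob_char n (ind_char ?G H \<psi>) = const (1 / fact n) * (const (of_nat (card (lcosets\<^bsub>?G\<^esub> H))) * ?s)"
    by (simp add: frob_char_def cycle_p_def const_of_nat)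
  also have "\<dots> = const (1 / fact n * of_nat (card (lcosets\<^bsub>?G\<^esub> H))) * ?s"
    by (simp only: const_mult mult.assoc)
  also have "1 / fact n * of_nat (card (lcosets\<^bsub>?G\<^esub> H)) = (1 / of_nat (card H) :: complex)"
  proof -
    have "order ?G = fact n"
      by (simp add: order_def sym_group_def card_permutations)
    hence "card (lcosets\<^bsub>?G\<^esub> H) * card H = fact n" using G.l_lagrange[OF fin H] by simp
    hence eq: "of_nat (card (lcosets\<^bsub>?G\<^esub> H)) * of_nat (card H) = (fact n :: complex)"
      by (metis of_nat_fact of_nat_mult)
    hence "of_nat (card H) \<noteq> (0 :: complex)" by (metis fact_nonzero mult_zero_right)
    thus ?thesis using eq by (simp add: field_simps)
  qed
  finally show ?thesis .
qed

section \<open>The cyclic group generated by an \<open>n\<close>-cycle\<close>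

text \<open>Divided by their gcd, n and j become coprime, and the cofactor of j can be cancelled.
  The computation runs in the integers because i - i' may be negative.\<close>

lemma cong_mult_gcd_cancel:
  fixes n i i' j :: nat
  assumes "n > 0"
  shows "(i * j) mod n = (i' * j) mod n \<longleftrightarrow> i mod (n div gcd n j) = i' mod (n div gcd n j)"
proof -
  define g where "g = gcd n j"
  have g: "g > 0" using assms by (simp add: g_def)
  obtain d u where d: "n = d * g" and u: "j = u * g" and cop: "coprime d u"
    using gcd_coprime_exists[of n j] g unfolding g_def by auto
  have "(i * j) mod n = (i' * j) mod n \<longleftrightarrow> (int i * int j) mod int n = (int i' * int j) mod int n"
    by (metis of_nat_eq_iff of_nat_mod of_nat_mult)
  also have "\<dots> \<longleftrightarrow> int n dvd (int i - int i') * int j"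
    by (simp add: mod_eq_dvd_iff left_diff_distrib)
  also have "\<dots> \<longleftrightarrow> int d * int g dvd (int i - int i') * int u * int g" by (simp add: d u mult.assoc)
  also have "\<dots> \<longleftrightarrow> int d dvd (int i - int i') * int u" using g by simp
  also have "\<dots> \<longleftrightarrow> int d dvd int i - int i'" using cop by (simp add: coprime_dvd_mult_left_iff)
  also have "\<dots> \<longleftrightarrow> i mod d = i' mod d"
    unfolding mod_eq_dvd_iff[symmetric] by (metis of_nat_eq_iff of_nat_mod)
  also have "d = n div gcd n j" unfolding g_def[symmetric] using d g by simp
  finally show ?thesis .
qed

locale n_cycle =
  fixes n :: nat and c :: "nat \<Rightarrow> nat"
  assumes n: "n \<ge> 1" and cycle: "is_n_cycle n c"
begin

definition cs :: "nat list" where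
  "cs = (SOME cs. distinct cs \<and> set cs = {1..n} \<and> c = cycle_of_list cs)"

lemma cs: "distinct cs" "set cs = {1..n}" "c = cycle_of_list cs" "length cs = n"
proof -
  have "distinct cs \<and> set cs = {1..n} \<and> c = cycle_of_list cs"
    unfolding cs_def using cycle unfolding is_n_cycle_def by (rule someI_ex)
  thus *: "distinct cs" "set cs = {1..n}" "c = cycle_of_list cs" by auto
  show "length cs = n" using distinct_card[OF *(1)] *(2) by simp
qed

text \<open>Indexing by all naturals modulo n lets \<open>c\<close> act as the shift by 1.\<close>

definition pt :: "nat \<Rightarrow> nat" where
  "pt k = cs ! (k mod n)"

lemma funpow_pt: "(c ^^ i) (pt k) = pt (i + k)"
proof -
  have "k mod n < length cs" using n cs(4) by simp
  hence "(c ^^ i) (pt k) = map (c ^^ i) cs ! (k mod n)" by (simp add: pt_def)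
  also have "\<dots> = rotate i cs ! (k mod n)" using cyclic_rotation[OF cs(1)] cs(3) by simp
  also have "\<dots> = pt (i + k)"
    using \<open>k mod n < length cs\<close> by (simp add: nth_rotate pt_def cs(4) mod_add_right_eq)
  finally show ?thesis .
qed

lemma pt_eq_iff: "pt k = pt l \<longleftrightarrow> k mod n = l mod n"
  using n cs(1,4) by (simp add: pt_def nth_eq_iff_index_eq)

lemma range_pt: "x \<in> {1..n} \<Longrightarrow> \<exists>k. x = pt k"
  using cs(2,4) by (metis in_set_conv_nth mod_less pt_def)

lemma orbit_pt:
  "orbit (c ^^ j) (pt k) = (\<lambda>i. pt (i * j + k)) ` {..<n div gcd n j}"
proof -
  let ?d = "n div gcd n j"
  have d: "?d > 0" using n by (simp add: div_greater_zero_iff gcd_le1_nat)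
  have pow: "((c ^^ j) ^^ i) (pt k) = pt (i * j + k)" for i
    by (simp add: funpow_mult funpow_pt mult.commute)
  have red: "pt (i * j + k) = pt ((i mod ?d) * j + k)" for i
    unfolding pt_eq_iff using cong_mult_gcd_cancel[of n i j "i mod ?d"] n
    by (intro mod_add_cong) auto
  show ?thesis
  proof (intro equalityI subsetI)
    fix y assume "y \<in> orbit (c ^^ j) (pt k)"
    then obtain i where "y = pt (i * j + k)" unfolding orbit_altdef pow by auto
    hence "y = pt ((i mod ?d) * j + k)" using red[of i] by simp
    moreover have "i mod ?d \<in> {..<?d}" using d by simp
    ultimately show "y \<in> (\<lambda>i. pt (i * j + k)) ` {..<?d}" by blast
  next
    fix y assume "y \<in> (\<lambda>i. pt (i * j + k)) ` {..<?d}"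
    then obtain i where "y = pt (i * j + k)" by auto
    \<comment> \<open>\<open>orbit\<close> collects positive iterates only; adding the period covers
      i = 0.\<close>
    moreover have "pt (i * j + k) = pt ((i + ?d) * j + k)" using red[of i] red[of "i + ?d"] by simp
    moreover have "0 < i + ?d" using d by simp
    ultimately show "y \<in> orbit (c ^^ j) (pt k)" unfolding orbit_altdef pow by blast
  qed
qed

lemma card_orbit: "x \<in> {1..n} \<Longrightarrow> card (orbit (c ^^ j) x) = n div gcd n j"
proof -
  assume "x \<in> {1..n}"
  then obtain k where k: "x = pt k" using range_pt by blast
  have "inj_on (\<lambda>i. pt (i * j + k)) {..<n div gcd n j}"
  proof (rule inj_onI)
    fix i i' assume i: "i \<in> {..<n div gcd n j}" "i' \<in> {..<n div gcd n j}" "pt (i * j + k) = pt (i' * j + k)"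
    hence "(i * j + k) mod n = (i' * j + k) mod n" by (simp add: pt_eq_iff)
    hence "(int (i * j) + int k) mod int n = (int (i' * j) + int k) mod int n"
      by (metis of_nat_add of_nat_mod)
    hence "int (i * j) mod int n = int (i' * j) mod int n" by (simp add: mod_eq_dvd_iff)
    hence "(i * j) mod n = (i' * j) mod n" by (metis of_nat_eq_iff of_nat_mod)
    thus "i = i'" using cong_mult_gcd_cancel[of n i j i'] n i by simp
  qed
  thus ?thesis by (simp add: k orbit_pt card_image)
qed

lemma c_permutes: "c permutes {1..n}"
  using cycle_permutes[of cs] cs(2,3) by simp

text \<open>The orbits partition n points into classes of n / gcd n j elements each.\<close>

lemma card_orbits: "card (orbit (c ^^ j) ` {1..n}) = gcd n j"
proof -
  let ?d = "n div gcd n j" and ?O = "orbit (c ^^ j) ` {1..n}"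
  have perm: "(c ^^ j) permutes {1..n}" using c_permutes by (rule permutes_funpow)
  hence permutation: "permutation (c ^^ j)" by (auto simp: permutation_permutes)
  have self: "x \<in> orbit (c ^^ j) x" for x by (rule permutation_self_in_orbit[OF permutation])
  have sub: "orbit (c ^^ j) x \<subseteq> {1..n}" if "x \<in> {1..n}" for x
    using that perm by (rule permutes_orbit_subset[rotated])
  have union: "\<Union> ?O = {1..n}" using self sub by blast
  have disj: "A \<inter> B = {}" if AB: "A \<in> ?O" "B \<in> ?O" "A \<noteq> B" for A B
  proof (rule ccontr)
    assume "A \<inter> B \<noteq> {}"
    then obtain y x x' where "y \<in> orbit (c ^^ j) x" "y \<in> orbit (c ^^ j) x'"
      "A = orbit (c ^^ j) x" "B = orbit (c ^^ j) x'" using AB by auto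
    moreover have "orbit (c ^^ j) y = orbit (c ^^ j) z" if "y \<in> orbit (c ^^ j) z" for z
      using orbit_cyclic_eq3[OF cyclic_on_orbit'[OF permutation] that] .
    ultimately show False using AB(3) by metis
  qed
  have "?d * card ?O = card (\<Union> ?O)"
    by (rule card_partition) (use card_orbit disj union in auto)
  hence "?d * card ?O = n" using union by simp
  moreover have "?d * gcd n j = n" by simp
  moreover have "?d > 0" using n by (simp add: div_greater_zero_iff gcd_le1_nat)
  ultimately show ?thesis by (metis mult_cancel1 less_numeral_extra(3))
qed

lemma cycle_p_power: "cycle_p n (c ^^ j) = sym_p (n div gcd n j) ^ gcd n j"
proof -
  have "cycle_p n (c ^^ j) = (\<Prod>C\<in>orbit (c ^^ j) ` {1..n}. sym_p (n div gcd n j))"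
    unfolding cycle_p_def by (rule prod.cong) (auto simp: card_orbit)
  thus ?thesis using card_orbits[of j] by simp
qed

lemma funpow_c_inj: "c ^^ i = c ^^ j \<Longrightarrow> i mod n = j mod n"
  using funpow_pt[of i 0] funpow_pt[of j 0] by (simp add: pt_eq_iff)

lemma funpow_c_mod: "c ^^ i = c ^^ (i mod n)"
proof -
  have "c ^^ n = id" using cycle_is_id_root[OF cs(1)] cs(3,4) by simp
  have "c ^^ i = c ^^ (i mod n + n * (i div n))" by simp
  also have "\<dots> = c ^^ (i mod n) \<circ> (c ^^ n) ^^ (i div n)" by (simp only: funpow_add funpow_mult)
  also have "\<dots> = c ^^ (i mod n)" using \<open>c ^^ n = id\<close> by simp
  finally show ?thesis .
qed

lemma generate_c: "generate (sym_group n) {c} = (\<lambda>j. c ^^ j) ` {..<n}"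
proof -
  interpret G: group "sym_group n" by (rule sym_group_is_group)
  have sub: "subgroup (range (\<lambda>j. c ^^ j)) (sym_group n)"
  proof (rule G.subgroupI)
    show "range (\<lambda>j. c ^^ j) \<subseteq> carrier (sym_group n)"
      using permutes_funpow[OF c_permutes] by (auto simp: sym_group_carrier)
    fix w assume "w \<in> range (\<lambda>j. c ^^ j)"
    then obtain i where w: "w = c ^^ i" by auto
    \<comment> \<open>An inverse of \<open>c ^^ i\<close> with a natural exponent: n i is at least
      i, and \<open>c ^^ (n * i)\<close> is the identity.\<close>
    have "c ^^ (n * i - i) \<circ> c ^^ i = c ^^ (n * i)"
      using n by (simp add: funpow_add[symmetric])
    also have "\<dots> = id" using funpow_c_mod[of "n * i"] by simp
    finally have "inv\<^bsub>sym_group n\<^esub> w = c ^^ (n * i - i)"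
      using permutes_funpow[OF c_permutes] unfolding w
      by (intro G.inv_equality) (simp_all add: sym_group_def)
    thus "inv\<^bsub>sym_group n\<^esub> w \<in> range (\<lambda>j. c ^^ j)" by simp
    fix w' assume "w' \<in> range (\<lambda>j. c ^^ j)"
    then obtain j where "w' = c ^^ j" by auto
    hence "w \<otimes>\<^bsub>sym_group n\<^esub> w' = c ^^ (i + j)" by (simp add: w sym_group_mult funpow_add)
    thus "w \<otimes>\<^bsub>sym_group n\<^esub> w' \<in> range (\<lambda>j. c ^^ j)" by simp
  qed simp
  have "c \<in> range (\<lambda>j. c ^^ j)" by (rule range_eqI[of _ _ 1]) simp
  hence "generate (sym_group n) {c} \<subseteq> range (\<lambda>j. c ^^ j)"
    by (intro G.generate_subgroup_incl[OF _ sub]) simp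
  moreover have "c ^^ j \<in> generate (sym_group n) {c}" for j
  proof (induction j)
    case 0
    show ?case using generate.one[of "sym_group n" "{c}"] by (simp add: sym_group_one id_def)
  next
    case (Suc j)
    have "c \<in> generate (sym_group n) {c}" by (rule generate.incl) simp
    from generate.eng[OF this Suc] show ?case unfolding sym_group_mult funpow.simps(2) .
  qed
  ultimately have "generate (sym_group n) {c} = range (\<lambda>j. c ^^ j)" by blast
  also have "\<dots> = (\<lambda>j. c ^^ j) ` {..<n}"
  proof (intro equalityI subsetI)
    fix w assume "w \<in> range (\<lambda>j. c ^^ j)"
    then obtain k where "w = c ^^ (k mod n)" using funpow_c_mod by auto
    thus "w \<in> (\<lambda>j. c ^^ j) ` {..<n}" using n by auto
  qed auto
  finally show ?thesis .
qed

lemma inj_on_funpow_c: "inj_on (\<lambda>j. c ^^ j) {..<n}"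
  by (rule inj_onI) (use funpow_c_inj in fastforce)

lemma cyclic_char_power:
  assumes "j < n"
  shows "cyclic_char c z (c ^^ j) = z ^ j"
proof -
  have "(LEAST i. c ^^ i = c ^^ j) = j"
  proof (rule Least_equality)
    fix i assume "c ^^ i = c ^^ j"
    hence "i mod n = j" using funpow_c_inj[of i j] assms by simp
    thus "j \<le> i" by (metis mod_less_eq_dividend)
  qed simp
  thus ?thesis by (simp add: cyclic_char_def)
qed

lemma frob_char_cyclic:
  "frob_char n (ind_char (sym_group n) (generate (sym_group n) {c}) (cyclic_char c z)) =
    const (1 / of_nat n) * (\<Sum>j<n. const (z ^ j) * sym_p (n div gcd n j) ^ gcd n j)"
proof -
  interpret G: group "sym_group n" by (rule sym_group_is_group)
  have "subgroup (generate (sym_group n) {c}) (sym_group n)"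
    by (rule G.generate_is_subgroup) (use c_permutes in \<open>simp add: sym_group_carrier\<close>)
  hence "frob_char n (ind_char (sym_group n) (generate (sym_group n) {c}) (cyclic_char c z)) =
      const (1 / of_nat (card ((\<lambda>j. c ^^ j) ` {..<n}))) * (\<Sum>u\<in>(\<lambda>j. c ^^ j) ` {..<n}. const (cyclic_char c z u) * cycle_p n u)"
    by (simp only: frob_char_ind_char generate_c)
  also have "card ((\<lambda>j. c ^^ j) ` {..<n}) = n" by (simp add: card_image inj_on_funpow_c)
  also have "(\<Sum>u\<in>(\<lambda>j. c ^^ j) ` {..<n}. const (cyclic_char c z u) * cycle_p n u) =
      (\<Sum>j<n. const (cyclic_char c z (c ^^ j)) * cycle_p n (c ^^ j))"
    by (simp add: sum.reindex inj_on_funpow_c)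
  also have "\<dots> = (\<Sum>j<n. const (z ^ j) * sym_p (n div gcd n j) ^ gcd n j)"
    by (rule sum.cong) (simp_all add: cyclic_char_power cycle_p_power)
  finally show ?thesis .
qed

end

section \<open>Ramanujan sums\<close>

text \<open>Here u/d is the fraction j/n in lowest terms; j = 0 corresponds to d = 1 and u =
  0.\<close>

lemma sum_by_gcd:
  fixes G :: "nat \<Rightarrow> 'a :: comm_monoid_add"
  assumes "n > 0"
  shows "(\<Sum>j<n. G j) = (\<Sum>d | d dvd n. \<Sum>u | u < d \<and> coprime d u. G (n div d * u))"
proof -
  have fin: "finite {d. d dvd n}" using assms by simp
  have "(\<Sum>d | d dvd n. \<Sum>u | u < d \<and> coprime d u. G (n div d * u)) =
      (\<Sum>(d, u)\<in>Sigma {d. d dvd n} (\<lambda>d. {u. u < d \<and> coprime d u}). G (n div d * u))"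
    by (rule sum.Sigma) (use fin in auto)
  also have "\<dots> = (\<Sum>j<n. G j)"
  proof (rule sum.reindex_bij_witness[where i = "\<lambda>j. (n div gcd n j, j div gcd n j)"
        and j = "\<lambda>(d, u). n div d * u"])
    fix j assume j: "j \<in> {..<n}"
    define g where "g = gcd n j"
    have g: "g > 0" "g dvd n" "g dvd j" using assms by (auto simp: g_def)
    obtain d u where d: "n = d * g" and u: "j = u * g" and cop: "coprime d u"
      using gcd_coprime_exists[of n j] g unfolding g_def by auto
    have du: "n div g = d" "j div g = u" using d u g(1) by simp_all
    have "d > 0" using d assms by simp
    have "u < d" using j d u g(1) by simp
    show "(n div gcd n j, j div gcd n j) \<in> Sigma {d. d dvd n} (\<lambda>d. {u. u < d \<and> coprime d u})"
      unfolding g_def[symmetric] du using d cop \<open>u < d\<close> by simp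
    show "(case (n div gcd n j, j div gcd n j) of (d, u) \<Rightarrow> n div d * u) = j"
      unfolding g_def[symmetric] du using d u \<open>d > 0\<close> by (simp add: mult.commute)
  next
    fix x assume "x \<in> Sigma {d. d dvd n} (\<lambda>d. {u. u < d \<and> coprime d u})"
    then obtain d u where x: "x = (d, u)" "d dvd n" "u < d" "coprime d u" by auto
    then obtain k where k: "n = d * k" unfolding dvd_def by blast
    have pos: "d > 0" "k > 0" using k assms by auto
    have nd: "n div d = k" using k pos by simp
    have gcd: "gcd n (k * u) = k"
    proof -
      have "gcd n (k * u) = k * gcd d u" unfolding k by (simp add: gcd_mult_distrib_nat mult.commute)
      thus ?thesis using x(4) by simp
    qed
    show "(case x of (d, u) \<Rightarrow> n div d * u) \<in> {..<n}" using x nd k pos by (simp add: mult.commute)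
    show "(n div gcd n (case x of (d, u) \<Rightarrow> n div d * u),
        (case x of (d, u) \<Rightarrow> n div d * u) div gcd n (case x of (d, u) \<Rightarrow> n div d * u)) = x"
      using x(1) nd gcd k pos by simp
    show "G (case x of (d, u) \<Rightarrow> n div d * u) = (case x of (d, u) \<Rightarrow> G (n div d * u))"
      by (simp add: x(1))
  qed
  finally show ?thesis by simp
qed

lemma gcd_div_mult:
  fixes n d u :: nat
  assumes "n > 0" "d dvd n" "coprime d u"
  shows "gcd n (n div d * u) = n div d"
proof -
  obtain k where k: "n = d * k" using assms(2) unfolding dvd_def by blast
  hence "n div d = k" using assms(1) by auto
  moreover have "gcd n (k * u) = k * gcd d u" unfolding k by (simp add: gcd_mult_distrib_nat mult.commute)
  ultimately show ?thesis using assms(3) by simp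
qed

definition ramanujan_sum :: "nat \<Rightarrow> nat \<Rightarrow> complex" where
  "ramanujan_sum d q = (\<Sum>u | u < d \<and> coprime d u. exp (2 * of_real pi * \<i> * of_nat (q * u) / of_nat d))"

text \<open>The primitive d-th roots of unity for all d dividing n make up the n-th roots of unity,
  whose q-th powers form a geometric sum.\<close>

lemma sum_ramanujan_sum:
  assumes "n > 0"
  shows "(\<Sum>d | d dvd n. ramanujan_sum d q) = (if n dvd q then of_nat n else 0)"
proof -
  define w where "w = exp (2 * of_real pi * \<i> * of_nat q / of_nat n)"
  have w_pow: "w ^ j = exp (2 * of_real pi * \<i> * of_nat (q * j) / of_nat n)" for j
    unfolding w_def exp_of_nat_mult[symmetric] by (simp add: mult_ac)
  have "w ^ (n div d * u) = exp (2 * of_real pi * \<i> * of_nat (q * u) / of_nat d)" if dvd: "d dvd n" for d u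
  proof -
    obtain k where k: "n = d * k" using dvd unfolding dvd_def by blast
    have "d > 0" "k > 0" using k assms by auto
    thus ?thesis unfolding w_pow by (simp add: k field_simps)
  qed
  hence "(\<Sum>d | d dvd n. ramanujan_sum d q) = (\<Sum>j<n. w ^ j)"
    unfolding ramanujan_sum_def sum_by_gcd[OF assms] by (intro sum.cong) auto
  also have "\<dots> = (if n dvd q then of_nat n else 0)"
  proof -
    have w1: "w = 1 \<longleftrightarrow> n dvd q"
      unfolding w_def using complex_root_unity_eq_1[of n q] assms by (simp add: mult_ac)
    have "w ^ n = 1"
      unfolding w_pow using complex_root_unity_eq_1[of n "q * n"] assms by (simp add: mult_ac)
    hence "(\<Sum>j<n. w ^ j) = 0" if "w \<noteq> 1" using that by (simp add: geometric_sum)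
    thus ?thesis using w1 by (cases "w = 1") simp_all
  qed
  finally show ?thesis .
qed

text \<open>The exponent of 2 is that of \<open>d\<close> itself and not of the n of which
  \<open>d\<close> is a divisor, so that one function serves all n;
  \<open>ramanujan_sum_power_2\<close> justifies this.\<close>

definition psi :: "nat \<Rightarrow> complex" where
  "psi d = ramanujan_sum d (2 ^ multiplicity 2 d)"

text \<open>Both sides say that \<open>d\<close> is a power of 2.\<close>

lemma dvd_power_2_iff:
  assumes "d > 0" "multiplicity 2 d \<le> k"
  shows "d dvd 2 ^ k \<longleftrightarrow> d dvd 2 ^ multiplicity 2 (d :: nat)"
proof
  assume "d dvd 2 ^ k"
  then obtain i where "d = 2 ^ i" using divides_primepow_nat[of 2 d k] two_is_prime_nat by blast
  thus "d dvd 2 ^ multiplicity 2 d" by simp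
next
  assume "d dvd 2 ^ multiplicity 2 d"
  thus "d dvd 2 ^ k" using assms(2) by (meson dvd_trans le_imp_power_dvd)
qed

text \<open>The sum over all divisors of \<open>d\<close> depends only on whether \<open>d\<close>
  is a power of 2, and the proper divisors are covered by induction; what is left is the term of
  \<open>d\<close> itself.\<close>

lemma ramanujan_sum_power_2:
  "d > 0 \<Longrightarrow> multiplicity 2 d \<le> k \<Longrightarrow> ramanujan_sum d (2 ^ k) = psi d"
proof (induction d arbitrary: k rule: less_induct)
  case (less d)
  let ?D = "{e. e dvd d} - {d}"
  have split: "(\<Sum>e | e dvd d. f e) = f d + (\<Sum>e\<in>?D. f e)" for f :: "nat \<Rightarrow> complex"
    by (rule sum.remove) (use less.prems(1) in simp_all)
  have psi: "ramanujan_sum e (2 ^ k) = psi e" if "e \<in> ?D" "multiplicity 2 d \<le> k" for e k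
  proof (rule less.IH)
    have "e dvd d" "e \<noteq> d" using that(1) by auto
    thus "e > 0" "e < d" using less.prems(1) dvd_pos_nat[of d e] dvd_imp_le[of e d] by simp_all
    have "multiplicity 2 e \<le> multiplicity 2 d" using \<open>e dvd d\<close> less.prems(1) by (intro dvd_imp_multiplicity_le) auto
    thus "multiplicity 2 e \<le> k" using that by simp
  qed
  have "(\<Sum>e | e dvd d. ramanujan_sum e (2 ^ k)) = (\<Sum>e | e dvd d. ramanujan_sum e (2 ^ multiplicity 2 d))"
    unfolding sum_ramanujan_sum[OF less.prems(1)] dvd_power_2_iff[OF less.prems] ..
  moreover have "(\<Sum>e\<in>?D. ramanujan_sum e (2 ^ k)) = (\<Sum>e\<in>?D. psi e)" if "multiplicity 2 d \<le> k" for k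
    using psi that by (intro sum.cong) blast+
  ultimately have "ramanujan_sum d (2 ^ k) = ramanujan_sum d (2 ^ multiplicity 2 d)"
    using less.prems(2) unfolding split by simp
  thus ?case by (simp only: psi_def)
qed

lemma sum_psi:
  assumes "n > 0"
  shows "(\<Sum>d | d dvd n. psi d) = (if n dvd 2 ^ multiplicity 2 n then of_nat n else 0)"
proof -
  have "psi d = ramanujan_sum d (2 ^ multiplicity 2 n)" if "d dvd n" for d
  proof (rule ramanujan_sum_power_2[symmetric])
    show "d > 0" using dvd_pos_nat[OF assms that] .
    show "multiplicity 2 d \<le> multiplicity 2 n" using that assms by (intro dvd_imp_multiplicity_le) auto
  qed
  thus ?thesis using sum_ramanujan_sum[OF assms, of "2 ^ multiplicity 2 n"] by simp
qed

text \<open>For odd n all signs are -1, and 1 is the only odd power of 2. For n = 2 m the sign is +1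
  exactly if d divides m, so the sum is twice the sum of \<open>psi\<close> over the divisors of m
  minus that over the divisors of n. This is 2 m - n = 0 if n is a power of 2, and both sums vanish
  otherwise.\<close>

lemma alternating_sum_psi:
  assumes "n > 0"
  shows "(\<Sum>d | d dvd n. (-1) ^ (n div d) * psi d) = (if n = 1 then -1 else 0)"
proof (cases "even n")
  case False
  have "(-1 :: complex) ^ (n div d) = -1" if "d dvd n" for d
  proof -
    have "n div d * d = n" using that by simp
    hence "odd (n div d)" using False by (metis even_mult_iff)
    thus ?thesis by simp
  qed
  hence "(\<Sum>d | d dvd n. (-1) ^ (n div d) * psi d) = - (\<Sum>d | d dvd n. psi d)"
    by (simp add: sum_negf)
  also have "\<dots> = (if n = 1 then -1 else 0)"
    using False by (simp add: sum_psi[OF assms] not_dvd_imp_multiplicity_0)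
  finally show ?thesis .
next
  case True
  then obtain m where m: "n = 2 * m" by (rule evenE)
  have m0: "m > 0" using m assms by simp
  have even_iff: "even (n div d) \<longleftrightarrow> d dvd m" if dvd: "d dvd n" for d
  proof -
    obtain k where k: "n = d * k" using dvd unfolding dvd_def by blast
    have d: "d > 0" using k assms by simp
    have "n div d = k" using k d by simp
    moreover have "even k \<longleftrightarrow> d dvd m"
    proof
      assume "even k"
      then obtain l where "k = 2 * l" by (rule evenE)
      hence "m = d * l" using k m by simp
      thus "d dvd m" by simp
    next
      assume "d dvd m"
      then obtain l where "m = d * l" unfolding dvd_def by blast
      hence "d * k = d * (2 * l)" using k m by (metis mult.left_commute)
      hence "k = 2 * l" using d by (metis nat_mult_eq_cancel1)
      thus "even k" by simp
    qed
    ultimately show ?thesis by simp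
  qed
  have "(\<Sum>d | d dvd n. (-1) ^ (n div d) * psi d) = (\<Sum>d | d dvd n. 2 * (if d dvd m then psi d else 0) - psi d)"
    by (rule sum.cong) (use even_iff in \<open>auto simp: minus_one_power_iff\<close>)
  also have "\<dots> = 2 * (\<Sum>d | d dvd n. if d dvd m then psi d else 0) - (\<Sum>d | d dvd n. psi d)"
    by (simp add: sum_subtractf sum_distrib_left)
  also have "(\<Sum>d | d dvd n. if d dvd m then psi d else 0) = (\<Sum>d | d dvd m. psi d)"
    by (rule sum.mono_neutral_cong_right) (use assms m in auto)
  also have "2 * (\<Sum>d | d dvd m. psi d) - (\<Sum>d | d dvd n. psi d) = 0"
  proof -
    have "multiplicity 2 n = Suc (multiplicity 2 m)"
      using m m0 by (simp add: multiplicity_times_same)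
    hence "n dvd 2 ^ multiplicity 2 n \<longleftrightarrow> m dvd 2 ^ multiplicity 2 m" by (simp add: m)
    thus ?thesis unfolding sum_psi[OF assms] sum_psi[OF m0] by (simp add: m)
  qed
  finally show ?thesis using True by auto
qed

section \<open>The series \<open>Lie2\<close>\<close>

text \<open>The powers of the cycle that have order d consist of n/d cycles of length d, and
  \<open>sum_by_gcd\<close> collects their character values into a Ramanujan sum. Its argument is
  the power of 2 belonging to n, which may be replaced by the one belonging to d.\<close>

lemma Lie2_expansion:
  assumes "n > 0" "is_n_cycle n (c n)"
  shows "of_nat n * Lie2 c n = (\<Sum>d | d dvd n. const (psi d) * sym_p d ^ (n div d))"
proof -
  interpret n_cycle n "c n" by unfold_locales (use assms in auto)
  let ?k = "multiplicity 2 n"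
  define z where "z = exp (2 * of_real pi * \<i> / of_nat n * 2 ^ ?k)"
  have z_pow: "z ^ (n div d * u) = exp (2 * of_real pi * \<i> * of_nat (2 ^ ?k * u) / of_nat d)" if dvd: "d dvd n" for d u
  proof -
    obtain l where l: "n = d * l" using dvd unfolding dvd_def by blast
    have "d > 0" "l > 0" using l assms by auto
    thus ?thesis unfolding z_def exp_of_nat_mult[symmetric] by (simp add: l field_simps)
  qed
  have inner: "(\<Sum>u | u < d \<and> coprime d u. const (z ^ (n div d * u)) *
      sym_p (n div gcd n (n div d * u)) ^ gcd n (n div d * u)) = const (psi d) * sym_p d ^ (n div d)"
    if d: "d dvd n" for d
  proof -
    have "n div (n div d) = d" using d assms by (auto elim!: dvdE)
    hence "(\<Sum>u | u < d \<and> coprime d u. const (z ^ (n div d * u)) *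
        sym_p (n div gcd n (n div d * u)) ^ gcd n (n div d * u)) =
        (\<Sum>u | u < d \<and> coprime d u. const (exp (2 * of_real pi * \<i> * of_nat (2 ^ ?k * u) / of_nat d)) * sym_p d ^ (n div d))"
      by (intro sum.cong) (simp_all add: gcd_div_mult[OF assms(1) d] z_pow[OF d])
    also have "\<dots> = const (ramanujan_sum d (2 ^ ?k)) * sym_p d ^ (n div d)"
      by (simp only: ramanujan_sum_def const_sum sum_distrib_right)
    also have "ramanujan_sum d (2 ^ ?k) = psi d"
        using dvd_pos_nat[OF assms(1) d] d assms(1)
      by (intro ramanujan_sum_power_2 dvd_imp_multiplicity_le) auto
    finally show ?thesis .
  qed
  have "Lie2 c n = const (1 / of_nat n) * (\<Sum>j<n. const (z ^ j) * sym_p (n div gcd n j) ^ gcd n j)"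
    unfolding Lie2_def frob_char_cyclic z_def ..
  also have "(\<Sum>j<n. const (z ^ j) * sym_p (n div gcd n j) ^ gcd n j) =
      (\<Sum>d | d dvd n. const (psi d) * sym_p d ^ (n div d))"
    unfolding sum_by_gcd[OF assms(1)] by (rule sum.cong) (simp_all add: inner)
  finally have "of_nat n * Lie2 c n = const (of_nat n) * const (1 / of_nat n) * (\<Sum>d | d dvd n. const (psi d) * sym_p d ^ (n div d))"
    by (simp add: const_of_nat mult.assoc)
  thus ?thesis using assms(1) by (simp add: const_mult[symmetric])
qed

lemma
  assumes "n > 0" "is_n_cycle n (c n)"
  shows symmetric_Lie2: "symmetric (Lie2 c n)" and homogeneous_Lie2: "homogeneous n (Lie2 c n)"
proof -
  let ?s = "\<Sum>d | d dvd n. const (psi d) * sym_p d ^ (n div d)"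
  have eq: "Lie2 c n = const (1 / of_nat n) * ?s"
    unfolding Lie2_expansion[where c = c, OF assms, symmetric] using assms(1)
    by (simp add: const_mult[symmetric] mult.assoc[symmetric] flip: const_of_nat)
  show "symmetric (Lie2 c n)" unfolding eq by (intro symmetric_intros(5) symmetric_sum) auto
  have "homogeneous n (sym_p d ^ (n div d))" if "d dvd n" for d
    using homogeneous_power[OF homogeneous_sym_p[of d], of "n div d"] that by simp
  hence "coeff ?s M = 0" if "size M \<noteq> n" for M
    using that unfolding coeff_sum by (intro sum.neutral) (auto simp: homogeneous_def)
  thus "homogeneous n (Lie2 c n)" unfolding eq homogeneous_def by auto
qed

lemma psi_1: "psi 1 = 1"
  using sum_psi[of 1] by simp

lemma Lie2_1:
  assumes "is_n_cycle 1 (c 1)"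
  shows "Lie2 c 1 = sym_p 1"
proof -
  have "{d. d dvd (1 :: nat)} = {1}" by auto
  thus ?thesis using Lie2_expansion[of 1 c] assms psi_1 by simp
qed

text \<open>The logarithmic derivative of H[f] is the sum of (-1)^k psi(d) p_(k d)^m over all
  positive k, d and m. For fixed e = k d the coefficients add up to the alternating sum of
  \<open>psi\<close>, so only e = 1 survives, and -(p_1 + p_1^2 + ...) = 1 - \<open>geo\<close>
  remains.\<close>

lemma H_pm_Lie2:
  assumes c: "\<And>n. n \<ge> 1 \<Longrightarrow> is_n_cycle n (c n)" and s: "(Lie2 c has_sum f) {1..}"
  shows "plethysm H_pm f = 1 - sym_p 1"
proof -
  have sym: "symmetric f"
    by (rule has_sum_symmetric[OF s]) (use symmetric_Lie2 c in force)
  have hom: "homogeneous n (Lie2 c n)" if "n \<ge> 1" for n using homogeneous_Lie2 c that by force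
  have coeff_f: "coeff f N = coeff (Lie2 c (size N)) N" if "N \<noteq> {#}" for N
  proof -
    have "coeff f N = (\<Sum>n\<in>{size N}. coeff (Lie2 c n) N)"
      by (rule has_sum_coeff(2)[OF s]) (use hom that in \<open>auto simp: homogeneous_def Suc_le_eq simp flip: nonempty_has_size\<close>)
    thus ?thesis by simp
  qed
  have pos: "pos f"
    by (rule pos_has_sum[OF s]) (use hom in \<open>force simp: homogeneous_def\<close>)
  \<comment> \<open>Only the component of \<open>f\<close> in degree \<open>size M / k\<close>
    matters, and \<open>euler\<close> supplies the factor with which \<open>Lie2_expansion\<close>
    is stated.\<close>
  have coeff_ps: "coeff (power_subst k (euler f)) M =
      (if k dvd size M then \<Sum>d | d dvd size M div k. psi d * coeff (sym_p (k * d) ^ (size M div (k * d))) M else 0)"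
    if k: "k > 0" and M: "M \<noteq> {#}" for k M
  proof (cases "k dvd size M")
    case True
    define n where "n = size M div k"
    have n: "size M = k * n" "n > 0" using True M k by (auto simp: n_def nonempty_has_size)
    have "coeff (power_subst k (euler f)) M = coeff (power_subst k (of_nat n * Lie2 c n)) M"
    proof (cases "\<exists>N. M = repeat_mset k N")
      case True
      then obtain N where N: "M = repeat_mset k N" ..
      hence "size N = n" "N \<noteq> {#}" using n k M by auto
      thus ?thesis by (simp add: N coeff_power_subst_repeat[OF k] coeff_f)
    qed (simp add: coeff_power_subst_other)
    also have "of_nat n * Lie2 c n = (\<Sum>d | d dvd n. const (psi d) * sym_p d ^ (n div d))"
      by (rule Lie2_expansion) (use n c in auto)
    also have "power_subst k (\<Sum>d | d dvd n. const (psi d) * sym_p d ^ (n div d)) =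
        (\<Sum>d | d dvd n. const (psi d) * sym_p (k * d) ^ (n div d))"
    proof -
      note h = cont_hom_power_subst[OF k]
      show ?thesis
        by (simp add: cont_hom_additiveD(5)[OF h ring_closed_UNIV ring_closed_UNIV]
            cont_homD(2,3,5)[OF h ring_closed_UNIV] power_subst_sym_p[OF k])
    qed
    also have "coeff \<dots> M = (\<Sum>d | d dvd n. psi d * coeff (sym_p (k * d) ^ (size M div (k * d))) M)"
      using k by (simp add: n(1))
    finally show ?thesis using True by (simp add: n_def)
  next
    case False
    hence "M \<noteq> repeat_mset k N" for N by auto
    thus ?thesis using False by (simp add: coeff_power_subst_other)
  qed
  have "((\<lambda>k. const ((-1) ^ k) * power_subst k (euler f)) has_sum (1 - geo)) {1..}"
  proof (rule has_sum_mseriesI[where S = "\<lambda>M. if M = {#} then {} else {k. k dvd size M}"])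
    fix M :: "nat multiset"
    show "finite (if M = {#} then {} else {k. k dvd size M})"
      by (simp add: finite_divisors_nat flip: nonempty_has_size)
    show "(if M = {#} then {} else {k. k dvd size M}) \<subseteq> {1..}"
      using dvd_pos_nat[of "size M"] by (auto simp: Suc_le_eq simp flip: nonempty_has_size)
    show "k \<in> (if M = {#} then {} else {k. k dvd size M})"
      if "k \<in> {1..}" "coeff (const ((-1) ^ k) * power_subst k (euler f)) M \<noteq> 0" for k
      using that coeff_ps[of k M] pos_power_subst[of "euler f" k] by (auto split: if_splits)
    show "coeff (1 - geo) M = (\<Sum>k\<in>(if M = {#} then {} else {k. k dvd size M}).
        coeff (const ((-1) ^ k) * power_subst k (euler f)) M)"
    proof (cases "M = {#}")
      case True
      thus ?thesis by (simp add: coeff_geo)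
    next
      case False
      define n where "n = size M"
      have n: "n > 0" using False by (simp add: n_def nonempty_has_size)
      define P where "P e = coeff (sym_p e ^ (n div e)) M" for e
      have "(\<Sum>k | k dvd n. coeff (const ((-1) ^ k) * power_subst k (euler f)) M) =
          (\<Sum>k | k dvd n. \<Sum>d | d dvd n div k. (-1) ^ k * psi d * P (k * d))"
      proof (rule sum.cong, rule refl)
        fix k assume "k \<in> {k. k dvd n}"
        hence "k dvd n" by simp
        moreover from this have "k > 0" by (rule dvd_pos_nat[OF n])
        ultimately show "coeff (const ((-1) ^ k) * power_subst k (euler f)) M = (\<Sum>d | d dvd n div k. (-1) ^ k * psi d * P (k * d))"
          using coeff_ps[of k M] False by (simp add: n_def P_def sum_distrib_left mult.assoc)
      qed
      also have "\<dots> = (\<Sum>(k, d)\<in>Sigma {k. k dvd n} (\<lambda>k. {d. d dvd n div k}). (-1) ^ k * psi d * P (k * d))"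
        by (rule sum.Sigma) (use n in \<open>auto elim!: dvdE\<close>)
      \<comment> \<open>Regrouping by e = k d turns the exponent k of the sign into e / d, as in
        \<open>alternating_sum_psi\<close>.\<close>
      also have "\<dots> = (\<Sum>(e, d)\<in>Sigma {e. e dvd n} (\<lambda>e. {d. d dvd e}). (-1) ^ (e div d) * psi d * P e)"
      proof (rule sum.reindex_bij_witness[where i = "\<lambda>(e, d). (e div d, d)" and j = "\<lambda>(k, d). (k * d, d)"])
        fix x assume "x \<in> Sigma {k. k dvd n} (\<lambda>k. {d. d dvd n div k})"
        then obtain k d where x: "x = (k, d)" "k dvd n" "d dvd n div k" by auto
        then obtain l where l: "n = k * (d * l)" by (metis dvdE dvd_mult_div_cancel)
        have kd: "k > 0" "d > 0" using l n by auto
        show "(case case x of (k, d) \<Rightarrow> (k * d, d) of (e, d) \<Rightarrow> (e div d, d)) = x" using x kd by simp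
        show "(case x of (k, d) \<Rightarrow> (k * d, d)) \<in> Sigma {e. e dvd n} (\<lambda>e. {d. d dvd e})"
          using x l by (auto simp: mult.assoc[symmetric])
        show "(case case x of (k, d) \<Rightarrow> (k * d, d) of (e, d) \<Rightarrow> (-1) ^ (e div d) * psi d * P e) =
            (case x of (k, d) \<Rightarrow> (-1) ^ k * psi d * P (k * d))" using x kd by simp
      next
        fix x assume "x \<in> Sigma {e. e dvd n} (\<lambda>e. {d. d dvd e})"
        then obtain e d where x: "x = (e, d)" "e dvd n" "d dvd e" by auto
        then obtain k where k: "e = d * k" unfolding dvd_def by blast
        obtain l where l: "n = e * l" using x(2) unfolding dvd_def by blast
        have kd: "k > 0" "d > 0" using l k n by auto
        show "(case case x of (e, d) \<Rightarrow> (e div d, d) of (k, d) \<Rightarrow> (k * d, d)) = x" using x by simp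
        have "e div d = k" "n div k = d * l" using k l kd by (simp_all add: mult_ac)
        thus "(case x of (e, d) \<Rightarrow> (e div d, d)) \<in> Sigma {k. k dvd n} (\<lambda>k. {d. d dvd n div k})"
          using x l k by simp
      qed
      also have "\<dots> = (\<Sum>e | e dvd n. \<Sum>d | d dvd e. (-1) ^ (e div d) * psi d * P e)"
        by (rule sum.Sigma[symmetric]) (use n in \<open>auto elim!: dvdE\<close>)
      also have "\<dots> = (\<Sum>e | e dvd n. if e = 1 then - P 1 else 0)"
      proof (rule sum.cong, rule refl)
        fix e assume "e \<in> {e. e dvd n}"
        hence "e > 0" using dvd_pos_nat[OF n] by blast
        thus "(\<Sum>d | d dvd e. (-1) ^ (e div d) * psi d * P e) = (if e = 1 then - P 1 else 0)"
          unfolding sum_distrib_right[symmetric] alternating_sum_psi[OF \<open>e > 0\<close>] by simp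
      qed
      also have "\<dots> = - P 1" using n by (subst sum.delta) auto
      also have "\<dots> = coeff (1 - geo) M" using False by (simp add: P_def coeff_geo n_def)
      finally show ?thesis using False by (simp add: n_def)
    qed
  qed
  from euler_H_pm_plethysm[OF sym pos this]
  have "euler (plethysm H_pm f) = plethysm H_pm f * (1 - geo)" .
  \<comment> \<open>The claimed value solves the same equation: (1 - p_1)(1 - \<open>geo\<close>) =
    (1 - p_1) - 1 = -p_1.\<close>
  moreover have "euler (1 - sym_p 1) = (1 - sym_p 1) * (1 - geo)"
  proof -
    have "(1 - sym_p 1) * (1 - geo) = (1 - sym_p 1) - geo * (1 - sym_p 1)"
      by (simp add: algebra_simps)
    also have "\<dots> = - sym_p 1" unfolding geo_inverse by simp
    also have "\<dots> = euler (1 - sym_p 1)"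
      using euler_homogeneous[OF homogeneous_sym_p[of 1]] by (simp add: euler_diff)
    finally show ?thesis ..
  qed
  ultimately show ?thesis
  proof (rule euler_ode_unique)
    show "pos (1 - geo)" by (simp add: coeff_geo)
    have "coeff (plethysm H_pm f) {#} = 1"
      using pos_plethysm[of "H_pm - 1" f] pos by (simp add: pleth_simps coeff_H_pm)
    thus "coeff (plethysm H_pm f) {#} = coeff (1 - sym_p 1) {#}" by simp
  qed
qed

theorem theorem2p12:
  fixes c :: "nat \<Rightarrow> nat \<Rightarrow> nat"
  assumes "\<And>n. n \<ge> 1 \<Longrightarrow> is_n_cycle n (c n)"
  shows
   "let ge1 = (\<lambda>L :: nat \<Rightarrow> mseries. \<Sum>\<^sub>\<infinity>n\<in>{1..}. L n);
        ge2 = (\<lambda>L :: nat \<Rightarrow> mseries. \<Sum>\<^sub>\<infinity>n\<in>{2..}. L n);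
        I1 = (\<lambda>L. plethysm (E_series - 1) (ge1 L) = plethysm (\<Sum>\<^sub>\<infinity>r\<in>{1..}. sym_e r) (ge1 L) \<and>
                  plethysm (\<Sum>\<^sub>\<infinity>r\<in>{1..}. sym_e r) (ge1 L) = (\<Sum>\<^sub>\<infinity>n\<in>{1..}. sym_p 1 ^ n));
        I2 = (\<lambda>L. plethysm (1 - H_pm) (ge1 L) =
                    plethysm (\<Sum>\<^sub>\<infinity>r\<in>{1..}. (-1) ^ (r - 1) * sym_h r) (ge1 L) \<and>
                  plethysm (\<Sum>\<^sub>\<infinity>r\<in>{1..}. (-1) ^ (r - 1) * sym_h r) (ge1 L) = sym_p 1);
        I3 = (\<lambda>L. plethysm (1 - H_pm) (ge2 L) =
                    plethysm (\<Sum>\<^sub>\<infinity>r\<in>{1..}. (-1) ^ (r - 1) * sym_h r) (ge2 L) \<and>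
                  plethysm (\<Sum>\<^sub>\<infinity>r\<in>{1..}. (-1) ^ (r - 1) * sym_h r) (ge2 L) = omega kappa);
        I3' = (\<lambda>L. \<forall>n\<ge>2. deg_part n (\<Sum>r\<le>n. (-1) ^ r * plethysm (sym_h (n - r)) (ge2 L)) =
                    (-1) ^ (n - 1) * schur (2 # replicate (n - 2) 1));
        I4 = (\<lambda>L. ge2 L = plethysm (ge1 L) (omega kappa));
        I5 = (\<lambda>L. ((\<lambda>k. ((plethysm (omega kappa)) ^^ k) (omega kappa)) has_sum ge2 L) UNIV);
        I6 = (\<lambda>L. plethysm (E_series - 1) (ge2 L) = (\<Sum>\<^sub>\<infinity>r\<in>{1..}. plethysm (sym_e r) (ge2 L)) \<and>
                  (\<Sum>\<^sub>\<infinity>r\<in>{1..}. plethysm (sym_e r) (ge2 L)) =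
                    mseries_inv (1 - sym_p 1) * H_pm - 1 \<and>
                  mseries_inv (1 - sym_p 1) * H_pm - 1 =
                    (\<Sum>\<^sub>\<infinity>n\<in>{2..}. \<Sum>k=0..n. (-1) ^ k * sym_p 1 ^ (n - k) * sym_h k))
    in
      (I1 (Lie2 c) \<and> I2 (Lie2 c) \<and> I3 (Lie2 c) \<and> I3' (Lie2 c) \<and>
       I4 (Lie2 c) \<and> I5 (Lie2 c) \<and> I6 (Lie2 c)) \<and>
      (\<forall>L. L 1 = sym_p 1 \<and> (\<forall>n\<ge>1. symmetric (L n) \<and> homogeneous n (L n)) \<longrightarrow>
         (I1 L \<longleftrightarrow> I2 L) \<and> (I2 L \<longleftrightarrow> I3 L) \<and> (I3 L \<longleftrightarrow> I3' L) \<and>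
         (I3 L \<longleftrightarrow> I4 L) \<and> (I4 L \<longleftrightarrow> I5 L) \<and> (I5 L \<longleftrightarrow> I6 L))"
proof -
  define ge1 where "ge1 L = (\<Sum>\<^sub>\<infinity>n\<in>{1..}. L n)" for L :: "nat \<Rightarrow> mseries"
  define ge2 where "ge2 L = (\<Sum>\<^sub>\<infinity>n\<in>{2..}. L n)" for L :: "nat \<Rightarrow> mseries"
  \<comment> \<open>Since \<open>Lie2 c\<close> is good, the equivalences for good families also
    carry (2) over to the other identities for \<open>Lie2 c\<close>.\<close>
  define good where "good L \<longleftrightarrow> L 1 = sym_p 1 \<and> (\<forall>n\<ge>1. symmetric (L n) \<and> homogeneous n (L n))" for L
  have good: "(L has_sum ge1 L) {1..}" "symmetric (ge2 L)" "ord_ge 2 (ge2 L)" "pos (ge2 L)"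
    "ge1 L = sym_p 1 + ge2 L" "pos (ge1 L)" "symmetric (ge1 L)" if "good L" for L
  proof -
    have ord: "ord_ge n (L n)" if "n \<ge> 1" for n
      using \<open>good L\<close> that by (force simp: good_def homogeneous_def ord_ge_def)
    show s1: "(L has_sum ge1 L) {1..}"
      unfolding ge1_def by (rule has_sum_ord_ge) (simp add: ord)
    have s2: "(L has_sum ge2 L) {2..}"
      unfolding ge2_def by (rule has_sum_ord_ge) (simp add: ord)
    show sym: "symmetric (ge2 L)"
      by (rule has_sum_symmetric[OF s2]) (use that in \<open>simp add: good_def\<close>)
    show o2: "ord_ge 2 (ge2 L)" unfolding ord_ge_def
    proof (intro allI impI)
      fix M :: "nat multiset" assume "size M < 2"
      hence "coeff (L n) M = 0" if "n \<in> {2..}" for n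
        using ord[of n] that by (simp add: ord_ge_def)
      thus "coeff (ge2 L) M = 0" using has_sum_coeff(2)[OF s2, of "{}" M] by auto
    qed
    thus pos: "pos (ge2 L)" by (rule pos_if_ord_ge_2)
    have "(L has_sum L 1 + ge2 L) {1..}" by (rule has_sum_shift) (use s2 in \<open>simp add: numeral_2_eq_2\<close>)
    hence "ge1 L = L 1 + ge2 L" by (rule has_sum_unique[OF s1])
    thus eq: "ge1 L = sym_p 1 + ge2 L" using that by (simp add: good_def)
    show "pos (ge1 L)" "symmetric (ge1 L)" using eq pos sym by auto
  qed
  have good_Lie2: "good (Lie2 c)"
    unfolding good_def using Lie2_1[of c] symmetric_Lie2[of _ c] homogeneous_Lie2[of _ c] assms
    by (auto simp: Suc_le_eq)
  have I2_Lie2: "plethysm H_pm (ge1 (Lie2 c)) = 1 - sym_p 1"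
    by (rule H_pm_Lie2[OF assms good(1)[OF good_Lie2]])
  \<comment> \<open>Matching the goal binds each identity as a function of the two summation
    operators, so that it can be instantiated at \<open>ge1\<close> and \<open>ge2\<close> without
    being written out again.\<close>
  let "let g1 = _; g2 = _; I1 = ?J1 g1 g2; I2 = ?J2 g1 g2; I3 = ?J3 g1 g2; I3' = ?J4 g1 g2;
      I4 = ?J5 g1 g2; I5 = ?J6 g1 g2; I6 = ?J7 g1 g2 in _" = ?thesis
  let ?I1 = "?J1 ge1 ge2" and ?I2 = "?J2 ge1 ge2" and ?I3 = "?J3 ge1 ge2" and ?I3' = "?J4 ge1 ge2"
    and ?I4 = "?J5 ge1 ge2" and ?I5 = "?J6 ge1 ge2" and ?I6 = "?J7 ge1 ge2"
  have equiv: "?I1 L \<longleftrightarrow> ?I2 L" "?I2 L \<longleftrightarrow> ?I3 L" "?I3 L \<longleftrightarrow> ?I3' L" "?I3 L \<longleftrightarrow> ?I4 L"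
    "?I4 L \<longleftrightarrow> ?I5 L" "?I5 L \<longleftrightarrow> ?I6 L" and I2_iff: "?I2 L \<longleftrightarrow> plethysm H_pm (ge1 L) = 1 - sym_p 1"
    if L: "good L" for L
  proof -
    note g = good[OF L]
    show I2: "?I2 L \<longleftrightarrow> plethysm H_pm (ge1 L) = 1 - sym_p 1" by (rule identity_2[OF g(6)])
    show "?I1 L \<longleftrightarrow> ?I2 L" unfolding I2 by (rule identity_1[OF g(6)])
    have H: "plethysm H_pm (ge1 L) = 1 - sym_p 1 \<longleftrightarrow> plethysm H_pm (ge2 L) = 1 - hooks"
      unfolding g(5) by (rule H_pm_hooks_iff[OF g(2,4)])
    have I3: "?I3 L \<longleftrightarrow> plethysm H_pm (ge2 L) = 1 - hooks"
      unfolding omega_kappa by (rule identity_2[OF g(4)])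
    show "?I2 L \<longleftrightarrow> ?I3 L" unfolding I2 I3 by (rule H)
    have "?I3' L \<longleftrightarrow> (\<forall>n\<ge>2. deg_part n (\<Sum>r\<le>n. (-1) ^ r * plethysm (sym_h (n - r)) (ge2 L)) =
        (-1) ^ (n - 1) * (sym_e (n - 1) * sym_e 1 - sym_e n))"
      by (intro all_cong1 imp_cong refl) (simp only: schur_near_column)
    also have "\<dots> \<longleftrightarrow> plethysm H_pm (ge2 L) = 1 - hooks"
      by (rule identity_3_degreewise[OF g(2,3)])
    finally have I3': "?I3' L \<longleftrightarrow> plethysm H_pm (ge2 L) = 1 - hooks" .
    show "?I3 L \<longleftrightarrow> ?I3' L" by (rule trans[OF I3 I3'[symmetric]])
    have 4: "?I4 L \<longleftrightarrow> plethysm H_pm (ge2 L) = 1 - hooks"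
    proof
      \<comment> \<open>\<open>ge2 (Lie2 c)\<close> solves (4) as well, so by uniqueness the two
        sums coincide and \<open>L\<close> inherits the value of H on its sum.\<close>
      assume I4: "?I4 L"
      note g' = good[OF good_Lie2]
      have "ge2 L = ge2 (Lie2 c)"
      proof (rule identity_4_unique[OF g(2,4) g'(2,4)])
        show "ge2 L = plethysm (sym_p 1 + ge2 L) hooks" using I4 unfolding omega_kappa g(5) .
        show "ge2 (Lie2 c) = plethysm (sym_p 1 + ge2 (Lie2 c)) hooks"
          by (rule identity_4[OF g'(2,4)]) (use I2_Lie2 in \<open>simp only: g'(5)\<close>)
      qed
      hence "ge1 L = ge1 (Lie2 c)" unfolding g(5) g'(5) by simp
      thus "plethysm H_pm (ge2 L) = 1 - hooks" using I2_Lie2 H by simp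
    next
      assume "plethysm H_pm (ge2 L) = 1 - hooks"
      hence "plethysm H_pm (sym_p 1 + ge2 L) = 1 - sym_p 1" using H g(5) by simp
      thus "?I4 L" unfolding omega_kappa g(5) by (rule identity_4[OF g(2,4)])
    qed
    show "?I3 L \<longleftrightarrow> ?I4 L" by (rule trans[OF I3 4[symmetric]])
    have 45: "?I4 L \<longleftrightarrow> ?I5 L"
      unfolding omega_kappa g(5) by (rule identity_4_iff_5[OF g(2,4) symmetric_hooks ord_ge_hooks])
    thus "?I4 L \<longleftrightarrow> ?I5 L" .
    have 6: "?I6 L \<longleftrightarrow> plethysm H_pm (ge2 L) = 1 - hooks" by (rule identity_6[OF g(2,4)])
    show "?I5 L \<longleftrightarrow> ?I6 L" by (rule trans[OF 45[symmetric] trans[OF 4 6[symmetric]]])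
  qed
  note e = equiv[OF good_Lie2]
  have i2: "?I2 (Lie2 c)" by (rule iffD2[OF I2_iff[OF good_Lie2] I2_Lie2])
  note i1 = iffD2[OF e(1) i2]
  note i3 = iffD1[OF e(2) i2]
  note i3' = iffD1[OF e(3) i3]
  note i4 = iffD1[OF e(4) i3]
  note i5 = iffD1[OF e(5) i4]
  note i6 = iffD1[OF e(6) i5]
  have Lie2: "?I1 (Lie2 c) \<and> ?I2 (Lie2 c) \<and> ?I3 (Lie2 c) \<and> ?I3' (Lie2 c) \<and> ?I4 (Lie2 c) \<and> ?I5 (Lie2 c) \<and> ?I6 (Lie2 c)"
    by (rule conjI[OF i1 conjI[OF i2 conjI[OF i3 conjI[OF i3' conjI[OF i4 conjI[OF i5 i6]]]]]])
  have all: "\<forall>L. good L \<longrightarrow> (?I1 L \<longleftrightarrow> ?I2 L) \<and> (?I2 L \<longleftrightarrow> ?I3 L) \<and> (?I3 L \<longleftrightarrow> ?I3' L) \<and>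
      (?I3 L \<longleftrightarrow> ?I4 L) \<and> (?I4 L \<longleftrightarrow> ?I5 L) \<and> (?I5 L \<longleftrightarrow> ?I6 L)"
  proof (intro allI impI)
    fix L assume "good L"
    note e = equiv[OF this]
    show "(?I1 L \<longleftrightarrow> ?I2 L) \<and> (?I2 L \<longleftrightarrow> ?I3 L) \<and> (?I3 L \<longleftrightarrow> ?I3' L) \<and>
        (?I3 L \<longleftrightarrow> ?I4 L) \<and> (?I4 L \<longleftrightarrow> ?I5 L) \<and> (?I5 L \<longleftrightarrow> ?I6 L)"
      by (rule conjI[OF e(1) conjI[OF e(2) conjI[OF e(3) conjI[OF e(4) conjI[OF e(5) e(6)]]]]])
  qed
  show ?thesis
    unfolding Let_def
    by (rule conjI[OF Lie2[unfolded ge1_def ge2_def] all[unfolded good_def ge1_def ge2_def]])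
qed

end
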